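(* Let $\alpha$ be an irrational real number and $\beta\in\mathbb{R}$. There exists an increasing sequence $(x_k)_{k\in\mathbb{N}}$ of positive integers such that the following holds: for every fixed $\varepsilon>0$, if $2\le y<x_k^{1/2}$, $y<z\le x_k$ and $\delta=x_k^{-1/4+\varepsilon}$, then $$\sum_{\substack{n\in S(x_k;y,z)\\ \lVert \alpha n+\beta\rVert<\delta}}1 \;=\; 2\delta\,\Psi(x_k;y,z)+O\big(x_k^{3/4+\varepsilon/2+o(1)}\big),$$ where the error term means: for every fixed $\eta>0$ the difference is $\ll x_k^{3/4+\varepsilon/2+\eta}$ for all sufficiently large $k$. Moreover, for every fixed positive integer $A$, the same asymptotic formula holds for the sequence $x_k=k$ ($k\in\mathbb{N}$), uniformly for all $\alpha\in\mathcal{I}(A)$.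
   Context: For real $x$, $\lVert x\rVert=\min_{v\in\mathbb{Z}}|x-v|$ denotes the distance from $x$ to the nearest integer. For real numbers $0<y\le z\le x$, $S(x;y,z)=\{a\in[1,x]\cap\mathbb{N}: p\mid a \text{ (p prime)}\implies p\in[y,z]\}$ is the set of integers in $[1,x]$ all of whose prime factors lie in $[y,z]$, and $\Psi(x;y,z)=\#S(x;y,z)$. For a positive integer $A$, $\mathcal{I}(A)=\{\alpha\in\mathbb{R}\setminus\mathbb{Q}: \alpha=[a_0;a_1,a_2,\ldots],\ |a_j|\le A \text{ for all } j\ge 0\}$, where $[a_0;a_1,\ldots]$ is the continued fraction expansion of $\alpha$.
   Formalization: The formula is proved for 0 < ε < 1/4 instead of every ε > 0; for ε ≥ 1/4 one has δ ≥ 1, so the count equals Ψ, and with y = 2, z = x_k the difference (2δ−1)x_k exceeds the stated error term, so the claim fails there. *)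

theory Defs
  imports Complex_Main "HOL-Computational_Algebra.Primes"
begin

definition dist_nint :: "real \<Rightarrow> real" where
  "dist_nint x = (INF v::int. \<bar>x - of_int v\<bar>)"

text \<open>The infimum over the integers is attained, so it is the minimum.\<close>

lemma dist_nint_attained: "\<exists>v::int. dist_nint x = \<bar>x - of_int v\<bar>"
proof -
  have "dist_nint x = \<bar>x - of_int (round x)\<bar>"
    unfolding dist_nint_def
    by (rule cInf_eq_minimum) (auto intro: round_diff_minimal)
  then show ?thesis ..
qed

lemma dist_nint_le: "dist_nint x \<le> \<bar>x - of_int v\<bar>"
  unfolding dist_nint_def by (rule cINF_lower) (auto intro: bdd_belowI[where m = 0])

definition S_set :: "real \<Rightarrow> real \<Rightarrow> real \<Rightarrow> nat set" where
  "S_set x y z =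
     {a. 1 \<le> a \<and> real a \<le> x \<and> (\<forall>p. prime p \<and> p dvd a \<longrightarrow> y \<le> real p \<and> real p \<le> z)}"

definition Psi :: "real \<Rightarrow> real \<Rightarrow> real \<Rightarrow> nat" where
  "Psi x y z = card (S_set x y z)"

text \<open>Complete quotients and partial quotients of the regular continued fraction
  expansion. For irrational \<open>\<alpha>\<close> the expansion is infinite and no denominator vanishes.\<close>

fun cf_complete_quotient :: "real \<Rightarrow> nat \<Rightarrow> real" where
  "cf_complete_quotient \<alpha> 0 = \<alpha>"
| "cf_complete_quotient \<alpha> (Suc j) =
     1 / (cf_complete_quotient \<alpha> j - of_int \<lfloor>cf_complete_quotient \<alpha> j\<rfloor>)"

definition cf_partial_quotient :: "real \<Rightarrow> nat \<Rightarrow> int" where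
  "cf_partial_quotient \<alpha> j = \<lfloor>cf_complete_quotient \<alpha> j\<rfloor>"

definition bounded_quotients :: "nat \<Rightarrow> real set" where
  "bounded_quotients A = {\<alpha>. \<alpha> \<notin> \<rat> \<and> (\<forall>j. \<bar>cf_partial_quotient \<alpha> j\<bar> \<le> int A)}"

text \<open>The asymptotic formula along the sequence \<open>x\<close>, uniformly for \<open>\<alpha>\<close> in \<open>B\<close>: the
  implied constant and the threshold for \<open>k\<close> do not depend on \<open>\<alpha> \<in> B\<close>, \<open>y\<close>, \<open>z\<close>.
  The bound \<open>\<epsilon> < 1/4\<close> is the usual tacit requirement that \<open>\<delta>\<close> tends to \<open>0\<close>. For
  \<open>\<epsilon> \<ge> 1/4\<close> we have \<open>\<delta> \<ge> 1\<close>, the left-hand count is all of \<open>\<Psi>\<close>, and the formula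
  fails, e.g. for \<open>y = 2\<close>, \<open>z = x k\<close>.\<close>

definition asymptotic_formula :: "real set \<Rightarrow> real \<Rightarrow> (nat \<Rightarrow> nat) \<Rightarrow> bool" where
  "asymptotic_formula B \<beta> x \<longleftrightarrow>
     (\<forall>\<epsilon> \<eta>. 0 < \<epsilon> \<and> \<epsilon> < 1 / 4 \<and> 0 < \<eta> \<longrightarrow>
       (\<exists>C. \<forall>\<^sub>F k in sequentially. \<forall>\<alpha>\<in>B. \<forall>y z \<delta> :: real.
          2 \<le> y \<and> y < real (x k) powr (1 / 2) \<and> y < z \<and> z \<le> real (x k) \<and>
          \<delta> = real (x k) powr (- 1 / 4 + \<epsilon>) \<longrightarrow>
          \<bar>real (card {n \<in> S_set (x k) y z. dist_nint (\<alpha> * real n + \<beta>) < \<delta>})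
             - 2 * \<delta> * real (Psi (x k) y z)\<bar>
            \<le> C * real (x k) powr (3 / 4 + \<epsilon> / 2 + \<eta>)))"

end

theory Submission
  imports Defs "HOL-Analysis.Kronecker_Approximation_Theorem" "HOL-Analysis.Harmonic_Numbers"
    "HOL-Computational_Algebra.Squarefree" "HOL-Real_Asymp.Real_Asymp"
begin

text \<open>Write \<open>X = u\<^sup>4\<close> and replace the indicator of \<open>\<parallel>t\<parallel> < \<delta>\<close> by a sum of shifted Fejer kernels; this
  leaves an exponential sum \<open>W(n) = \<Sum>\<^sub>h c\<^sub>h e(\<alpha> h n)\<close> with \<open>c\<^sub>h \<lless> min(\<delta>, 1/|h|)\<close> to be summed over
  the sifted set. If \<open>\<alpha> l\<close> is at distance about \<open>u\<^sup>-\<^sup>2\<close> from the integers for all \<open>l\<close> up to about \<open>u\<^sup>2\<close>, then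
  Cauchy-Schwarz bounds every bilinear sum \<open>\<Sum>\<^sub>m |\<Sum>\<^sub>k b\<^sub>k W(k m)|\<close> with \<open>k \<le> u\<^sup>2\<close>, \<open>m \<le> u\<^sup>3\<close> by
  \<open>X\<^sup>3\<^sup>/\<^sup>4 (u \<delta>)\<^sup>1\<^sup>/\<^sup>2\<close> up to \<open>X\<^sup>o\<^sup>(\<^sup>1\<^sup>)\<close>. An integer without prime factors above \<open>u\<^sup>2\<close> has a
  divisor in \<open>[u, u\<^sup>2]\<close> formed by its largest prime factors, and a prime factor in \<open>(u\<^sup>2, u\<^sup>3]\<close> is itself a
  suitable factor \<open>m\<close>. A prime factor above \<open>u\<^sup>3\<close> is detected by the sieve of Eratosthenes up to \<open>u\<^sup>2\<close>;
  the sieving divisors are either small, which gives linear sums, or again have a divisor in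
  \<open>[u, u\<^sup>2]\<close>. The conditions linking \<open>k\<close> and \<open>m\<close> are inequalities, and a discrete Fourier expansion
  removes them at the cost of a logarithm.\<close>

section \<open>Geometric sums at spaced points\<close>

text \<open>The Diophantine input fixes the scale. For a general irrational \<alpha> the multiples
  \<alpha> l with l up to about q are spaced by about 1/q when q is the denominator of a good
  rational approximation; the argument needs this with q = u^2 = X^(1/2), so X is taken to be q^2.
  Bounded partial quotients give the spacing at every scale, so every X is allowed. The exponent
  arises as follows. After Cauchy-Schwarz with k \<le> K, m of size M and K M \<le> X, the
  frequencies in the first block contribute about X \<delta> M, at most X \<delta> u^3. All other
  terms are at most about X u^2, which is no larger since \<delta> u \<ge> 1. The square root is
  X^(3/4) (u \<delta>)^(1/2), and u \<delta> = X^\<epsilon>. Thus m \<le> u^3 is the limit of the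
  method. The obstacle is an integer m p with m < u and a prime p > u^3: its divisors lie below u or
  above u^3, none in [u, u^2]. No bilinear structure is visible until the primality of p itself is
  written as a sum over divisors.\<close>

lemma dist_nint_eq_round: "dist_nint x = \<bar>x - of_int (round x)\<bar>"
  unfolding dist_nint_def
  by (rule cInf_eq_minimum) (auto intro: round_diff_minimal)

lemma dist_nint_nonneg [simp]: "0 \<le> dist_nint x"
  by (simp add: dist_nint_eq_round)

lemma dist_nint_le_half: "dist_nint x \<le> 1 / 2"
  using of_int_round_abs_le[of x] by (simp add: dist_nint_eq_round abs_minus_commute)

lemma dist_nint_minus: "dist_nint (- x) = dist_nint x"
proof -
  have le: "dist_nint (- a) \<le> dist_nint a" for a :: real
  proof -
    obtain v :: int where v: "dist_nint a = \<bar>a - of_int v\<bar>"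
      using dist_nint_attained by blast
    show ?thesis
      using dist_nint_le[of "- a" "- v"] v by simp
  qed
  show ?thesis
    using le[of x] le[of "- x"] by simp
qed

lemma dist_nint_add_int: "dist_nint (x + of_int n) = dist_nint x"
proof -
  have le: "dist_nint (a + of_int m) \<le> dist_nint a" for a :: real and m :: int
  proof -
    obtain v :: int where v: "dist_nint a = \<bar>a - of_int v\<bar>"
      using dist_nint_attained by blast
    show ?thesis
      using dist_nint_le[of "a + of_int m" "v + m"] v by simp
  qed
  show ?thesis
    using le[of x n] le[of "x + of_int n" "- n"] by simp
qed

lemma dist_nint_le_abs: "dist_nint x \<le> \<bar>x\<bar>"
  using dist_nint_le[of x 0] by simp

lemma dist_nint_eq_abs: "\<bar>x\<bar> \<le> 1 / 2 \<Longrightarrow> dist_nint x = \<bar>x\<bar>"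
proof (rule antisym)
  assume x: "\<bar>x\<bar> \<le> 1 / 2"
  obtain v :: int where v: "dist_nint x = \<bar>x - of_int v\<bar>"
    using dist_nint_attained by blast
  show "\<bar>x\<bar> \<le> dist_nint x"
  proof (cases "v = 0")
    case False
    then have "1 \<le> \<bar>real_of_int v\<bar>"
      by linarith
    then show ?thesis
      using v x by linarith
  qed (use v in simp)
qed (rule dist_nint_le_abs)

section \<open>The character \<open>ee\<close> and the majorant \<open>phi\<close> of geometric
  sums\<close>

definition ee :: "real \<Rightarrow> complex" where
  "ee t = cis (2 * pi * t)"

lemma norm_ee [simp]: "norm (ee t) = 1"
  by (simp add: ee_def)

lemma ee_add: "ee (s + t) = ee s * ee t"
  by (simp add: ee_def cis_mult ring_distribs)

lemma ee_0 [simp]: "ee 0 = 1"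
  by (simp add: ee_def)

lemma cnj_ee: "cnj (ee t) = ee (- t)"
  by (simp add: ee_def cis_cnj)

lemma ee_of_int [simp]: "ee (of_int n) = 1"
  using cis_multiple_2pi[of "of_int n"] by (simp add: ee_def mult.commute mult.left_commute)

lemma ee_of_nat_mult: "ee (of_nat n * t) = ee t ^ n"
  unfolding ee_def Complex.DeMoivre by (simp add: algebra_simps)

text \<open>The norm is 2 |sin (pi s)| for the representative s of t closest to 0. The weak bound
  sin w \<ge> w/2 already gives pi |s| \<ge> 2 |s|. The factor 2 cancels later against the two end
  terms of a telescoped geometric sum.\<close>

lemma norm_one_minus_ee: "2 * dist_nint t \<le> norm (1 - ee t)"
proof -
  define s where "s = t - of_int (round t)"
  have s: "\<bar>s\<bar> = dist_nint t" "\<bar>s\<bar> \<le> 1 / 2"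
    using dist_nint_le_half[of t] by (auto simp: s_def dist_nint_eq_round)
  have "ee t = cis (2 * pi * s)"
    using ee_add[of s "of_int (round t)"] by (simp add: s_def ee_def)
  then have "norm (1 - ee t) ^ 2 = (1 - cos (2 * pi * s))\<^sup>2 + (sin (2 * pi * s))\<^sup>2"
    by (simp add: cmod_power2)
  also have "\<dots> = 2 - 2 * cos (2 * pi * s)"
    using sin_cos_squared_add[of "2 * pi * s"] by (simp add: power2_eq_square algebra_simps)
  also have "\<dots> = (2 * \<bar>sin (pi * s)\<bar>)\<^sup>2"
    using cos_double_sin[of "pi * s"] by (simp add: power_mult_distrib mult.assoc)
  finally have n: "norm (1 - ee t) = 2 * \<bar>sin (pi * s)\<bar>"
    using power2_eq_iff_nonneg[of "norm (1 - ee t)" "2 * \<bar>sin (pi * s)\<bar>"] by simp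
  define w where "w = pi * \<bar>s\<bar>"
  \<comment> \<open>1.6 is a rational bound for pi/2, small enough for the Taylor error: w^3/6 \<le>
    2.56 w/6 \<le> w/2.\<close>
  have w: "0 \<le> w" "w \<le> 1.6"
  proof -
    have "w \<le> 3.2 * (1 / 2)"
      unfolding w_def using s(2) pi_less_4 pi_approx by (intro mult_mono) auto
    then show "w \<le> 1.6" by simp
  qed (simp add: w_def)
  have "\<bar>sin w - w\<bar> \<le> w ^ 3 / 6"
    using Maclaurin_sin_bound[of w 3] w(1)
    by (simp add: eval_nat_numeral sin_coeff_def)
  moreover have "w ^ 3 \<le> 1.6 * 1.6 * w"
  proof -
    have "w * w * w \<le> 1.6 * 1.6 * w"
      using w by (intro mult_right_mono mult_mono) auto
    then show ?thesis
      by (simp add: power3_eq_cube)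
  qed
  ultimately have "sin w \<ge> w / 2"
    using w by linarith
  moreover have "\<bar>sin (pi * s)\<bar> \<ge> sin w"
    by (cases "s \<ge> 0") (auto simp: w_def)
  ultimately have "norm (1 - ee t) \<ge> w"
    using n by linarith
  moreover have "w \<ge> 2 * \<bar>s\<bar>"
    unfolding w_def using pi_ge_two by (intro mult_right_mono) auto
  ultimately show ?thesis
    using s by simp
qed

text \<open>The usual majorant min(Y, 1/\<parallel>t\<parallel>) of a geometric sum of Y terms.
  Testing the product keeps the value \<open>Y\<close> at integers t, where the quotient 1/0 would
  be 0.\<close>

definition phi :: "real \<Rightarrow> real \<Rightarrow> real" where
  "phi Y t = (if Y * dist_nint t \<le> 1 then Y else 1 / dist_nint t)"

lemma phi_nonneg: "0 \<le> Y \<Longrightarrow> 0 \<le> phi Y t"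
  by (simp add: phi_def)

lemma phi_le: "0 \<le> Y \<Longrightarrow> phi Y t \<le> Y"
  by (auto simp: phi_def divide_le_eq not_le mult.commute leD[OF dist_nint_nonneg])

lemma phi_mult_le: "phi Y t * dist_nint t \<le> 1"
  by (auto simp: phi_def)

text \<open>For Y \<ge> 0, together with \<open>phi_le\<close> and \<open>phi_mult_le\<close>, this
  characterises \<open>phi Y t\<close> as the largest v satisfying both bounds.\<close>

lemma le_phi: "v \<le> Y \<Longrightarrow> v * dist_nint t \<le> 1 \<Longrightarrow> v \<le> phi Y t"
proof -
  assume v: "v \<le> Y" "v * dist_nint t \<le> 1"
  show ?thesis
  proof (cases "Y * dist_nint t \<le> 1")
    case False
    then have "dist_nint t \<noteq> 0" by auto
    then have "0 < dist_nint t" by (simp add: less_le)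
    then show ?thesis using False v by (simp add: phi_def le_divide_eq)
  qed (use v in \<open>simp add: phi_def\<close>)
qed

lemma phi_mono: "0 \<le> Y \<Longrightarrow> Y \<le> Y' \<Longrightarrow> phi Y t \<le> phi Y' t"
  using phi_le[of Y t] by (intro le_phi phi_mult_le) auto

text \<open>Multiplication by 1 - e(t) telescopes the sum to two unimodular terms, and |1 - e(t)|
  \<ge> 2 \<parallel>t\<parallel>; the two factors 2 cancel.\<close>

lemma norm_geometric_ee:
  "norm (\<Sum>n\<in>{a..<b}. ee (of_nat n * t)) \<le> phi (real (b - a)) t"
proof (rule le_phi)
  let ?S = "\<Sum>n\<in>{a..<b}. ee (of_nat n * t)"
  have "norm ?S \<le> (\<Sum>n\<in>{a..<b}. 1)"
    by (rule order.trans[OF norm_sum]) simp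
  then show "norm ?S \<le> real (b - a)"
    by simp
  have "(1 - ee t) * ?S = (if a \<le> b then ee t ^ a - ee t ^ b else 0)"
  proof (cases "a \<le> b")
    case True
    then obtain c where c: "b = a + c"
      using le_Suc_ex by blast
    have "(1 - z) * (\<Sum>n\<in>{a..<a + c}. z ^ n) = z ^ a - z ^ (a + c)" for z :: complex
    proof (induction c)
      case (Suc c)
      have "(1 - z) * (\<Sum>n\<in>{a..<a + Suc c}. z ^ n) = (1 - z) * (\<Sum>n\<in>{a..<a + c}. z ^ n) + (1 - z) * z ^ (a + c)"
        by (simp add: distrib_left)
      also have "\<dots> = z ^ a - z ^ (a + Suc c)"
        unfolding Suc by (simp add: algebra_simps)
      finally show ?case .
    qed simp
    then show ?thesis
      unfolding c ee_of_nat_mult by simp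
  qed auto
  then have "norm (1 - ee t) * norm ?S \<le> norm (ee t ^ a) + norm (ee t ^ b)"
    by (metis norm_mult norm_triangle_ineq4 norm_zero add_nonneg_nonneg norm_ge_zero)
  then have "norm (1 - ee t) * norm ?S \<le> 2"
    by (simp add: norm_power)
  moreover have "2 * dist_nint t * norm ?S \<le> norm (1 - ee t) * norm ?S"
    by (intro mult_right_mono norm_one_minus_ee) auto
  ultimately show "norm ?S * dist_nint t \<le> 1"
    by (simp add: mult.commute)
qed

lemma norm_geometric_ee_int:
  "norm (\<Sum>n\<in>{a..<b::int}. ee (of_int n * t)) \<le> phi (real_of_int (max 0 (b - a))) t"
proof -
  define c where "c = nat (b - a)"
  have *: "(\<Sum>n\<in>{a..<b}. ee (of_int n * t)) = (\<Sum>n\<in>{0..<c}. ee (of_int a * t) * ee (of_nat n * t))"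
    by (rule sum.reindex_bij_witness[of _ "\<lambda>n. a + int n" "\<lambda>n. nat (n - a)"])
       (auto simp: c_def algebra_simps simp flip: ee_add)
  have "norm (\<Sum>n\<in>{a..<b}. ee (of_int n * t)) = norm (\<Sum>n\<in>{0..<c}. ee (of_nat n * t))"
    unfolding * by (simp add: norm_mult flip: sum_distrib_left)
  also have "\<dots> \<le> phi (real c) t"
    using norm_geometric_ee[of t 0 c] by simp
  also have "real c = real_of_int (max 0 (b - a))"
    by (simp add: c_def)
  finally show ?thesis .
qed

text \<open>Multiplication by the common ratio shifts the range by one. The term that leaves and the
  term that enters agree, because their exponents differ by the integer c. Hence the sum vanishes
  unless the ratio is 1, that is, unless c / (2n) is an integer.\<close>

lemma sum_ee_orthogonality:
  fixes c :: int and n :: nat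
  assumes "0 < n"
  shows "(\<Sum>t\<in>{- int n..<int n}. ee (of_int t * (of_int c / (2 * real n)))) =
           (if 2 * int n dvd c then of_nat (2 * n) else 0)"
proof (cases "2 * int n dvd c")
  case True
  then obtain d where d: "c = 2 * int n * d" ..
  have "ee (of_int t * (of_int c / (2 * real n))) = 1" for t
    using ee_of_int[of "t * d"] assms by (simp add: d)
  then show ?thesis
    using True by simp
next
  case False
  define w where "w = ee (of_int c / (2 * real n))"
  have "w \<noteq> 1"
  proof
    assume "w = 1"
    then have "dist_nint (of_int c / (2 * real n)) = 0"
      using norm_one_minus_ee[of "of_int c / (2 * real n)"] by (simp add: w_def antisym)
    then obtain v :: int where "real_of_int c / (2 * real n) = of_int v"
      by (auto simp: dist_nint_eq_round)
    then have "real_of_int c = of_int (2 * int n * v)"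
      using assms by (simp add: field_simps)
    then have "c = 2 * int n * v"
      by (simp only: of_int_eq_iff)
    with False show False by simp
  qed
  let ?g = "\<lambda>t::int. ee (of_int t * (of_int c / (2 * real n)))"
  have "w * sum ?g {- int n..<int n} = (\<Sum>t\<in>{- int n..<int n}. ?g (t + 1))"
    by (simp add: sum_distrib_left w_def algebra_simps add_divide_distrib flip: ee_add)
  also have "\<dots> = sum ?g {- int n + 1..<int n + 1}"
    by (rule sum.reindex_bij_witness[of _ "\<lambda>t. t - 1" "\<lambda>t. t + 1"]) auto
  also have "\<dots> = sum ?g {- int n + 1..<int n} + ?g (int n)"
  proof -
    have "{- int n + 1..<int n + 1} = insert (int n) {- int n + 1..<int n}"
      using assms by auto
    then show ?thesis by simp
  qed
  also have "?g (int n) = ?g (- int n)"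
    using assms ee_add[of "of_int (- int n) * (of_int c / (2 * real n))" "of_int c"]
    by (simp add: field_simps)
  also have "sum ?g {- int n + 1..<int n} + ?g (- int n) = sum ?g {- int n..<int n}"
  proof -
    have "{- int n..<int n} = insert (- int n) {- int n + 1..<int n}"
      using assms by auto
    then show ?thesis by simp
  qed
  finally have "(w - 1) * sum ?g {- int n..<int n} = 0"
    by (simp add: algebra_simps)
  with \<open>w \<noteq> 1\<close> False show ?thesis by simp
qed

text \<open>The integers \<open>\<lfloor>t/\<kappa>\<rfloor>\<close>, where \<open>t\<close> is the representative of \<open>f i\<close> modulo 1 closest to 0,
  are distinct; comparing with them gives a harmonic sum.\<close>

lemma spaced_sum:
  fixes f :: "'a \<Rightarrow> real"
  assumes fin: "finite I" and \<kappa>: "0 < \<kappa>" and Y: "0 \<le> Y"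
    and sp: "\<And>i j. i \<in> I \<Longrightarrow> j \<in> I \<Longrightarrow> i \<noteq> j \<Longrightarrow> \<kappa> \<le> dist_nint (f i - f j)"
    and N: "1 / (2 * \<kappa>) \<le> real N"
  shows "(\<Sum>i\<in>I. phi Y (f i)) \<le> 2 * Y + 2 / \<kappa> * harm N"
proof -
  define s where "s i = f i - of_int (round (f i))" for i
  define g where "g i = \<lfloor>s i / \<kappa>\<rfloor>" for i
  have s: "\<bar>s i\<bar> = dist_nint (f i)" "\<bar>s i\<bar> \<le> 1 / 2" for i
    using dist_nint_le_half[of "f i"] by (auto simp: s_def dist_nint_eq_round)
  have inj: "inj_on g I"
  proof (rule inj_onI, rule ccontr)
    fix i j assume ij: "i \<in> I" "j \<in> I" "g i = g j" "i \<noteq> j"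
    have "\<bar>s i / \<kappa> - s j / \<kappa>\<bar> < 1"
      using ij(3) unfolding g_def by linarith
    then have "\<bar>s i - s j\<bar> < \<kappa>"
      using \<kappa> by (simp add: field_simps flip: diff_divide_distrib)
    moreover have "dist_nint (f i - f j) \<le> \<bar>s i - s j\<bar>"
      using dist_nint_le[of "f i - f j" "round (f i) - round (f j)"] by (simp add: s_def algebra_simps)
    ultimately show False
      using sp[OF ij(1,2,4)] by linarith
  qed
  \<comment> \<open>A point in cell k lies at distance at least \<kappa> k from 0 if k > 0, and at
    least \<kappa> (- k - 1) if k < 0. The cells 0 and -1 touch 0 and admit only the trivial bound
    \<open>Y\<close>.\<close>
  define b where "b k = (if k = 0 \<or> k = -1 then Y else 1 / (\<kappa> * of_int (if k > 0 then k else - k - 1)))" for k :: int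
  have bnn: "0 \<le> b k" for k
    using Y \<kappa> by (auto simp: b_def intro!: divide_nonneg_nonneg mult_nonneg_nonneg)
  have le: "phi Y (f i) \<le> b (g i)" for i
  proof (cases "g i = 0 \<or> g i = -1")
    case True
    then show ?thesis using phi_le[OF Y] by (simp add: b_def)
  next
    case False
    define k where "k = (if g i > 0 then g i else - g i - 1)"
    have k: "0 < k" using False by (auto simp: k_def)
    have "of_int k \<le> \<bar>s i\<bar> / \<kappa>"
    proof (cases "g i > 0")
      case True
      then have "of_int k \<le> s i / \<kappa>" by (simp add: k_def g_def)
      also have "\<dots> \<le> \<bar>s i\<bar> / \<kappa>" using \<kappa> by (simp add: divide_right_mono)
      finally show ?thesis .
    next
      case F: False
      have "s i / \<kappa> \<le> of_int (g i) + 1" unfolding g_def by linarith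
      then have "of_int k \<le> - (s i / \<kappa>)" using F by (simp add: k_def)
      also have "\<dots> = (- s i) / \<kappa>" by simp
      also have "\<dots> \<le> \<bar>s i\<bar> / \<kappa>" using \<kappa> by (intro divide_right_mono) auto
      finally show ?thesis .
    qed
    then have "\<kappa> * of_int k \<le> dist_nint (f i)"
      using \<kappa> s(1)[of i] by (simp add: field_simps)
    then have "phi Y (f i) * (\<kappa> * of_int k) \<le> phi Y (f i) * dist_nint (f i)"
      by (intro mult_left_mono phi_nonneg Y)
    also have "\<dots> \<le> 1" by (rule phi_mult_le)
    finally show ?thesis
      using False \<kappa> k unfolding b_def k_def by (auto simp: field_simps)
  qed
  have rng: "g ` I \<subseteq> {- int N - 1..int N}"
  proof clarify
    fix i
    have "\<bar>s i / \<kappa>\<bar> \<le> (1 / 2) / \<kappa>"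
      unfolding abs_divide using s(2)[of i] \<kappa> by (simp add: field_simps)
    then have "\<bar>s i / \<kappa>\<bar> \<le> real N" using N by simp
    then show "g i \<in> {- int N - 1..int N}" unfolding g_def by (auto; linarith)
  qed
  have half: "(\<Sum>k=1..n. 1 / (\<kappa> * real k)) = harm n / \<kappa>" for n
    by (simp add: harm_def sum_divide_distrib inverse_eq_divide mult.commute)
  have "(\<Sum>i\<in>I. phi Y (f i)) \<le> (\<Sum>i\<in>I. b (g i))"
    by (intro sum_mono le)
  also have "\<dots> = sum b (g ` I)"
    by (simp add: sum.reindex[OF inj])
  also have "\<dots> \<le> sum b {- int N - 1..int N}"
    by (intro sum_mono2 rng bnn) auto
  also have "{- int N - 1..int N} = {0, -1} \<union> ({1..int N} \<union> {- int N - 1..-2})"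
    by auto
  also have "sum b \<dots> = sum b {0, -1} + sum b ({1..int N} \<union> {- int N - 1..-2})"
    by (rule sum.union_disjoint) auto
  also have "sum b ({1..int N} \<union> {- int N - 1..-2}) = sum b {1..int N} + sum b {- int N - 1..-2}"
    by (rule sum.union_disjoint) auto
  also have "sum b {0, -1} = 2 * Y"
    by (simp add: b_def)
  also have "sum b {1..int N} = (\<Sum>k=1..N. 1 / (\<kappa> * real k))"
    by (rule sum.reindex_bij_witness[of _ int nat]) (auto simp: b_def)
  also have "sum b {- int N - 1..-2} = (\<Sum>k=1..N. 1 / (\<kappa> * real k))"
    by (rule sum.reindex_bij_witness[of _ "\<lambda>k. - int k - 1" "\<lambda>k. nat (- k - 1)"]) (auto simp: b_def)
  finally show ?thesis
    unfolding half by simp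
qed

lemma dist_nint_fraction_ge:
  fixes c m :: int
  assumes "0 < m" "\<not> m dvd c"
  shows "1 / real_of_int m \<le> dist_nint (of_int c / of_int m)"
proof -
  obtain v :: int where v: "dist_nint (of_int c / of_int m) = \<bar>of_int c / of_int m - of_int v\<bar>"
    using dist_nint_attained by blast
  have "c - m * v \<noteq> 0"
    using assms(2) by auto
  then have "1 \<le> \<bar>c - m * v\<bar>"
    by linarith
  then have "1 \<le> \<bar>real_of_int c - of_int m * of_int v\<bar>"
    by (metis of_int_1_le_iff of_int_abs of_int_diff of_int_mult)
  then have "1 / real_of_int m \<le> \<bar>real_of_int c - of_int m * of_int v\<bar> / of_int m"
    using assms(1) by (simp add: divide_right_mono)
  also have "\<dots> = \<bar>(real_of_int c - of_int m * of_int v) / of_int m\<bar>"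
    using assms(1) by (simp add: abs_divide)
  also have "(real_of_int c - of_int m * of_int v) / of_int m = of_int c / of_int m - of_int v"
    using assms(1) by (simp add: diff_divide_distrib)
  finally show ?thesis
    using v by simp
qed

text \<open>The index set stays within one period, so the grid points are spaced by 1/(2n) modulo 1,
  and n cells on each side of 0 suffice.\<close>

lemma sum_phi_grid:
  assumes n: "0 < n" and J: "J \<subseteq> {- int n..<int n}"
  shows "(\<Sum>j\<in>J. phi (real n) (s - of_int j / (2 * real n))) \<le> 2 * real n * (1 + 2 * harm n)"
proof -
  have "(\<Sum>j\<in>J. phi (real n) (s - of_int j / (2 * real n)))
      \<le> 2 * real n + 2 / (1 / (2 * real n)) * harm n"
  proof (rule spaced_sum)
    show "finite J"
      using J finite_subset by blast
    fix i j assume ij: "i \<in> J" "j \<in> J" "i \<noteq> j"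
    have "\<not> 2 * int n dvd j - i"
    proof
      assume "2 * int n dvd j - i"
      then have "\<bar>2 * int n\<bar> \<le> \<bar>j - i\<bar>"
        using ij by (intro dvd_imp_le_int) auto
      then show False
        using ij J by (auto simp: subset_iff) (smt (verit))
    qed
    then have "1 / real_of_int (2 * int n) \<le> dist_nint (of_int (j - i) / of_int (2 * int n))"
      using n by (intro dist_nint_fraction_ge) auto
    then show "1 / (2 * real n) \<le> dist_nint (s - of_int i / (2 * real n) - (s - of_int j / (2 * real n)))"
      by (simp add: diff_divide_distrib)
  qed (use n in auto)
  then show ?thesis
    by (simp add: algebra_simps)
qed

section \<open>Separation of variables\<close>

text \<open>The relation a \<le> b holds iff j + a - b = 0 for some j in [0, n). Since |j + a - b| <
  2n, this equation can be tested modulo 2n by orthogonality. The coefficients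
  \<open>\<gamma>\<close> are the Fourier coefficients of the interval [0, n) in Z/2n, with
  logarithmic sum of norms because each is a geometric sum.\<close>

lemma fourier_of_bool_le:
  fixes n :: nat
  assumes n: "0 < n"
  obtains \<gamma> :: "int \<Rightarrow> complex"
  where "(\<Sum>t\<in>{- int n..<int n}. norm (\<gamma> t)) \<le> 1 + 2 * harm n"
    and "\<And>a b. a < n \<Longrightarrow> b < n \<Longrightarrow> of_bool (a \<le> b) =
           (\<Sum>t\<in>{- int n..<int n}. \<gamma> t * ee (of_int t * (real a / (2 * real n)))
                                      * ee (- (of_int t * (real b / (2 * real n)))))"
proof
  let ?T = "{- int n..<int n}"
  define \<gamma> where "\<gamma> t = (\<Sum>j\<in>{0..<n}. ee (of_nat j * (of_int t / (2 * real n)))) / (2 * real n)" for t :: int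
  have "(\<Sum>t\<in>?T. norm (\<gamma> t)) \<le> (\<Sum>t\<in>?T. phi (real n) (0 - of_int t / (2 * real n)) / (2 * real n))"
  proof (rule sum_mono)
    fix t :: int
    have "norm (\<Sum>j\<in>{0..<n}. ee (of_nat j * (of_int t / (2 * real n)))) \<le> phi (real n) (of_int t / (2 * real n))"
      using norm_geometric_ee[of "of_int t / (2 * real n)" 0 n] by simp
    also have "\<dots> = phi (real n) (0 - of_int t / (2 * real n))"
      by (simp add: phi_def dist_nint_minus)
    finally show "norm (\<gamma> t) \<le> phi (real n) (0 - of_int t / (2 * real n)) / (2 * real n)"
      using n by (simp add: \<gamma>_def norm_divide norm_mult divide_right_mono)
  qed
  also have "\<dots> = (\<Sum>t\<in>?T. phi (real n) (0 - of_int t / (2 * real n))) / (2 * real n)"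
    by (simp add: sum_divide_distrib)
  also have "\<dots> \<le> 2 * real n * (1 + 2 * harm n) / (2 * real n)"
    using n by (intro divide_right_mono sum_phi_grid) auto
  also have "\<dots> = 1 + 2 * harm n"
    using n by simp
  finally show "(\<Sum>t\<in>?T. norm (\<gamma> t)) \<le> 1 + 2 * harm n" .
  fix a b :: nat assume ab: "a < n" "b < n"
  have "(\<Sum>t\<in>?T. \<gamma> t * ee (of_int t * (real a / (2 * real n))) * ee (- (of_int t * (real b / (2 * real n)))))
      = (\<Sum>t\<in>?T. \<Sum>j\<in>{0..<n}. ee (of_int t * (of_int (int j + int a - int b) / (2 * real n))) / (2 * real n))"
  proof (rule sum.cong[OF refl])
    fix t :: int
    have "ee (of_nat j * (of_int t / (2 * real n))) * ee (of_int t * (real a / (2 * real n)))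
             * ee (- (of_int t * (real b / (2 * real n))))
           = ee (of_int t * (of_int (int j + int a - int b) / (2 * real n)))" for j
      by (simp add: diff_divide_distrib add_divide_distrib algebra_simps flip: ee_add)
    then show "\<gamma> t * ee (of_int t * (real a / (2 * real n))) * ee (- (of_int t * (real b / (2 * real n))))
        = (\<Sum>j\<in>{0..<n}. ee (of_int t * (of_int (int j + int a - int b) / (2 * real n))) / (2 * real n))"
      by (simp add: \<gamma>_def sum_divide_distrib sum_distrib_right)
  qed
  also have "\<dots> = (\<Sum>j\<in>{0..<n}. (\<Sum>t\<in>?T. ee (of_int t * (of_int (int j + int a - int b) / (2 * real n)))) / (2 * real n))"
    by (subst sum.swap) (simp add: sum_divide_distrib)
  also have "\<dots> = (\<Sum>j\<in>{0..<n}. if int j + int a = int b then 1 else 0)"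
  proof (rule sum.cong[OF refl])
    fix j assume j: "j \<in> {0..<n}"
    have "2 * int n dvd int j + int a - int b \<longleftrightarrow> int j + int a = int b"
    proof
      assume d: "2 * int n dvd int j + int a - int b"
      show "int j + int a = int b"
      proof (rule ccontr)
        assume "int j + int a \<noteq> int b"
        then have "\<bar>2 * int n\<bar> \<le> \<bar>int j + int a - int b\<bar>"
          using d by (intro dvd_imp_le_int) auto
        then show False using j ab by auto
      qed
    qed auto
    then show "(\<Sum>t\<in>?T. ee (of_int t * (of_int (int j + int a - int b) / (2 * real n)))) / (2 * real n)
       = (if int j + int a = int b then 1 else 0)"
      using n unfolding sum_ee_orthogonality[OF n] by simp
  qed
  also have "\<dots> = (\<Sum>j\<in>{0..<n}. if j = b - a \<and> a \<le> b then 1 else 0)"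
    by (intro sum.cong) auto
  also have "\<dots> = of_bool (a \<le> b)"
    using ab by (cases "a \<le> b") (auto simp: sum.delta')
  finally show "of_bool (a \<le> b) = (\<Sum>t\<in>?T. \<gamma> t * ee (of_int t * (real a / (2 * real n)))
      * ee (- (of_int t * (real b / (2 * real n)))))" by simp
qed

text \<open>The fibres of \<open>R\<close> over \<Omega> form a chain. This makes
  \<open>R w k\<close> equivalent to a comparison of two integers, one attached to w and one to
  k.\<close>

definition coupling :: "'w set \<Rightarrow> 'k set \<Rightarrow> ('w \<Rightarrow> 'k \<Rightarrow> bool) \<Rightarrow> bool" where
  "coupling \<Omega> K R \<longleftrightarrow> (\<forall>w\<in>\<Omega>. \<forall>w'\<in>\<Omega>. {k\<in>K. R w k} \<subseteq> {k\<in>K. R w' k} \<or> {k\<in>K. R w' k} \<subseteq> {k\<in>K. R w k})"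

text \<open>With c(w) the size of the fibre over w and t(k) the smallest size of a fibre containing
  k, the relation becomes t(k) \<le> c(w), to which \<open>fourier_of_bool_le\<close> applies. The
  phase in k is absorbed into the coefficients \<open>b\<close>, over which the hypothesis is
  uniform; the phase in w has norm 1.\<close>

lemma remove_coupling:
  fixes f :: "'w \<Rightarrow> 'k \<Rightarrow> complex"
  assumes fin: "finite \<Omega>" "finite K" and R: "coupling \<Omega> K R"
    and V: "\<And>b. (\<forall>k. norm (b k) \<le> 1) \<Longrightarrow> (\<Sum>w\<in>\<Omega>. norm (\<Sum>k\<in>K. b k * f w k)) \<le> V"
    and b: "\<forall>k. norm (b k) \<le> 1"
  shows "(\<Sum>w\<in>\<Omega>. norm (\<Sum>k\<in>K. b k * (of_bool (R w k) * f w k))) \<le> (1 + 2 * harm (card K + 2)) * V"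
proof -
  define n where "n = card K + 2"
  define c where "c w = card {k\<in>K. R w k}" for w
  \<comment> \<open>If no fibre contains k, the default \<open>card K + 1\<close> exceeds every c(w)
    and is still below \<open>n\<close>.\<close>
  define t where "t k = Min (insert (card K + 1) {c w | w. w \<in> \<Omega> \<and> R w k})" for k
  have fin': "finite (insert (card K + 1) {c w | w. w \<in> \<Omega> \<and> R w k})" for k
    using fin by simp
  have c_le: "c w \<le> card K" for w
    unfolding c_def using fin by (intro card_mono) auto
  have t_less: "t k < n" for k
    using Min_le[OF fin', of "card K + 1" k] unfolding t_def n_def by simp
  have R_iff: "R w k \<longleftrightarrow> t k \<le> c w" if "w \<in> \<Omega>" "k \<in> K" for w k
  proof
    assume "R w k"
    then show "t k \<le> c w"
      unfolding t_def using that by (intro Min_le fin') auto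
  next
    assume le: "t k \<le> c w"
    have "t k \<in> insert (card K + 1) {c w | w. w \<in> \<Omega> \<and> R w k}"
      unfolding t_def by (rule Min_in[OF fin']) auto
    moreover have "t k \<noteq> card K + 1"
      using le c_le[of w] by linarith
    ultimately obtain w' where w': "w' \<in> \<Omega>" "R w' k" "t k = c w'"
      by auto
    \<comment> \<open>In a chain, a fibre of no larger cardinality is contained in the other
      one.\<close>
    have "{k\<in>K. R w' k} \<subseteq> {k\<in>K. R w k}"
    proof (rule ccontr)
      assume "\<not> {k\<in>K. R w' k} \<subseteq> {k\<in>K. R w k}"
      then have "{k\<in>K. R w k} \<subset> {k\<in>K. R w' k}"
        using R that w' unfolding coupling_def by blast
      then have "c w < c w'"
        unfolding c_def using fin by (intro psubset_card_mono) auto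
      with le w' show False by simp
    qed
    then show "R w k"
      using w' that by auto
  qed
  obtain \<gamma> where \<gamma>: "(\<Sum>t\<in>{- int n..<int n}. norm (\<gamma> t)) \<le> 1 + 2 * harm n"
    "\<And>a b. a < n \<Longrightarrow> b < n \<Longrightarrow> of_bool (a \<le> b) =
           (\<Sum>t\<in>{- int n..<int n}. \<gamma> t * ee (of_int t * (real a / (2 * real n)))
                                      * ee (- (of_int t * (real b / (2 * real n)))))"
    using fourier_of_bool_le[of n] unfolding n_def by auto
  let ?T = "{- int n..<int n}"
  define B where "B s k = ee (of_int s * (real (t k) / (2 * real n))) * b k" for s :: int and k
  have B: "\<forall>k. norm (B s k) \<le> 1" for s
    using b by (simp add: B_def norm_mult)
  have V0: "0 \<le> V"
    using V[OF b] by (meson norm_ge_zero order.trans sum_nonneg)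
  have "(\<Sum>w\<in>\<Omega>. norm (\<Sum>k\<in>K. b k * (of_bool (R w k) * f w k)))
      \<le> (\<Sum>w\<in>\<Omega>. \<Sum>s\<in>?T. norm (\<gamma> s) * norm (\<Sum>k\<in>K. B s k * f w k))"
  proof (rule sum_mono)
    fix w assume w: "w \<in> \<Omega>"
    have "(\<Sum>k\<in>K. b k * (of_bool (R w k) * f w k))
        = (\<Sum>k\<in>K. \<Sum>s\<in>?T. \<gamma> s * ee (- (of_int s * (real (c w) / (2 * real n)))) * (B s k * f w k))"
    proof (rule sum.cong[OF refl])
      fix k assume k: "k \<in> K"
      have "c w < n"
        using c_le[of w] by (simp add: n_def)
      then show "b k * (of_bool (R w k) * f w k)
        = (\<Sum>s\<in>?T. \<gamma> s * ee (- (of_int s * (real (c w) / (2 * real n)))) * (B s k * f w k))"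
        unfolding R_iff[OF w k] \<gamma>(2)[OF t_less \<open>c w < n\<close>]
        by (simp add: sum_distrib_left sum_distrib_right B_def mult_ac)
    qed
    also have "\<dots> = (\<Sum>s\<in>?T. \<gamma> s * ee (- (of_int s * (real (c w) / (2 * real n)))) * (\<Sum>k\<in>K. B s k * f w k))"
      by (subst sum.swap) (simp add: sum_distrib_left)
    also have "norm \<dots> \<le> (\<Sum>s\<in>?T. norm (\<gamma> s) * norm (\<Sum>k\<in>K. B s k * f w k))"
      by (rule order.trans[OF norm_sum]) (simp add: norm_mult)
    finally show "norm (\<Sum>k\<in>K. b k * (of_bool (R w k) * f w k))
        \<le> (\<Sum>s\<in>?T. norm (\<gamma> s) * norm (\<Sum>k\<in>K. B s k * f w k))" .
  qed
  also have "\<dots> = (\<Sum>s\<in>?T. norm (\<gamma> s) * (\<Sum>w\<in>\<Omega>. norm (\<Sum>k\<in>K. B s k * f w k)))"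
    by (subst sum.swap) (simp add: sum_distrib_left)
  also have "\<dots> \<le> (\<Sum>s\<in>?T. norm (\<gamma> s) * V)"
    by (intro sum_mono mult_left_mono V B) auto
  also have "\<dots> = (\<Sum>s\<in>?T. norm (\<gamma> s)) * V"
    by (simp add: sum_distrib_right)
  also have "\<dots> \<le> (1 + 2 * harm n) * V"
    using \<gamma>(1) V0 by (intro mult_right_mono) auto
  finally show ?thesis
    by (simp add: n_def)
qed

text \<open>Weights that separate into a factor in w and a factor in k, up to the indicators of
  \<open>n\<close> chain relations. The counter records the number of logarithms that their removal
  costs.\<close>

inductive coupled :: "'w set \<Rightarrow> 'k set \<Rightarrow> nat \<Rightarrow> ('w \<Rightarrow> 'k \<Rightarrow> complex) \<Rightarrow> bool"
  for \<Omega> K where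
  product: "(\<forall>w. norm (a w) \<le> 1) \<Longrightarrow> (\<forall>k. norm (b k) \<le> 1) \<Longrightarrow> coupled \<Omega> K 0 (\<lambda>w k. a w * b k)"
| couple: "coupled \<Omega> K n g \<Longrightarrow> coupling \<Omega> K R \<Longrightarrow> coupled \<Omega> K (Suc n) (\<lambda>w k. of_bool (R w k) * g w k)"

text \<open>The induction generalises \<open>f\<close> and \<open>V\<close>: the outermost indicator
  moves from the weight into \<open>f\<close>, and \<open>remove_coupling\<close> supplies the
  hypothesis for the new \<open>f\<close> with \<open>V\<close> enlarged by one logarithm.\<close>

lemma coupled_bound:
  fixes f :: "'w \<Rightarrow> 'k \<Rightarrow> complex"
  assumes "coupled \<Omega> K n g" "finite \<Omega>" "finite K"
    and "\<And>b. (\<forall>k. norm (b k) \<le> 1) \<Longrightarrow> (\<Sum>w\<in>\<Omega>. norm (\<Sum>k\<in>K. b k * f w k)) \<le> V"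
  shows "(\<Sum>w\<in>\<Omega>. norm (\<Sum>k\<in>K. g w k * f w k)) \<le> (1 + 2 * harm (card K + 2)) ^ n * V"
  using assms
proof (induction arbitrary: f V rule: coupled.induct)
  case (product a b)
  have "(\<Sum>w\<in>\<Omega>. norm (\<Sum>k\<in>K. a w * b k * f w k)) \<le> (\<Sum>w\<in>\<Omega>. norm (\<Sum>k\<in>K. b k * f w k))"
  proof (rule sum_mono)
    fix w
    have "norm (\<Sum>k\<in>K. a w * b k * f w k) = norm (a w) * norm (\<Sum>k\<in>K. b k * f w k)"
      by (simp add: mult.assoc flip: sum_distrib_left norm_mult)
    then show "norm (\<Sum>k\<in>K. a w * b k * f w k) \<le> norm (\<Sum>k\<in>K. b k * f w k)"
      using product(1) by (simp add: mult_left_le_one_le)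
  qed
  then show ?case
    using product(5)[OF product(2)] by simp
next
  case (couple n g R)
  have "(\<Sum>w\<in>\<Omega>. norm (\<Sum>k\<in>K. g w k * (of_bool (R w k) * f w k)))
      \<le> (1 + 2 * harm (card K + 2)) ^ n * ((1 + 2 * harm (card K + 2)) * V)"
    by (rule couple.IH[OF couple.prems(1,2)])
       (rule remove_coupling[OF couple.prems(1,2) couple.hyps(2) couple.prems(3)])
  then show ?case
    by (simp add: mult_ac)
qed

section \<open>Fejer approximation of an interval modulo 1\<close>

text \<open>Fejer kernels shifted to the 2Q grid points j/(2Q) form a partition of unity by
  trigonometric polynomials of degree below Q. The approximant is the sum of the kernels centred in
  [-\<delta>, \<delta>]. Its error at t is the mass of the kernels centred on the wrong side, and
  these centres are no closer to t than the nearer of \<delta> and -\<delta>.\<close>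

lemma fejer_approximation:
  fixes Q :: nat and \<delta> :: real
  assumes Q: "0 < Q" and \<delta>: "0 \<le> \<delta>" "\<delta> < 1 / 2"
  obtains c :: "int \<Rightarrow> complex"
  where "\<And>h. norm (c h) \<le> 2 * \<delta> + 1 / real Q"
    and "\<And>h. \<bar>h\<bar> < int Q \<Longrightarrow> of_int \<bar>h\<bar> * norm (c h) \<le> 1"
    and "norm (c 0 - 2 * \<delta>) \<le> 1 / real Q"
    and "\<And>t. norm (of_bool (dist_nint t < \<delta>) - (\<Sum>h\<in>{- int Q<..<int Q}. c h * ee (of_int h * t)))
           \<le> (1 + 2 * harm Q) * (phi (real Q) (t - \<delta>) + phi (real Q) (t + \<delta>)) / real Q"
proof
  define L :: real where "L = 1 + 2 * harm Q"
  \<comment> \<open>The normalisation gives total mass 1: summed over the 2Q grid points, only the Q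
    diagonal pairs survive, each contributing 2Q / (2 Q^2).\<close>
  define D where "D s = (norm (\<Sum>a\<in>{0..<Q}. ee (of_nat a * s)))\<^sup>2 / (2 * (real Q)\<^sup>2)" for s
  define x where "x j = of_int j / (2 * real Q)" for j :: int
  let ?T = "{- int Q..<int Q}"
  define r where "r = \<lfloor>2 * real Q * \<delta>\<rfloor>"
  define J where "J = {- r..r}"
  define w where "w h = (\<Sum>j\<in>J. ee (- (of_int h * x j))) / (2 * (real Q)\<^sup>2)" for h
  define A where "A h = {p \<in> {0..<Q} \<times> {0..<Q}. int (fst p) - int (snd p) = h}" for h
  define c where "c h = of_nat (card (A h)) * w h" for h
  have L1: "1 \<le> L"
    by (simp add: L_def harm_nonneg)
  have "2 * real Q * \<delta> < real_of_int (int Q)"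
    using Q \<delta>(2) by (simp add: field_simps)
  then have r: "0 \<le> r" "r < int Q" "of_int r \<le> 2 * real Q * \<delta>" "2 * real Q * \<delta> < of_int r + 1"
    unfolding r_def using \<delta>(1) by (auto simp: floor_less_iff)
  have D0: "0 \<le> D s" for s
    by (simp add: D_def)
  have D_expand: "complex_of_real (D s) = (\<Sum>p\<in>{0..<Q} \<times> {0..<Q}. ee (of_int (int (fst p) - int (snd p)) * s)) / (2 * (real Q)\<^sup>2)" for s
  proof -
    have "complex_of_real ((norm (\<Sum>a\<in>{0..<Q}. ee (of_nat a * s)))\<^sup>2)
       = (\<Sum>a\<in>{0..<Q}. ee (of_nat a * s)) * cnj (\<Sum>a\<in>{0..<Q}. ee (of_nat a * s))"
      by (rule complex_norm_square)
    also have "\<dots> = (\<Sum>a\<in>{0..<Q}. \<Sum>b\<in>{0..<Q}. ee (of_int (int a - int b) * s))"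
      by (simp add: sum_product cnj_ee algebra_simps flip: ee_add)
    also have "\<dots> = (\<Sum>p\<in>{0..<Q} \<times> {0..<Q}. ee (of_int (int (fst p) - int (snd p)) * s))"
      by (simp add: sum.cartesian_product case_prod_beta)
    finally show ?thesis
      by (simp add: D_def)
  qed
  have D_sum: "complex_of_real (\<Sum>j\<in>I. D (t - x j)) =
      (\<Sum>p\<in>{0..<Q} \<times> {0..<Q}. ee (of_int (int (fst p) - int (snd p)) * t) *
         ((\<Sum>j\<in>I. ee (- (of_int (int (fst p) - int (snd p)) * x j))) / (2 * (real Q)\<^sup>2)))" for I t
  proof -
    have "complex_of_real (\<Sum>j\<in>I. D (t - x j)) =
      (\<Sum>j\<in>I. \<Sum>p\<in>{0..<Q} \<times> {0..<Q}. ee (of_int (int (fst p) - int (snd p)) * t) *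
          ee (- (of_int (int (fst p) - int (snd p)) * x j)) / (2 * (real Q)\<^sup>2))"
      unfolding of_real_sum D_expand
      by (simp add: sum_divide_distrib algebra_simps flip: ee_add)
    also have "\<dots> = (\<Sum>p\<in>{0..<Q} \<times> {0..<Q}. \<Sum>j\<in>I. ee (of_int (int (fst p) - int (snd p)) * t) *
          ee (- (of_int (int (fst p) - int (snd p)) * x j)) / (2 * (real Q)\<^sup>2))"
      by (rule sum.swap)
    finally show ?thesis
      by (simp add: sum_distrib_left sum_divide_distrib)
  qed
  have total: "(\<Sum>j\<in>?T. D (t - x j)) = 1" for t
  proof -
    have "complex_of_real (\<Sum>j\<in>?T. D (t - x j)) =
      (\<Sum>p\<in>{0..<Q} \<times> {0..<Q}. if fst p = snd p then 1 / of_nat Q else 0)"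
      unfolding D_sum
    proof (rule sum.cong[OF refl])
      fix p assume p: "p \<in> {0..<Q} \<times> {0..<Q}"
      let ?h = "int (fst p) - int (snd p)"
      have "(\<Sum>j\<in>?T. ee (- (of_int ?h * x j))) = (\<Sum>j\<in>?T. ee (of_int j * (of_int (- ?h) / (2 * real Q))))"
        by (intro sum.cong refl arg_cong[of _ _ ee]) (simp add: x_def field_simps)
      also have "\<dots> = (if 2 * int Q dvd - ?h then of_nat (2 * Q) else 0)"
        by (rule sum_ee_orthogonality[OF Q])
      also have "2 * int Q dvd - ?h \<longleftrightarrow> fst p = snd p"
      proof
        assume d: "2 * int Q dvd - ?h"
        show "fst p = snd p"
        proof (rule ccontr)
          assume "fst p \<noteq> snd p"
          then have "\<bar>2 * int Q\<bar> \<le> \<bar>- ?h\<bar>"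
            using d by (intro dvd_imp_le_int) auto
          then show False using p by (auto simp: mem_Times_iff)
        qed
      qed auto
      finally show "ee (of_int ?h * t) * ((\<Sum>j\<in>?T. ee (- (of_int ?h * x j))) / (2 * (real Q)\<^sup>2))
           = (if fst p = snd p then 1 / of_nat Q else 0)"
        using Q by (simp add: power2_eq_square)
    qed
    also have "\<dots> = (\<Sum>a\<in>{0..<Q}. \<Sum>b\<in>{0..<Q}. if a = b then 1 / of_nat Q else 0)"
      unfolding sum.cartesian_product by (rule sum.cong) (auto simp: case_prod_beta)
    also have "\<dots> = 1"
      using Q by (simp add: sum.delta)
    finally show ?thesis
      using of_real_eq_1_iff by blast
  qed
  \<comment> \<open>The kernel is at most phi^2 / (2 Q^2). One factor \<open>phi\<close> is
    cancelled by the distance \<rho>, the other is summed over the grid.\<close>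
  have tail: "(\<Sum>j\<in>I. D (t - x j)) * \<rho> * real Q \<le> L"
    if I: "I \<subseteq> ?T" and \<rho>: "0 \<le> \<rho>" "\<And>j. j \<in> I \<Longrightarrow> \<rho> \<le> dist_nint (t - x j)" for I t \<rho>
  proof -
    have "(\<Sum>j\<in>I. D (t - x j)) * \<rho> = (\<Sum>j\<in>I. D (t - x j) * \<rho>)"
      by (simp add: sum_distrib_right)
    also have "\<dots> \<le> (\<Sum>j\<in>I. phi (real Q) (t - x j) / (2 * (real Q)\<^sup>2))"
    proof (rule sum_mono)
      fix j assume j: "j \<in> I"
      let ?p = "phi (real Q) (t - x j)"
      have p0: "0 \<le> ?p" by (simp add: phi_nonneg)
      have "(norm (\<Sum>a\<in>{0..<Q}. ee (of_nat a * (t - x j))))\<^sup>2 \<le> ?p\<^sup>2"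
        using norm_geometric_ee[of "t - x j" 0 Q] by (intro power_mono) auto
      then have "D (t - x j) * \<rho> \<le> ?p\<^sup>2 / (2 * (real Q)\<^sup>2) * dist_nint (t - x j)"
        unfolding D_def using \<rho> j by (intro mult_mono divide_right_mono) auto
      also have "\<dots> = (?p * dist_nint (t - x j)) * (?p / (2 * (real Q)\<^sup>2))"
        by (simp add: power2_eq_square)
      also have "\<dots> \<le> 1 * (?p / (2 * (real Q)\<^sup>2))"
        using p0 by (intro mult_right_mono phi_mult_le) auto
      finally show "D (t - x j) * \<rho> \<le> ?p / (2 * (real Q)\<^sup>2)" by simp
    qed
    also have "\<dots> = (\<Sum>j\<in>I. phi (real Q) (t - of_int j / (2 * real Q))) / (2 * (real Q)\<^sup>2)"
      by (simp add: sum_divide_distrib x_def)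
    also have "\<dots> \<le> 2 * real Q * L / (2 * (real Q)\<^sup>2)"
      unfolding L_def by (intro divide_right_mono sum_phi_grid Q I) auto
    also have "\<dots> = L / real Q"
      using Q by (simp add: power2_eq_square)
    finally show ?thesis
      using Q by (simp add: field_simps)
  qed
  have G: "complex_of_real (\<Sum>j\<in>J. D (t - x j)) = (\<Sum>h\<in>{- int Q<..<int Q}. c h * ee (of_int h * t))" for t
  proof -
    have "complex_of_real (\<Sum>j\<in>J. D (t - x j)) =
       (\<Sum>p\<in>{0..<Q} \<times> {0..<Q}. ee (of_int (int (fst p) - int (snd p)) * t) * w (int (fst p) - int (snd p)))"
      unfolding D_sum w_def by simp
    also have "\<dots> = (\<Sum>h\<in>{- int Q<..<int Q}. \<Sum>p\<in>A h. ee (of_int (int (fst p) - int (snd p)) * t) * w (int (fst p) - int (snd p)))"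
      unfolding A_def by (rule sum.group[symmetric]) auto
    also have "\<dots> = (\<Sum>h\<in>{- int Q<..<int Q}. \<Sum>p\<in>A h. ee (of_int h * t) * w h)"
      by (intro sum.cong refl) (auto simp: A_def)
    finally show ?thesis
      by (simp add: c_def mult_ac)
  qed
  have JT: "J \<subseteq> ?T"
    using r by (auto simp: J_def)
  have cardA: "card (A h) \<le> Q" for h
  proof -
    have "inj_on snd (A h)"
      by (auto simp: inj_on_def A_def)
    moreover have "snd ` A h \<subseteq> {0..<Q}"
      by (auto simp: A_def)
    ultimately show ?thesis
      using card_inj_on_le[of snd "A h" "{0..<Q}"] by simp
  qed
  have cardJ: "real (card J) = 2 * of_int r + 1"
    using r by (simp add: J_def)
  have c_le: "norm (c h) \<le> norm (\<Sum>j\<in>J. ee (- (of_int h * x j))) / (2 * real Q)" for h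
  proof -
    have "norm (c h) \<le> real Q * norm (w h)"
      unfolding c_def using cardA[of h] by (simp add: norm_mult mult_right_mono)
    also have "\<dots> = norm (\<Sum>j\<in>J. ee (- (of_int h * x j))) / (2 * real Q)"
      using Q by (simp add: w_def norm_divide norm_mult norm_power power2_eq_square)
    finally show ?thesis .
  qed
  show "norm (c h) \<le> 2 * \<delta> + 1 / real Q" for h
  proof -
    have "norm (\<Sum>j\<in>J. ee (- (of_int h * x j))) \<le> 2 * of_int r + 1"
      using sum_norm_le[of J "\<lambda>j. ee (- (of_int h * x j))" "\<lambda>_. 1"] cardJ by simp
    also have "\<dots> \<le> 2 * (2 * real Q * \<delta>) + 2"
      using r by linarith
    also have "\<dots> = (2 * \<delta> + 1 / real Q) * (2 * real Q)"
      using Q by (simp add: field_simps)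
    finally have "norm (\<Sum>j\<in>J. ee (- (of_int h * x j))) / (2 * real Q) \<le> 2 * \<delta> + 1 / real Q"
      using Q by (subst pos_divide_le_eq) auto
    then show ?thesis
      using c_le[of h] by linarith
  qed
  show "of_int \<bar>h\<bar> * norm (c h) \<le> 1" if h: "\<bar>h\<bar> < int Q" for h
  proof -
    let ?g = "norm (\<Sum>j\<in>J. ee (- (of_int h * x j)))"
    \<comment> \<open>Now the sum is read as geometric in j with frequency -h/(2Q). As |h| < Q, this
      lies in [-1/2, 1/2], so its distance to the integers is exactly |h|/(2Q).\<close>
    have "(\<Sum>j\<in>J. ee (- (of_int h * x j))) = (\<Sum>j\<in>{- r..<r + 1}. ee (of_int j * x (- h)))"
      by (intro sum.cong) (auto simp: J_def x_def mult.commute)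
    then have "?g * dist_nint (x (- h)) \<le> 1"
      using norm_geometric_ee_int[of "x (- h)" "- r" "r + 1"] phi_mult_le[of _ "x (- h)"]
        mult_right_mono[OF _ dist_nint_nonneg] by (metis order.trans)
    moreover have "dist_nint (x (- h)) = of_int \<bar>h\<bar> / (2 * real Q)"
    proof -
      have "\<bar>real_of_int h\<bar> < real Q"
        using h by linarith
      then have "\<bar>x (- h)\<bar> \<le> 1 / 2"
        using Q by (simp add: x_def field_simps)
      then show ?thesis
        using Q by (subst dist_nint_eq_abs) (auto simp: x_def)
    qed
    ultimately have "?g * of_int \<bar>h\<bar> \<le> 2 * real Q"
      using Q by (simp add: field_simps)
    then have "of_int \<bar>h\<bar> * (?g / (2 * real Q)) \<le> 1"
      using Q by (simp add: field_simps)
    then show ?thesis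
      using mult_left_mono[OF c_le[of h], of "of_int \<bar>h\<bar>"] by simp
  qed
  show "norm (c 0 - 2 * \<delta>) \<le> 1 / real Q"
  proof -
    have "A 0 = (\<lambda>a. (a, a)) ` {0..<Q}"
      by (auto simp: A_def)
    then have "card (A 0) = Q"
      by (simp add: card_image inj_on_def)
    then have "c 0 = of_real ((2 * of_int r + 1) / (2 * real Q))"
      using Q cardJ by (simp add: c_def w_def power2_eq_square)
        (metis of_real_of_nat_eq of_real_add of_real_mult of_real_numeral of_real_of_int_eq of_real_1)
    then have "norm (c 0 - 2 * \<delta>) = \<bar>(2 * of_int r + 1) / (2 * real Q) - 2 * \<delta>\<bar>"
      by (metis norm_of_real of_real_diff of_real_mult of_real_numeral)
    also have "\<dots> = \<bar>2 * of_int r + 1 - 4 * real Q * \<delta>\<bar> / (2 * real Q)"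
      using Q by (simp add: field_simps flip: abs_divide) (simp add: abs_divide)
    also have "\<dots> \<le> 2 / (2 * real Q)"
      using r by (intro divide_right_mono) auto
    finally show ?thesis by simp
  qed
  show "norm (of_bool (dist_nint t < \<delta>) - (\<Sum>h\<in>{- int Q<..<int Q}. c h * ee (of_int h * t)))
           \<le> (1 + 2 * harm Q) * (phi (real Q) (t - \<delta>) + phi (real Q) (t + \<delta>)) / real Q" for t
  proof -
    \<comment> \<open>The centres on the wrong side: those outside \<open>J\<close> if t is close to
      an integer, those in \<open>J\<close> otherwise. Since the kernels are nonnegative with sum 1,
      the error is exactly their mass on \<open>I\<close>.\<close>
    define I where "I = (if dist_nint t < \<delta> then ?T - J else J)"
    define er where "er = (\<Sum>j\<in>I. D (t - x j))"
    have IT: "I \<subseteq> ?T"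
      using JT by (auto simp: I_def)
    have "(\<Sum>j\<in>J. D (t - x j)) + (\<Sum>j\<in>?T - J. D (t - x j)) = 1"
      using sum.subset_diff[OF JT, of "\<lambda>j. D (t - x j)"] total[of t] by simp
    then have "\<bar>of_bool (dist_nint t < \<delta>) - (\<Sum>j\<in>J. D (t - x j))\<bar> = er"
      using sum_nonneg[of J "\<lambda>j. D (t - x j)"] sum_nonneg[of "?T - J" "\<lambda>j. D (t - x j)"] D0
      by (auto simp: er_def I_def abs_if)
    moreover have "of_bool (dist_nint t < \<delta>) - (\<Sum>h\<in>{- int Q<..<int Q}. c h * ee (of_int h * t))
        = of_real (of_bool (dist_nint t < \<delta>) - (\<Sum>j\<in>J. D (t - x j)))"
      by (simp flip: G)
    ultimately have er: "norm (of_bool (dist_nint t < \<delta>) - (\<Sum>h\<in>{- int Q<..<int Q}. c h * ee (of_int h * t))) = er"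
      by (metis norm_of_real)
    have er1: "er \<le> 1"
      unfolding er_def total[of t, symmetric] by (intro sum_mono2 IT D0) auto
    \<comment> \<open>Passing from t to s crosses the boundary of the interval modulo 1, so one of
      its end points is at least as close to t as s is.\<close>
    have near: "dist_nint (t - \<delta>) \<le> dist_nint (t - s) \<or> dist_nint (t + \<delta>) \<le> dist_nint (t - s)"
      if "dist_nint t < \<delta> \<and> \<delta> \<le> dist_nint s \<or> \<delta> \<le> dist_nint t \<and> dist_nint s \<le> \<delta>" for s
      using that
    proof
      assume a: "dist_nint t < \<delta> \<and> \<delta> \<le> dist_nint s"
      define t' where "t' = t - of_int (round t)"
      define s' where "s' = s - of_int (round t) + of_int (round (t - s))"
      have t': "\<bar>t'\<bar> < \<delta>"
        using a by (simp add: t'_def dist_nint_eq_round)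
      have "dist_nint s' = dist_nint s"
        using dist_nint_add_int[of s "round (t - s) - round t"] by (simp add: s'_def algebra_simps)
      then have s': "\<delta> \<le> \<bar>s'\<bar>"
        using a dist_nint_le_abs[of s'] by linarith
      have d: "dist_nint (t - s) = \<bar>t' - s'\<bar>"
        by (simp add: t'_def s'_def dist_nint_eq_round algebra_simps)
      have "dist_nint (t - \<delta>) \<le> \<bar>t' - \<delta>\<bar>" "dist_nint (t + \<delta>) \<le> \<bar>t' + \<delta>\<bar>"
        using dist_nint_le[of "t - \<delta>" "round t"] dist_nint_le[of "t + \<delta>" "round t"]
        by (simp_all add: t'_def algebra_simps)
      then show ?thesis
        using t' s' d by linarith
    next
      assume a: "\<delta> \<le> dist_nint t \<and> dist_nint s \<le> \<delta>"
      define s' where "s' = s - of_int (round s)"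
      define t' where "t' = t - of_int (round s) - of_int (round (t - s))"
      have s': "\<bar>s'\<bar> \<le> \<delta>"
        using a by (simp add: s'_def dist_nint_eq_round)
      have "dist_nint t' = dist_nint t"
        using dist_nint_add_int[of t "- round (t - s) - round s"] by (simp add: t'_def algebra_simps)
      then have t': "\<delta> \<le> \<bar>t'\<bar>"
        using a dist_nint_le_abs[of t'] by linarith
      have d: "dist_nint (t - s) = \<bar>t' - s'\<bar>"
        by (simp add: t'_def s'_def dist_nint_eq_round algebra_simps)
      have "dist_nint (t - \<delta>) \<le> \<bar>t' - \<delta>\<bar>" "dist_nint (t + \<delta>) \<le> \<bar>t' + \<delta>\<bar>"
        using dist_nint_le[of "t - \<delta>" "round s + round (t - s)"] dist_nint_le[of "t + \<delta>" "round s + round (t - s)"]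
        by (simp_all add: t'_def algebra_simps)
      then show ?thesis
        using t' s' d by linarith
    qed
    have far: "dist_nint t < \<delta> \<and> \<delta> \<le> dist_nint (x j) \<or> \<delta> \<le> dist_nint t \<and> dist_nint (x j) \<le> \<delta>" if j: "j \<in> I" for j
    proof -
      have "\<bar>j\<bar> \<le> int Q" using subsetD[OF IT j] by (simp add: abs_le_iff)
      then have "\<bar>real_of_int j\<bar> \<le> real Q" by linarith
      then have "\<bar>x j\<bar> \<le> 1 / 2" using Q by (simp add: x_def field_simps)
      then have dx: "dist_nint (x j) = \<bar>real_of_int j\<bar> / (2 * real Q)"
        using Q by (subst dist_nint_eq_abs) (auto simp: x_def)
      show ?thesis
      proof (cases "dist_nint t < \<delta>")
        case True
        then have "\<not> \<bar>j\<bar> \<le> r"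
          using j by (auto simp: I_def J_def abs_le_iff)
        then have "of_int r + 1 \<le> \<bar>real_of_int j\<bar>"
          by linarith
        then have "\<delta> \<le> dist_nint (x j)"
          unfolding dx using r Q by (simp add: field_simps)
        then show ?thesis using True by blast
      next
        case False
        then have "\<bar>j\<bar> \<le> r"
          using j by (auto simp: I_def J_def abs_le_iff)
        then have "\<bar>real_of_int j\<bar> \<le> of_int r"
          by linarith
        then have "dist_nint (x j) \<le> \<delta>"
          unfolding dx using r Q by (simp add: field_simps)
        then show ?thesis using False by auto
      qed
    qed
    define \<rho> where "\<rho> = min (dist_nint (t - \<delta>)) (dist_nint (t + \<delta>))"
    have "er * \<rho> * real Q \<le> L"
      unfolding er_def by (rule tail[OF IT]) (use near[OF far] in \<open>auto simp: \<rho>_def min_le_iff_disj\<close>)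
    then obtain y where y: "y = t - \<delta> \<or> y = t + \<delta>" "er * dist_nint y * real Q \<le> L"
      unfolding \<rho>_def min_def by (metis (full_types))
    have "er * real Q / L \<le> phi (real Q) y"
    proof (rule le_phi)
      have "er * real Q \<le> real Q * L"
        using er1 L1 Q by (simp add: mult.commute mult_mono)
      then show "er * real Q / L \<le> real Q"
        using L1 by (simp add: divide_le_eq)
      show "er * real Q / L * dist_nint y \<le> 1"
        using y(2) L1 by (simp add: divide_le_eq mult_ac)
    qed
    also have "\<dots> \<le> phi (real Q) (t - \<delta>) + phi (real Q) (t + \<delta>)"
      using y(1) phi_nonneg[of "real Q"] by auto
    finally have "er * real Q \<le> L * (phi (real Q) (t - \<delta>) + phi (real Q) (t + \<delta>))"
      using L1 by (simp add: divide_le_eq mult.commute)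
    then show ?thesis
      unfolding er using Q by (simp add: le_divide_eq L_def)
  qed
qed

section \<open>Divisors and factorisations\<close>

lemma card_divisors_prime_power_mult:
  fixes p m :: nat
  assumes "prime p" "0 < m"
  shows "card {d. d dvd p ^ a * m} \<le> (a + 1) * card {d. d dvd m}"
proof -
  have "{d. d dvd p ^ a * m} \<subseteq> (\<lambda>(i, d). p ^ i * d) ` ({..a} \<times> {d. d dvd m})"
  proof
    fix d assume "d \<in> {d. d dvd p ^ a * m}"
    then obtain b c where bc: "d = b * c" "b dvd p ^ a" "c dvd m"
      using division_decomp by blast
    then obtain i where "i \<le> a" "b = p ^ i"
      using divides_primepow_nat assms(1) by blast
    then show "d \<in> (\<lambda>(i, d). p ^ i * d) ` ({..a} \<times> {d. d dvd m})"
      using bc by force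
  qed
  then have "card {d. d dvd p ^ a * m} \<le> card ((\<lambda>(i, d). p ^ i * d) ` ({..a} \<times> {d. d dvd m}))"
    using assms(2) by (intro card_mono finite_imageI finite_cartesian_product) auto
  also have "\<dots> \<le> card ({..a} \<times> {d. d dvd m})"
    using assms(2) by (intro card_image_le finite_cartesian_product) auto
  finally show ?thesis
    by (simp add: card_cartesian_product)
qed

text \<open>The number of divisors is built up prime by prime, and a + 1 is compared with p^(a
  \<eta>). If p \<ge> 2^(1/\<eta>), then p^\<eta> \<ge> 2 and a + 1 \<le> 2^a is enough. The
  boundedly many smaller primes cost a factor \<open>K\<close> each.\<close>

lemma divisor_bound:
  assumes \<eta>: "0 < (\<eta>::real)"
  obtains C :: real where "\<And>n. 0 < n \<Longrightarrow> real (card {d. d dvd n}) \<le> C * real n powr \<eta>"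
proof -
  \<comment> \<open>Chosen so that K (1 + a \<eta> ln 2) \<ge> 1 + a, where 1 + a \<eta> ln 2 \<le>
    2^(a \<eta>).\<close>
  define K where "K = max 1 (1 / (\<eta> * ln 2))"
  define P0 where "P0 = nat \<lceil>2 powr (1 / \<eta>)\<rceil>"
  define c where "c p = (if p < P0 then K else 1)" for p :: nat
  have K1: "1 \<le> K" "1 \<le> K * (\<eta> * ln 2)"
    using \<eta> by (auto simp: K_def max_def field_simps)
  have c1: "1 \<le> c p" for p
    using K1 by (simp add: c_def)
  have local_bound: "real (a + 1) \<le> c p * real (p ^ a) powr \<eta>" if p: "prime p" for p a
  proof -
    have p2: "2 \<le> real p"
      using prime_ge_2_nat[OF p] by simp
    have pw: "real (p ^ a) powr \<eta> = (real p powr \<eta>) ^ a"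
      using p2 by (simp add: powr_powr mult.commute flip: powr_realpow)
    show ?thesis
    proof (cases "p < P0")
      case True
      have "exp (real a * (\<eta> * ln 2)) = (2 powr \<eta>) ^ a"
        by (simp add: powr_def exp_of_nat_mult)
      also have "\<dots> \<le> (real p powr \<eta>) ^ a"
        using p2 \<eta> by (intro power_mono powr_mono2) auto
      finally have "1 + real a * (\<eta> * ln 2) \<le> (real p powr \<eta>) ^ a"
        using exp_ge_add_one_self[of "real a * (\<eta> * ln 2)"] by linarith
      then have "K * (1 + real a * (\<eta> * ln 2)) \<le> K * (real p powr \<eta>) ^ a"
        using K1 by (intro mult_left_mono) auto
      moreover have "real a * 1 \<le> real a * (K * (\<eta> * ln 2))"
        using K1 by (intro mult_left_mono) auto
      ultimately have "1 + real a \<le> K * (real p powr \<eta>) ^ a"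
        using K1 by (simp add: algebra_simps)
      then show ?thesis
        unfolding pw using True by (simp add: c_def)
    next
      case False
      then have "2 powr (1 / \<eta>) \<le> real p"
        unfolding P0_def by linarith
      then have "(2 powr (1 / \<eta>)) powr \<eta> \<le> real p powr \<eta>"
        using \<eta> by (intro powr_mono2) auto
      then have "2 \<le> real p powr \<eta>"
        using \<eta> by (simp add: powr_powr)
      then have "2 ^ a \<le> (real p powr \<eta>) ^ a"
        by (intro power_mono) auto
      moreover have "real (a + 1) \<le> 2 ^ a"
        by (induction a) auto
      ultimately show ?thesis
        unfolding pw using False by (simp add: c_def)
    qed
  qed
  have main: "real (card {d. d dvd n}) \<le> (\<Prod>p\<in>prime_factors n. c p) * real n powr \<eta>" if "0 < n" for n
    using that
  proof (induction n rule: less_induct)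
    case (less n)
    show ?case
    proof (cases "n = 1")
      case False
      then obtain p where p: "prime p" "p dvd n"
        using prime_factor_nat by blast
      define a where "a = multiplicity p n"
      obtain m where m: "n = p ^ a * m" "\<not> p dvd m"
        using multiplicity_decompose'[of n p] less.prems p(1) unfolding a_def
        by (metis not_prime_unit not_gr_zero)
      have m0: "0 < m" using m less.prems by (auto intro: Nat.gr0I)
      have a0: "0 < a" using m p by (auto intro!: Nat.gr0I)
      have "1 < p ^ a" using one_less_power[OF prime_gt_1_nat[OF p(1)] a0] .
      then have mn: "m < n" using m0 m(1) by simp
      have pf: "prime_factors n = insert p (prime_factors m)"
        using m0 a0 p(1) unfolding m(1)
        by (subst prime_factors_product) (auto simp: prime_factorization_prime_power prime_prime_factors)
      have "real (card {d. d dvd n}) \<le> real (a + 1) * real (card {d. d dvd m})"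
        using card_divisors_prime_power_mult[OF p(1) m0, of a] unfolding m(1)
        by (metis of_nat_le_iff of_nat_mult)
      also have "\<dots> \<le> (c p * real (p ^ a) powr \<eta>) * ((\<Prod>p\<in>prime_factors m. c p) * real m powr \<eta>)"
        using local_bound[OF p(1), of a] less.IH[OF mn m0] c1[of p] by (intro mult_mono) auto
      also have "\<dots> = (\<Prod>p\<in>prime_factors n. c p) * real n powr \<eta>"
      proof -
        have "p \<notin> prime_factors m"
          using m(2) by auto
        moreover have "real n powr \<eta> = real (p ^ a) powr \<eta> * real m powr \<eta>"
          unfolding m(1) by (simp add: powr_mult)
        ultimately show ?thesis
          by (simp add: pf mult_ac)
      qed
      finally show ?thesis .
    qed simp
  qed
  have "(\<Prod>p\<in>prime_factors n. c p) \<le> K ^ P0" for n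
  proof -
    have "(\<Prod>p\<in>prime_factors n. c p) = (\<Prod>p\<in>prime_factors n \<inter> {..<P0}. K)"
      by (rule prod.mono_neutral_cong_right) (auto simp: c_def)
    also have "\<dots> = K ^ card (prime_factors n \<inter> {..<P0})"
      by simp
    also have "\<dots> \<le> K ^ P0"
      using K1 card_mono[of "{..<P0}" "prime_factors n \<inter> {..<P0}"] by (intro power_increasing) auto
    finally show ?thesis .
  qed
  then have "real (card {d. d dvd n}) \<le> K ^ P0 * real n powr \<eta>" if "0 < n" for n
    using main[OF that] by (meson mult_right_mono order.trans powr_ge_zero)
  then show ?thesis
    using that by blast
qed

text \<open>\<open>top_split u k m\<close>: the product \<open>k\<close> of the largest prime factors of \<open>k * m\<close>, taken one by one
  in decreasing order until \<open>u\<close> is reached.\<close>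

definition top_split :: "real \<Rightarrow> nat \<Rightarrow> nat \<Rightarrow> bool" where
  "top_split u k m \<longleftrightarrow> 0 < k \<and> 0 < m \<and> u \<le> real k \<and> (\<forall>q. prime q \<and> q dvd k \<longrightarrow> real k < u * real q)
     \<and> (\<forall>p q. prime p \<and> p dvd m \<and> prime q \<and> q dvd k \<longrightarrow> p \<le> q)"

text \<open>Among the divisors k \<ge> u whose primes dominate those of the cofactor, the least is
  taken. Dividing it by its smallest prime r keeps the domination, so by minimality the quotient
  falls below u, that is k < u r.\<close>

lemma top_split_exists:
  assumes d: "0 < d" "u \<le> real d"
  obtains k m where "d = k * m" "top_split u k m"
proof -
  define P where "P k \<longleftrightarrow> u \<le> real k \<and> (\<exists>m. d = k * m \<and> (\<forall>p q. prime p \<and> p dvd m \<and> prime q \<and> q dvd k \<longrightarrow> p \<le> q))" for k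
  have "P d"
    using d by (auto simp: P_def intro!: exI[of _ 1])
  define k where "k = (LEAST k. P k)"
  have Pk: "P k"
    unfolding k_def by (rule LeastI[of P, OF \<open>P d\<close>])
  have least: "\<not> P k'" if "k' < k" for k'
    using that unfolding k_def by (rule not_less_Least)
  obtain m where m: "d = k * m" "\<And>p q. prime p \<Longrightarrow> p dvd m \<Longrightarrow> prime q \<Longrightarrow> q dvd k \<Longrightarrow> p \<le> q"
    using Pk unfolding P_def by blast
  have pos: "0 < k" "0 < m"
    using m(1) d by auto
  have "real k < u * real q" if q: "prime q" "q dvd k" for q
  proof -
    define r where "r = (LEAST r. prime r \<and> r dvd k)"
    have r: "prime r" "r dvd k"
      using LeastI[of "\<lambda>r. prime r \<and> r dvd k" q] q by (auto simp: r_def)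
    have rle: "r \<le> q'" if "prime q'" "q' dvd k" for q'
      unfolding r_def using that by (intro Least_le) auto
    obtain k' where k': "k = r * k'"
      using r(2) by blast
    have "k' < k"
      using k' pos prime_gt_1_nat[OF r(1)] by simp
    then have notP: "\<not> P k'" by (rule least)
    have dk': "d = k' * (r * m)"
      using m(1) k' by simp
    have pq: "p \<le> q'" if "prime p" "p dvd r * m" "prime q'" "q' dvd k'" for p q'
    proof (cases "p dvd m")
      case False
      then have "p = r"
        using that(1,2) r(1) by (auto simp: prime_dvd_mult_iff primes_dvd_imp_eq)
      then show ?thesis
        using rle[of q'] that k' by simp
    qed (use m(2) that k' in auto)
    have "real k' < u"
    proof (rule ccontr)
      assume "\<not> real k' < u"
      then have "P k'"
        unfolding P_def using dk' pq by (intro conjI exI[of _ "r * m"]) auto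
      with notP show False ..
    qed
    then have "real k' * real r < u * real r"
      using prime_gt_0_nat[OF r(1)] by simp
    moreover have "u * real r \<le> u * real q"
      using rle[OF q] \<open>real k' < u\<close> by (intro mult_left_mono) auto
    ultimately show ?thesis
      using k' by (simp add: mult.commute)
  qed
  moreover have "u \<le> real k"
    using Pk by (simp add: P_def)
  ultimately have "top_split u k m"
    unfolding top_split_def using m(2) pos by blast
  with m(1) show ?thesis
    using that by blast
qed

text \<open>After division by the gcd, let k and k' have coprime parts a and b. If both exceed 1, a
  prime p of a divides m' and a prime q of b divides m, so p \<le> q \<le> p, against coprimality.
  Otherwise one of k, k' divides the other, and an additional prime q in the larger one would make
  it at least u q.\<close>

lemma top_split_unique:
  assumes 1: "top_split u k m" and 2: "top_split u k' m'" and eq: "k * m = k' * m'"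
  shows "k = k' \<and> m = m'"
proof -
  have dvd_eq: "k = k'" if 1: "top_split u k m" and 2: "top_split u k' m'" and eq: "k * m = k' * m'" and dvd: "k dvd k'"
    for k m k' m'
  proof (rule ccontr)
    assume ne: "k \<noteq> k'"
    obtain b where b: "k' = k * b" using dvd by blast
    have "b \<noteq> 1" using b ne by auto
    then obtain q where q: "prime q" "q dvd b"
      using prime_factor_nat by blast
    have "real k' < u * real q"
      using 2 q b by (auto simp: top_split_def)
    moreover have "real (k * q) \<le> real (k * b)"
    proof -
      have "0 < b" using 2 b by (auto simp: top_split_def)
      then have "q \<le> b" using q(2) by (intro dvd_imp_le)
      then show ?thesis by (simp add: mult_left_mono)
    qed
    moreover have "u * real q \<le> real k * real q"
      using 1 by (intro mult_right_mono) (auto simp: top_split_def)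
    ultimately show False
      using b by simp
  qed
  define g where "g = gcd k k'"
  have g: "g \<noteq> 0" using 1 by (auto simp: g_def top_split_def)
  obtain a b where ab: "k = a * g" "k' = b * g" "coprime a b"
    using gcd_coprime_exists[of k k'] g unfolding g_def by blast
  have am: "a * m = b * m'"
    using eq g unfolding ab by (simp add: mult_ac)
  have "a = 1 \<or> b = 1"
  proof (rule ccontr)
    assume "\<not> (a = 1 \<or> b = 1)"
    then obtain p q where p: "prime p" "p dvd a" and q: "prime q" "q dvd b"
      using prime_factor_nat[of a] prime_factor_nat[of b] by blast
    have "a dvd b * m'" "b dvd a * m"
      using am dvd_triv_left[of a m] dvd_triv_left[of b m'] by simp_all
    then have "a dvd m'" "b dvd m"
      using ab(3) by (simp_all add: coprime_dvd_mult_right_iff coprime_commute)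
    then have "p dvd m'" "q dvd m" "p dvd k" "q dvd k'"
      using p q ab(1,2) by (auto intro: dvd_trans)
    then have "q \<le> p" "p \<le> q"
      using 1 2 p q unfolding top_split_def by blast+
    then have "p = q" by simp
    then show False
      using p q coprime_common_divisor[OF ab(3), of p] not_prime_unit by blast
  qed
  then have "k = k'"
    using dvd_eq[OF 1 2 eq] dvd_eq[OF 2 1 eq[symmetric]] ab by auto
  then show ?thesis
    using eq 1 by (auto simp: top_split_def)
qed

text \<open>Let r be the smallest prime of k. Either k = r, or k / r contains a further prime, so r
  \<le> k / r < u and k < u r \<le> u^2.\<close>

lemma top_split_le:
  assumes split: "top_split u k m" and u: "1 < u" and primes: "\<And>p. prime p \<Longrightarrow> p dvd k \<Longrightarrow> real p \<le> u\<^sup>2"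
  shows "real k \<le> u\<^sup>2"
proof -
  have "k \<noteq> 1" using split u by (auto simp: top_split_def)
  then obtain q where q: "prime q" "q dvd k"
    using prime_factor_nat by blast
  define r where "r = (LEAST r. prime r \<and> r dvd k)"
  have r: "prime r" "r dvd k"
    using LeastI[of "\<lambda>r. prime r \<and> r dvd k" q] q by (auto simp: r_def)
  have rle: "r \<le> q'" if "prime q'" "q' dvd k" for q'
    unfolding r_def using that by (intro Least_le) auto
  obtain k' where k': "k = r * k'"
    using r(2) by blast
  have lt: "real k < u * real r"
    using split r by (auto simp: top_split_def)
  show ?thesis
  proof (cases "k' = 1")
    case True
    then show ?thesis using primes[OF r] k' by simp
  next
    case False
    then obtain q' where q': "prime q'" "q' dvd k'"
      using prime_factor_nat by blast
    have "k' > 0" using split k' by (auto simp: top_split_def intro!: Nat.gr0I)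
    then have "r \<le> k'"
      using rle[of q'] q' k' dvd_imp_le[of q' k'] by auto
    moreover have "real k' < u"
      using lt k' prime_gt_0_nat[OF r(1)] by simp
    ultimately have "u * real r \<le> u * u"
      using u by (intro mult_left_mono) auto
    then show ?thesis using lt by (simp add: power2_eq_square)
  qed
qed

lemma sum_top_split:
  assumes "finite D" "\<And>d. d \<in> D \<Longrightarrow> 0 < d \<and> u \<le> real d"
  shows "sum f D = (\<Sum>(k, m)\<in>{(k, m). top_split u k m \<and> k * m \<in> D}. f (k * m))"
proof -
  have "bij_betw (\<lambda>(k, m). k * m) {(k, m). top_split u k m \<and> k * m \<in> D} D"
    unfolding bij_betw_def
  proof
    show "inj_on (\<lambda>(k, m). k * m) {(k, m). top_split u k m \<and> k * m \<in> D}"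
      by (intro inj_onI) (clarsimp, blast dest: top_split_unique)
    show "(\<lambda>(k, m). k * m) ` {(k, m). top_split u k m \<and> k * m \<in> D} = D"
    proof
      show "D \<subseteq> (\<lambda>(k, m). k * m) ` {(k, m). top_split u k m \<and> k * m \<in> D}"
      proof
        fix d assume d: "d \<in> D"
        then obtain k m where "d = k * m" "top_split u k m"
          using assms(2) top_split_exists[of d u] by blast
        with d show "d \<in> (\<lambda>(k, m). k * m) ` {(k, m). top_split u k m \<and> k * m \<in> D}"
          by (intro image_eqI[of _ _ "(k, m)"]) auto
      qed
    qed auto
  qed
  then have "sum f D = (\<Sum>x\<in>{(k, m). top_split u k m \<and> k * m \<in> D}. f ((\<lambda>(k, m). k * m) x))"
    by (simp add: sum.reindex_bij_betw)
  then show ?thesis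
    by (simp add: case_prod_beta)
qed

section \<open>The Moebius function and the sieve of Eratosthenes\<close>

definition mu :: "nat \<Rightarrow> complex" where
  "mu d = (if squarefree d then (- 1) ^ card (prime_factors d) else 0)"

lemma norm_mu_le: "norm (mu d) \<le> 1"
  by (simp add: mu_def norm_power)

lemma mu_mult_coprime:
  assumes "coprime a b" "0 < a" "0 < b"
  shows "mu (a * b) = mu a * mu b"
proof -
  have "squarefree (a * b) \<longleftrightarrow> squarefree a \<and> squarefree b"
    using assms squarefree_mult_coprime squarefree_multD by blast
  moreover have "prime_factors (a * b) = prime_factors a \<union> prime_factors b"
    using assms by (simp add: prime_factors_product)
  moreover have "prime_factors a \<inter> prime_factors b = {}"
    using assms(1) by (auto simp: in_prime_factors_iff) (metis coprime_common_divisor not_prime_unit)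
  ultimately show ?thesis
    by (simp add: mu_def card_Un_disjoint power_add)
qed

lemma mu_mult_common_prime:
  assumes "prime p" "p dvd a" "p dvd b"
  shows "mu (a * b) = 0"
proof -
  have "p\<^sup>2 dvd a * b"
    using assms by (simp add: power2_eq_square mult_dvd_mono)
  then have "\<not> squarefree (a * b)"
    using assms(1) not_squarefreeI not_prime_unit by blast
  then show ?thesis
    by (simp add: mu_def)
qed

text \<open>Squarefree divisors with all primes at most v correspond to subsets T of the set
  \<open>A\<close> of such primes of n, and the sum of (-1)^|T| over these subsets is (1 -
  1)^|A|.\<close>

lemma sum_mu_smooth_divisors:
  fixes n :: nat and v :: real
  assumes n: "0 < n"
  shows "(\<Sum>d | d dvd n \<and> (\<forall>p. prime p \<and> p dvd d \<longrightarrow> real p \<le> v). mu d) =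
           of_bool (\<forall>p. prime p \<and> p dvd n \<longrightarrow> v < real p)"
proof -
  define A where "A = {p \<in> prime_factors n. real p \<le> v}"
  define D where "D = {d. d dvd n \<and> (\<forall>p. prime p \<and> p dvd d \<longrightarrow> real p \<le> v)}"
  have finA: "finite A" by (simp add: A_def)
  have finD: "finite D" using n by (simp add: D_def)
  have pr: "prime p" if "p \<in> A" for p
    using that by (auto simp: A_def in_prime_factors_iff)
  have pfT: "prime_factors (\<Prod>T) = T" "squarefree (\<Prod>T)" "\<Prod>T dvd n" if T: "T \<subseteq> A" for T
  proof -
    have prT: "prime p" if "p \<in> T" for p
      using that T pr by blast
    have finT: "finite T" using T finA finite_subset by blast
    have 0: "0 \<notin> (\<lambda>p. p) ` T" using prT[of 0] by auto
    have "prime_factors (\<Prod>p\<in>T. p) = (\<Union>p\<in>T. prime_factors p)"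
      using prime_factors_prod[OF finT 0] by simp
    also have "\<dots> = T"
      using prT by (auto simp: prime_prime_factors)
    finally show "prime_factors (\<Prod>T) = T" .
    show "squarefree (\<Prod>T)"
      using prT by (intro squarefree_prod_coprime) (auto simp: squarefree_prime primes_coprime)
    have "\<Prod>T dvd (\<Prod>p\<in>T. p ^ multiplicity p n)"
    proof (rule prod_dvd_prod)
      fix p assume "p \<in> T"
      then have "p \<in> prime_factors n" using T by (auto simp: A_def)
      then have "multiplicity p n > 0"
        using prime_factors_multiplicity by blast
      then show "p dvd p ^ multiplicity p n" by (simp add: dvd_power)
    qed
    also have "\<dots> dvd (\<Prod>p\<in>prime_factors n. p ^ multiplicity p n)"
      using T by (intro prod_dvd_prod_subset) (auto simp: A_def)
    also have "\<dots> = n"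
      using prod_prime_factors[of n] n by simp
    finally show "\<Prod>T dvd n" .
  qed
  have prod_pf: "\<Prod>(prime_factors d) = d" if d: "squarefree d" for d :: nat
  proof -
    have d0: "d \<noteq> 0" using d not_squarefree_0 by metis
    have "(\<Prod>p\<in>prime_factors d. p) = (\<Prod>p\<in>prime_factors d. p ^ multiplicity p d)"
      using d squarefree_factorial_semiring'[OF d0] by (intro prod.cong) auto
    also have "\<dots> = d"
      using prod_prime_factors[OF d0] by simp
    finally show ?thesis .
  qed
  have "sum mu D = sum mu {d \<in> D. squarefree d}"
    by (rule sum.mono_neutral_right) (auto simp: finD mu_def)
  also have "\<dots> = (\<Sum>T\<in>Pow A. (- 1) ^ card T)"
  proof (rule sum.reindex_bij_witness[of _ "\<lambda>T. \<Prod>T" prime_factors])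
    fix d assume d: "d \<in> {d \<in> D. squarefree d}"
    then show "\<Prod>(prime_factors d) = d"
      by (simp add: prod_pf)
    show "prime_factors d \<in> Pow A"
      using d n by (auto simp: D_def A_def in_prime_factors_iff)
    show "(- 1) ^ card (prime_factors d) = mu d"
      using d by (simp add: mu_def)
  next
    fix T assume T: "T \<in> Pow A"
    then show "prime_factors (\<Prod>T) = T"
      using pfT by simp
    have "p \<in> T" if "prime p" "p dvd \<Prod>T" for p
    proof -
      have "\<Prod>T \<noteq> 0" using pfT(2)[of T] T not_squarefree_0 by (metis PowD)
      then show ?thesis
        using that pfT(1)[of T] T by (metis PowD in_prime_factors_iff)
    qed
    then show "\<Prod>T \<in> {d \<in> D. squarefree d}"
      using pfT(2,3)[of T] T by (auto simp: D_def A_def)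
  qed
  also have "\<dots> = (\<Prod>p\<in>A. - 1 + 1)"
    using prod_add[OF finA, of "\<lambda>_. - 1 :: complex" "\<lambda>_. 1"] by simp
  also have "\<dots> = of_bool (A = {})"
    using finA by (simp add: power_0_left card_eq_0_iff)
  also have "A = {} \<longleftrightarrow> (\<forall>p. prime p \<and> p dvd n \<longrightarrow> v < real p)"
    using n by (auto simp: A_def in_prime_factors_iff)
  finally show ?thesis
    by (simp add: D_def)
qed

section \<open>Type I and type II sums\<close>

text \<open>For positive m this is the integer part of the binary logarithm.\<close>

definition dyadic_log :: "nat \<Rightarrow> nat" where
  "dyadic_log m = (LEAST j. m < 2 ^ Suc j)"

lemma dyadic_log:
  assumes "0 < m"
  shows "2 ^ dyadic_log m \<le> m" "m < 2 * 2 ^ dyadic_log m"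
proof -
  have "m < 2 ^ Suc m"
    using less_exp[of "Suc m"] by linarith
  then have *: "m < 2 ^ Suc (dyadic_log m)"
    unfolding dyadic_log_def by (rule LeastI[of "\<lambda>j. m < 2 ^ Suc j"])
  then show "m < 2 * 2 ^ dyadic_log m" by simp
  show "2 ^ dyadic_log m \<le> m"
  proof (cases "dyadic_log m")
    case (Suc j)
    then have "\<not> m < 2 ^ Suc j"
      using not_less_Least[of j "\<lambda>j. m < 2 ^ Suc j"] by (simp add: dyadic_log_def)
    then show ?thesis using Suc by simp
  qed (use assms in simp)
qed

lemma dyadic_log_less: "0 < m \<Longrightarrow> m < 2 ^ J \<Longrightarrow> dyadic_log m < J"
proof -
  assume "0 < m" "m < 2 ^ J"
  then have "(2::nat) ^ dyadic_log m < 2 ^ J"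
    using dyadic_log(1)[of m] by linarith
  then show ?thesis by simp
qed

text \<open>The weight has a uniform bound \<open>R0\<close> and a decay bound R1 / l. The first is
  used on the initial block, the second on block number j, where l \<ge> j B and the factors 1/j add
  up harmonically. The initial block has its own bound \<open>Z0\<close> because it omits l = 0,
  which can make it much smaller.\<close>

lemma sum_weighted_blocks:
  fixes r p :: "nat \<Rightarrow> real" and B :: nat
  assumes B: "0 < B" and r: "\<And>l. 0 \<le> r l" and p: "\<And>l. 0 \<le> p l"
    and R: "\<And>l. l \<in> {1..N} \<Longrightarrow> r l \<le> R0" "\<And>l. l \<in> {1..N} \<Longrightarrow> real l * r l \<le> R1" and R_nonneg: "0 \<le> R0" "0 \<le> R1"
    and Z0: "(\<Sum>l\<in>{1..<B}. p l) \<le> Z0" and Z1: "\<And>a. (\<Sum>l\<in>{a..<a + B}. p l) \<le> Z1"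
  shows "(\<Sum>l\<in>{1..N}. r l * p l) \<le> R0 * Z0 + R1 / real B * harm N * Z1"
proof -
  define T where "T j = {l \<in> {1..N}. l div B = j}" for j
  have "0 \<le> (\<Sum>l\<in>{0..<0 + B}. p l)"
    using p by (intro sum_nonneg) auto
  then have Z1_nonneg: "0 \<le> Z1"
    using Z1[of 0] by linarith
  have "(\<Sum>l\<in>{1..N}. r l * p l) = (\<Sum>j\<in>{0..N}. \<Sum>l\<in>T j. r l * p l)"
    unfolding T_def by (rule sum.group[symmetric]) (auto intro: order.trans[OF div_le_dividend])
  also have "\<dots> = (\<Sum>l\<in>T 0. r l * p l) + (\<Sum>j\<in>{1..N}. \<Sum>l\<in>T j. r l * p l)"
    by (simp add: sum.atLeast_Suc_atMost)
  also have "(\<Sum>l\<in>T 0. r l * p l) \<le> R0 * Z0"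
  proof -
    have "(\<Sum>l\<in>T 0. r l * p l) \<le> (\<Sum>l\<in>T 0. R0 * p l)"
      using p R by (intro sum_mono mult_right_mono) (auto simp: T_def)
    also have "\<dots> \<le> (\<Sum>l\<in>{1..<B}. R0 * p l)"
      using p R_nonneg B by (intro sum_mono2) (auto simp: T_def div_eq_0_iff)
    also have "\<dots> = R0 * (\<Sum>l\<in>{1..<B}. p l)"
      by (simp add: sum_distrib_left)
    finally show ?thesis
      using mult_left_mono[OF Z0 R_nonneg(1)] by linarith
  qed
  also have "(\<Sum>j\<in>{1..N}. \<Sum>l\<in>T j. r l * p l) \<le> (\<Sum>j\<in>{1..N}. R1 / real B * inverse (real j) * Z1)"
  proof (rule sum_mono)
    fix j assume j: "j \<in> {1..N}"
    have "(\<Sum>l\<in>T j. r l * p l) \<le> (\<Sum>l\<in>T j. R1 / real B * inverse (real j) * p l)"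
    proof (intro sum_mono mult_right_mono p)
      fix l assume l: "l \<in> T j"
      then have "j * B \<le> l"
        by (auto simp: T_def)
      then have "real (j * B) * r l \<le> real l * r l"
        using r by (intro mult_right_mono of_nat_mono)
      also have "\<dots> \<le> R1"
        using l R by (auto simp: T_def)
      finally show "r l \<le> R1 / real B * inverse (real j)"
        using j B by (simp add: field_simps)
    qed
    also have "\<dots> \<le> (\<Sum>l\<in>{j * B..<j * B + B}. R1 / real B * inverse (real j) * p l)"
    proof (rule sum_mono2)
      show "T j \<subseteq> {j * B..<j * B + B}"
      proof
        fix l assume "l \<in> T j"
        then have "l = j * B + l mod B"
          using div_mult_mod_eq[of l B] by (simp add: T_def)
        then show "l \<in> {j * B..<j * B + B}"
          using mod_less_divisor[OF B, of l] by simp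
      qed
    qed (use p R_nonneg in auto)
    also have "\<dots> = R1 / real B * inverse (real j) * (\<Sum>l\<in>{j * B..<j * B + B}. p l)"
      by (simp add: sum_distrib_left)
    also have "\<dots> \<le> R1 / real B * inverse (real j) * Z1"
      using R_nonneg by (intro mult_left_mono Z1) auto
    finally show "(\<Sum>l\<in>T j. r l * p l) \<le> R1 / real B * inverse (real j) * Z1" .
  qed
  also have "\<dots> = R1 / real B * harm N * Z1"
    by (simp add: harm_def sum_distrib_left sum_distrib_right)
  finally show ?thesis by simp
qed

lemma coupling_subset:
  assumes "coupling \<Omega> K R" "\<Omega>' \<subseteq> \<Omega>" "K' \<subseteq> K"
  shows "coupling \<Omega>' K' R"
  unfolding coupling_def
proof (intro ballI)
  fix w w' assume "w \<in> \<Omega>'" "w' \<in> \<Omega>'"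
  then have "w \<in> \<Omega>" "w' \<in> \<Omega>"
    using assms(2) by auto
  then have "{k\<in>K. R w k} \<subseteq> {k\<in>K. R w' k} \<or> {k\<in>K. R w' k} \<subseteq> {k\<in>K. R w k}"
    using assms(1) unfolding coupling_def by simp
  then show "{k\<in>K'. R w k} \<subseteq> {k\<in>K'. R w' k} \<or> {k\<in>K'. R w' k} \<subseteq> {k\<in>K'. R w k}"
    using assms(3) by auto
qed

lemma coupled_subset:
  assumes "coupled \<Omega> K n g" "\<Omega>' \<subseteq> \<Omega>" "K' \<subseteq> K"
  shows "coupled \<Omega>' K' n g"
  using assms
proof (induction rule: coupled.induct)
  case (product a b)
  then show ?case by (intro coupled.product) auto
next
  case (couple n g R)
  then show ?case by (intro coupled.couple) (auto intro: coupling_subset)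
qed

text \<open>The fibre over w depends only on \<open>N w\<close> and shrinks as \<open>N w\<close>
  grows.\<close>

lemma coupling_mult_le:
  fixes N :: "'w \<Rightarrow> nat" and x :: real
  shows "coupling \<Omega> K (\<lambda>w k. real (k * N w) \<le> x)"
  unfolding coupling_def
proof (intro ballI)
  fix w w'
  have *: "real (k * a) \<le> x" if "a \<le> b" "real (k * b) \<le> x" for a b k :: nat
    using that(2) mult_le_mono2[OF that(1), of k] by linarith
  show "{k \<in> K. real (k * N w) \<le> x} \<subseteq> {k \<in> K. real (k * N w') \<le> x}
      \<or> {k \<in> K. real (k * N w') \<le> x} \<subseteq> {k \<in> K. real (k * N w) \<le> x}"
    using *[of "N w" "N w'"] *[of "N w'" "N w"] linear[of "N w" "N w'"] by blast
qed

lemma coupling_less_mult: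
  fixes N :: "'w \<Rightarrow> nat" and x :: real
  shows "coupling \<Omega> K (\<lambda>w k. x < real (k * N w))"
  unfolding coupling_def
proof (intro ballI)
  fix w w'
  have *: "x < real (k * b)" if "a \<le> b" "x < real (k * a)" for a b k :: nat
    using that(2) mult_le_mono2[OF that(1), of k] by linarith
  show "{k \<in> K. x < real (k * N w)} \<subseteq> {k \<in> K. x < real (k * N w')}
      \<or> {k \<in> K. x < real (k * N w')} \<subseteq> {k \<in> K. x < real (k * N w)}"
    using *[of "N w" "N w'"] *[of "N w'" "N w"] linear[of "N w" "N w'"] by blast
qed

text \<open>Here \<open>X = u\<^sup>4\<close> is the length of the sum, \<open>E\<close> stands for an arbitrarily small power of \<open>X\<close>,
  and \<open>d0\<close> for a constant times \<open>\<delta>\<close>. The only Diophantine input is \<open>spacing\<close>.\<close>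

locale expsum =
  fixes \<alpha> :: real and X :: nat and u E d0 :: real and cf :: "int \<Rightarrow> complex"
  assumes u4: "u ^ 4 = real X" and u2: "2 \<le> u" and E1: "1 \<le> E" and Eu: "E \<le> u"
    and spacing: "\<And>l::nat. 0 < l \<Longrightarrow> E * real l \<le> u\<^sup>2 \<Longrightarrow> 1 / (E * u\<^sup>2) \<le> dist_nint (\<alpha> * real l)"
    and divisors: "\<And>n. 0 < n \<Longrightarrow> n \<le> X\<^sup>2 \<Longrightarrow> real (card {d. d dvd n}) \<le> E"
    and harm_X: "1 + 2 * harm (X\<^sup>2) \<le> E"
    and dyadic: "\<exists>J::nat. X < 2 ^ J \<and> real J \<le> E"
    and d0: "1 \<le> d0 * u" "d0 \<le> 1"
    and cf_le: "\<And>h. norm (cf h) \<le> d0"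
    and cf_decay: "\<And>h. \<bar>h\<bar> < int X \<Longrightarrow> of_int \<bar>h\<bar> * norm (cf h) \<le> 1"
begin

text \<open>The target size X^(3/4) (u d0)^(1/2), the square root of the bound u^4 times d0 u^3
  obtained from Cauchy-Schwarz.\<close>

definition F :: real where
  "F = u ^ 3 * sqrt (u * d0)"

text \<open>Frequency 0 is left out: its coefficient is close to 2 \<delta> and produces the main
  term.\<close>

definition Hs :: "int set" where
  "Hs = {h. h \<noteq> 0 \<and> \<bar>h\<bar> < int X}"

definition W :: "nat \<Rightarrow> complex" where
  "W n = (\<Sum>h\<in>Hs. cf h * ee (\<alpha> * of_int h * real n))"

text \<open>Two members of an interval of \<open>B\<close> integers differ by at most u^2 / E, the
  range of \<open>spacing\<close>. The added 1 makes \<open>B\<close> itself at least u^2 / E, so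
  that there are few blocks.\<close>

definition B :: nat where
  "B = nat \<lfloor>u\<^sup>2 / E\<rfloor> + 1"

lemma finite_Hs [simp]: "finite Hs"
  by (rule finite_subset[of _ "{- int X..int X}"]) (auto simp: Hs_def)

lemma u_pos: "0 < u" and E_pos: "0 < E"
  using u2 E1 by simp_all

lemma d0_pos: "0 < d0"
proof -
  have "0 < d0 * u" using d0(1) by linarith
  then show ?thesis using u_pos zero_less_mult_pos2 by blast
qed

lemma X_large: "16 \<le> real X"
  using power_mono[OF u2, of 4] u4 by simp

lemma u_powers_le: "u\<^sup>2 \<le> real X" "u ^ 3 \<le> real X" "2 * u ^ 3 \<le> real X" "u \<le> u\<^sup>2" "u\<^sup>2 \<le> u ^ 3" "u \<le> u ^ 3"
proof -
  have 1: "1 \<le> u" using u2 by simp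
  show "u\<^sup>2 \<le> real X" "u ^ 3 \<le> real X" "u\<^sup>2 \<le> u ^ 3"
    unfolding u4[symmetric] using 1 by (intro power_increasing; simp)+
  show "u \<le> u\<^sup>2" "u \<le> u ^ 3"
    using power_increasing[of 1 2 u] power_increasing[of 1 3 u] 1 by simp_all
  have "2 * u ^ 3 \<le> u * u ^ 3"
    using u2 by (intro mult_right_mono) auto
  then show "2 * u ^ 3 \<le> real X"
    unfolding u4[symmetric] by (simp add: eval_nat_numeral)
qed

lemma harm_bound: "n \<le> X\<^sup>2 \<Longrightarrow> 1 + 2 * harm n \<le> E"
  using harm_X harm_mono[of n "X\<^sup>2", where ?'a = real] by linarith

lemma F_bounds: "u ^ 3 \<le> F" "d0 * u\<^sup>2 \<le> F" "F\<^sup>2 = u ^ 7 * d0" "0 \<le> F"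
proof -
  have "1 \<le> sqrt (u * d0)"
    using d0 by (simp add: mult.commute)
  then show *: "u ^ 3 \<le> F"
    unfolding F_def using mult_left_mono[of 1 "sqrt (u * d0)" "u ^ 3"] u_pos by simp
  have "d0 * u\<^sup>2 \<le> 1 * u\<^sup>2"
    using d0 by (intro mult_right_mono) auto
  then show "d0 * u\<^sup>2 \<le> F"
    using * u_powers_le by linarith
  have "F\<^sup>2 = (u ^ 3)\<^sup>2 * (u * d0)"
    using u_pos d0_pos by (simp add: F_def power_mult_distrib)
  then show "F\<^sup>2 = u ^ 7 * d0"
    by (simp add: eval_nat_numeral)
  show "0 \<le> F"
    using * u_pos by (meson less_imp_le order.trans zero_le_power)
qed

lemma B_bounds: "0 < B" "u\<^sup>2 / E \<le> real B" "E * real (B - 1) \<le> u\<^sup>2"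
proof -
  have *: "0 \<le> u\<^sup>2 / E" using E_pos by simp
  show "0 < B" by (simp add: B_def)
  show "u\<^sup>2 / E \<le> real B" unfolding B_def using * by linarith
  have "real (B - 1) \<le> u\<^sup>2 / E"
    unfolding B_def using * by simp
  then show "E * real (B - 1) \<le> u\<^sup>2"
    using E_pos by (simp add: field_simps)
qed

lemma spacing_int:
  fixes l l' :: int
  assumes "l \<noteq> l'" "\<bar>l - l'\<bar> < int B"
  shows "1 / (E * u\<^sup>2) \<le> dist_nint (\<alpha> * of_int l - \<alpha> * of_int l')"
proof -
  define m where "m = nat \<bar>l - l'\<bar>"
  have m: "0 < m" "m \<le> B - 1"
    using assms by (auto simp: m_def)
  have "E * real m \<le> E * real (B - 1)"
    using m E_pos by (intro mult_left_mono) auto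
  then have "1 / (E * u\<^sup>2) \<le> dist_nint (\<alpha> * real m)"
    using m(1) B_bounds(3) by (intro spacing) auto
  also have "\<dots> = dist_nint (\<alpha> * of_int l - \<alpha> * of_int l')"
  proof (cases "l' \<le> l")
    case True
    then have "\<alpha> * real m = \<alpha> * of_int l - \<alpha> * of_int l'"
      by (simp add: m_def algebra_simps)
    then show ?thesis by simp
  next
    case False
    then have "\<alpha> * real m = - (\<alpha> * of_int l - \<alpha> * of_int l')"
      by (simp add: m_def algebra_simps)
    then show ?thesis by (simp only: dist_nint_minus)
  qed
  finally show ?thesis .
qed

text \<open>Within one block the points are spaced by 1 / (E u^2) modulo 1, whatever the shift
  \<theta>. The harmonic factor of \<open>spaced_sum\<close> is absorbed into the second
  \<open>E\<close>.\<close>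

lemma sum_phi_block:
  fixes g :: "'b \<Rightarrow> int"
  assumes fin: "finite I" and inj: "inj_on g I" and Y: "0 \<le> Y"
    and near: "\<And>i j. i \<in> I \<Longrightarrow> j \<in> I \<Longrightarrow> \<bar>g i - g j\<bar> < int B"
  shows "(\<Sum>i\<in>I. phi Y (\<alpha> * of_int (g i) + \<theta>)) \<le> 2 * Y + E\<^sup>2 * u\<^sup>2"
proof -
  have "(\<Sum>i\<in>I. phi Y (\<alpha> * of_int (g i) + \<theta>)) \<le> 2 * Y + 2 / (1 / (E * u\<^sup>2)) * harm (X\<^sup>2)"
  proof (rule spaced_sum[OF fin _ Y])
    show "0 < 1 / (E * u\<^sup>2)" using E_pos u_pos by simp
    show "1 / (E * u\<^sup>2) \<le> dist_nint (\<alpha> * of_int (g i) + \<theta> - (\<alpha> * of_int (g j) + \<theta>))"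
      if "i \<in> I" "j \<in> I" "i \<noteq> j" for i j
      using spacing_int[of "g i" "g j"] near[OF that(1,2)] inj that by (auto simp: inj_on_def)
    have "E * u\<^sup>2 \<le> u * u\<^sup>2"
      using Eu by (intro mult_right_mono) auto
    also have "\<dots> = u ^ 3" by (simp add: eval_nat_numeral)
    also have "\<dots> \<le> real X" by (rule u_powers_le)
    also have "\<dots> \<le> real (X\<^sup>2)"
      using X_large by (simp add: power2_eq_square)
    finally have "E * u\<^sup>2 \<le> real (X\<^sup>2)" .
    moreover have "1 / (2 * (1 / (E * u\<^sup>2))) = E * u\<^sup>2 / 2" "0 \<le> E * u\<^sup>2"
      using E_pos by simp_all
    ultimately show "1 / (2 * (1 / (E * u\<^sup>2))) \<le> real (X\<^sup>2)"
      by linarith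
  qed
  also have "2 / (1 / (E * u\<^sup>2)) * harm (X\<^sup>2) = E * u\<^sup>2 * (2 * harm (X\<^sup>2))"
    by simp
  also have "\<dots> \<le> E * u\<^sup>2 * E"
    using harm_X E_pos by (intro mult_left_mono) auto
  finally show ?thesis
    by (simp add: power2_eq_square mult_ac)
qed

lemma sum_norm_cf: "(\<Sum>h\<in>Hs. norm (cf h)) \<le> E"
proof -
  have "(\<Sum>h\<in>Hs. norm (cf h)) \<le> (\<Sum>h\<in>Hs. inverse (real_of_int \<bar>h\<bar>))"
  proof (rule sum_mono)
    fix h assume "h \<in> Hs"
    then show "norm (cf h) \<le> inverse (real_of_int \<bar>h\<bar>)"
      using cf_decay[of h] by (simp add: Hs_def field_simps)
  qed
  also have "\<dots> = (\<Sum>h\<in>int ` {1..X - 1} \<union> (\<lambda>n. - int n) ` {1..X - 1}. inverse (real_of_int \<bar>h\<bar>))"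
  proof (intro sum.cong refl)
    show "Hs = int ` {1..X - 1} \<union> (\<lambda>n. - int n) ` {1..X - 1}"
    proof (intro equalityI subsetI)
      fix h assume h: "h \<in> Hs"
      then have n: "nat \<bar>h\<bar> \<in> {1..X - 1}" by (auto simp: Hs_def)
      have "h = int (nat \<bar>h\<bar>) \<or> h = - int (nat \<bar>h\<bar>)" by auto
      then show "h \<in> int ` {1..X - 1} \<union> (\<lambda>n. - int n) ` {1..X - 1}"
        using n by blast
    qed (auto simp: Hs_def)
  qed
  also have "\<dots> = (\<Sum>h\<in>int ` {1..X - 1}. inverse (real_of_int \<bar>h\<bar>)) + (\<Sum>h\<in>(\<lambda>n. - int n) ` {1..X - 1}. inverse (real_of_int \<bar>h\<bar>))"
    by (rule sum.union_disjoint) auto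
  also have "\<dots> = 2 * harm (X - 1)"
    by (simp add: sum.reindex inj_on_def harm_def)
  also have "\<dots> \<le> E"
  proof -
    have "X - 1 \<le> X\<^sup>2"
      using le_square[of X] unfolding power2_eq_square by linarith
    then show ?thesis
      using harm_bound[of "X - 1"] by simp
  qed
  finally show ?thesis .
qed

lemma norm_W_le: "norm (W n) \<le> E"
proof -
  have "norm (W n) \<le> (\<Sum>h\<in>Hs. norm (cf h))"
    unfolding W_def by (rule order.trans[OF norm_sum]) (simp add: norm_mult)
  then show ?thesis
    using sum_norm_cf by linarith
qed

text \<open>Pairs are collected according to l = h k. By the divisor bound each l occurs at most
  \<open>E\<close> times, so its weight is at most E d0, and also at most E K / |l| because |h|
  |c_h| \<le> 1 and k \<le> K. The blocks then give E^3: one factor from divisors, one from 1/B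
  \<le> E / u^2, one from the harmonic sum.\<close>

lemma sum_cf_weighted:
  fixes K :: nat and p :: "int \<Rightarrow> real"
  assumes K: "K \<le> X" and p: "\<And>l. 0 \<le> p l"
    and Z0: "\<And>s. s = 1 \<or> s = - 1 \<Longrightarrow> (\<Sum>l\<in>{1..<B}. p (s * int l)) \<le> Z0"
    and Z1: "\<And>s a. s = 1 \<or> s = - 1 \<Longrightarrow> (\<Sum>l\<in>{a..<a + B}. p (s * int l)) \<le> Z1"
  shows "(\<Sum>(k, h)\<in>{1..K} \<times> Hs. norm (cf h) * p (h * int k)) \<le> 2 * E * d0 * Z0 + E ^ 3 * (real K / u\<^sup>2) * Z1"
proof -
  define P where "P = {1..K} \<times> Hs"
  define r where "r l = (\<Sum>q\<in>{q \<in> P. snd q * int (fst q) = l}. norm (cf (snd q)))" for l :: int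
  have finP: "finite P" by (simp add: P_def)
  have fiber: "real (card {q \<in> P. snd q * int (fst q) = l}) \<le> E" if l: "0 < \<bar>l\<bar>" "\<bar>l\<bar> \<le> int (X\<^sup>2)" for l
  proof -
    have "card {q \<in> P. snd q * int (fst q) = l} \<le> card {d. d dvd nat \<bar>l\<bar>}"
    proof (rule card_inj_on_le[of fst])
      show "inj_on fst {q \<in> P. snd q * int (fst q) = l}"
        by (auto simp: inj_on_def P_def)
      show "fst ` {q \<in> P. snd q * int (fst q) = l} \<subseteq> {d. d dvd nat \<bar>l\<bar>}"
        by (auto simp: abs_mult nat_mult_distrib)
      show "finite {d. d dvd nat \<bar>l\<bar>}" using l by (intro finite_divisors_nat) simp
    qed
    also have "real (card {d. d dvd nat \<bar>l\<bar>}) \<le> E"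
      using l by (intro divisors) (simp_all add: nat_le_iff)
    finally show ?thesis by simp
  qed
  have r0: "0 \<le> r l" for l
    unfolding r_def by (intro sum_nonneg) auto
  have r1: "r l \<le> E * d0" if "0 < \<bar>l\<bar>" "\<bar>l\<bar> \<le> int (X\<^sup>2)" for l
  proof -
    have "r l \<le> (\<Sum>q\<in>{q \<in> P. snd q * int (fst q) = l}. d0)"
      unfolding r_def by (intro sum_mono cf_le)
    also have "\<dots> = real (card {q \<in> P. snd q * int (fst q) = l}) * d0" by simp
    also have "\<dots> \<le> E * d0"
      using fiber[OF that] d0_pos by (intro mult_right_mono) auto
    finally show ?thesis .
  qed
  have r2: "of_int \<bar>l\<bar> * r l \<le> E * real K" if "0 < \<bar>l\<bar>" "\<bar>l\<bar> \<le> int (X\<^sup>2)" for l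
  proof -
    have "of_int \<bar>l\<bar> * r l \<le> (\<Sum>q\<in>{q \<in> P. snd q * int (fst q) = l}. real K)"
      unfolding r_def sum_distrib_left
    proof (rule sum_mono)
      fix q assume q: "q \<in> {q \<in> P. snd q * int (fst q) = l}"
      then have "of_int \<bar>l\<bar> * norm (cf (snd q)) = real (fst q) * (of_int \<bar>snd q\<bar> * norm (cf (snd q)))"
        by (auto simp: abs_mult)
      also have "\<dots> \<le> real K * 1"
        using q cf_decay[of "snd q"] by (intro mult_mono) (auto simp: P_def Hs_def)
      finally show "of_int \<bar>l\<bar> * norm (cf (snd q)) \<le> real K" by simp
    qed
    also have "\<dots> = real (card {q \<in> P. snd q * int (fst q) = l}) * real K" by simp
    also have "\<dots> \<le> E * real K"
      using fiber[OF that] by (intro mult_right_mono) auto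
    finally show ?thesis .
  qed
  define N where "N = X * K"
  have NX: "N \<le> X\<^sup>2" using K by (simp add: N_def power2_eq_square)
  define \<Lambda> where "\<Lambda> = int ` {1..N} \<union> (\<lambda>n. - int n) ` {1..N}"
  have "(\<Sum>(k, h)\<in>{1..K} \<times> Hs. norm (cf h) * p (h * int k)) = (\<Sum>q\<in>P. norm (cf (snd q)) * p (snd q * int (fst q)))"
    by (simp add: P_def case_prod_beta)
  also have "\<dots> = (\<Sum>l\<in>\<Lambda>. \<Sum>q\<in>{q \<in> P. snd q * int (fst q) = l}. norm (cf (snd q)) * p (snd q * int (fst q)))"
  proof (rule sum.group[symmetric])
    show "(\<lambda>q. snd q * int (fst q)) ` P \<subseteq> \<Lambda>"
    proof clarify
      fix k h assume kh: "(k, h) \<in> P"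
      define n where "n = nat \<bar>h\<bar> * k"
      have "1 \<le> nat \<bar>h\<bar>" "nat \<bar>h\<bar> \<le> X" "1 \<le> k" "k \<le> K"
        using kh by (auto simp: P_def Hs_def)
      then have n: "n \<in> {1..N}"
        unfolding n_def N_def by (auto intro!: mult_le_mono)
      have "h * int k = int n \<or> h * int k = - int n"
        by (cases "0 \<le> h") (auto simp: n_def)
      then show "snd (k, h) * int (fst (k, h)) \<in> \<Lambda>"
        using n unfolding \<Lambda>_def by auto
    qed
  qed (auto simp: finP \<Lambda>_def)
  also have "\<dots> = (\<Sum>l\<in>\<Lambda>. r l * p l)"
    unfolding r_def sum_distrib_right by (intro sum.cong) auto
  also have "\<dots> = (\<Sum>l\<in>int ` {1..N}. r l * p l) + (\<Sum>l\<in>(\<lambda>n. - int n) ` {1..N}. r l * p l)"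
    unfolding \<Lambda>_def by (rule sum.union_disjoint) auto
  also have "\<dots> = (\<Sum>l\<in>{1..N}. r (1 * int l) * p (1 * int l)) + (\<Sum>l\<in>{1..N}. r (- 1 * int l) * p (- 1 * int l))"
    by (simp add: sum.reindex inj_on_def)
  also have "\<dots> \<le> 2 * (E * d0 * Z0 + E * real K / real B * harm N * Z1)"
  proof -
    have "(\<Sum>l\<in>{1..N}. r (s * int l) * p (s * int l)) \<le> E * d0 * Z0 + E * real K / real B * harm N * Z1"
      if s: "s = 1 \<or> s = - 1" for s
    proof (rule sum_weighted_blocks)
      fix l assume "l \<in> {1..N}"
      then have l: "0 < \<bar>s * int l\<bar>" "\<bar>s * int l\<bar> \<le> int (X\<^sup>2)"
        using s NX by (auto simp: abs_mult simp del: of_nat_power)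
      show "r (s * int l) \<le> E * d0" using r1[OF l] .
      show "real l * r (s * int l) \<le> E * real K" using r2[OF l] s by (auto simp: abs_mult)
    qed (use B_bounds r0 p E_pos d0_pos Z0[OF s] Z1[OF s] in auto)
    from this[of 1, OF disjI1[OF refl]] this[of "- 1", OF disjI2[OF refl]] show ?thesis
      unfolding mult_2 by (rule add_mono)
  qed
  also have "\<dots> \<le> 2 * E * d0 * Z0 + E ^ 3 * (real K / u\<^sup>2) * Z1"
  proof -
    have "0 \<le> (\<Sum>l\<in>{0..<0 + B}. p (1 * int l))"
      using p by (intro sum_nonneg) auto
    then have Z1n: "0 \<le> Z1" using Z1[of 1 0] by linarith
    have "1 / real B \<le> E / u\<^sup>2"
      using B_bounds(1,2) E_pos u_pos by (simp add: field_simps)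
    then have "E * real K * (1 / real B) * (2 * harm N) * Z1 \<le> E * real K * (E / u\<^sup>2) * E * Z1"
      using harm_bound[OF NX] E_pos Z1n harm_nonneg[of N, where ?'a = real]
      by (intro mult_right_mono mult_mono mult_left_mono) auto
    then show ?thesis
      by (simp add: algebra_simps power3_eq_cube)
  qed
  finally show ?thesis .
qed

lemma sum_phi_shift_block:
  assumes Y: "0 \<le> Y" and s: "s = 1 \<or> s = - 1"
  shows "(\<Sum>l\<in>{a..<a + B}. phi Y (\<alpha> * of_int (s * int l) + \<theta>)) \<le> 2 * Y + E\<^sup>2 * u\<^sup>2"
  by (rule sum_phi_block[OF _ _ Y]) (use s in \<open>auto simp: inj_on_def abs_if\<close>)

section \<open>Bilinear sums on a dyadic block\<close>

text \<open>Opening the square turns the sum over m into a geometric sum at \<alpha> (h k - h' k').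
  For fixed (k', h') the other pair is summed by \<open>sum_cf_weighted\<close> with shift -
  \<alpha> h' k'; the remaining sum over (k', h') of |c_h'| costs only K E.\<close>

lemma typeII_dyadic:
  fixes K M :: nat and b :: "nat \<Rightarrow> complex"
  assumes K: "real K \<le> u\<^sup>2" and M: "0 < M" "real M \<le> u ^ 3" and KM: "K * M \<le> X"
    and b: "\<forall>k. norm (b k) \<le> 1"
  shows "(\<Sum>m\<in>{M..<2 * M}. norm (\<Sum>k\<in>{1..K}. b k * W (k * m))) \<le> 4 * E ^ 3 * F"
proof -
  define P where "P = {1..K} \<times> Hs"
  define a where "a q = b (fst q) * cf (snd q)" for q
  define l where "l q = snd q * int (fst q)" for q :: "nat \<times> int"
  define S where "S m = (\<Sum>k\<in>{1..K}. b k * W (k * m))" for m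
  define Z where "Z = 2 * real M + E\<^sup>2 * u\<^sup>2"
  have KX: "K \<le> X"
    using KM M(1) by (cases M) auto
  have a_le: "norm (a q) \<le> norm (cf (snd q))" for q
    using b by (simp add: a_def norm_mult mult_left_le_one_le)
  have S: "S m = (\<Sum>q\<in>P. a q * ee (real m * (\<alpha> * of_int (l q))))" for m
    unfolding S_def W_def P_def a_def l_def sum_distrib_left sum.cartesian_product
    by (intro sum.cong) (auto simp: mult_ac)
  have sq: "complex_of_real (\<Sum>m\<in>{M..<2 * M}. (norm (S m))\<^sup>2) =
      (\<Sum>q\<in>P. \<Sum>q'\<in>P. a q * cnj (a q') * (\<Sum>m\<in>{M..<2 * M}. ee (real m * (\<alpha> * of_int (l q) + - \<alpha> * of_int (l q')))))"
  proof -
    have "complex_of_real ((norm (S m))\<^sup>2) =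
       (\<Sum>q\<in>P. \<Sum>q'\<in>P. a q * cnj (a q') * ee (real m * (\<alpha> * of_int (l q) + - \<alpha> * of_int (l q'))))" for m
    proof -
      have "complex_of_real ((norm (S m))\<^sup>2) = S m * cnj (S m)"
        by (rule complex_norm_square)
      also have "\<dots> = (\<Sum>q\<in>P. \<Sum>q'\<in>P. a q * cnj (a q') * (ee (real m * (\<alpha> * of_int (l q))) * ee (- (real m * (\<alpha> * of_int (l q'))))))"
        by (simp add: S sum_product cnj_ee mult_ac)
      finally show ?thesis
        by (simp add: algebra_simps flip: ee_add)
    qed
    then have "complex_of_real (\<Sum>m\<in>{M..<2 * M}. (norm (S m))\<^sup>2) =
      (\<Sum>m\<in>{M..<2 * M}. \<Sum>q\<in>P. \<Sum>q'\<in>P. a q * cnj (a q') * ee (real m * (\<alpha> * of_int (l q) + - \<alpha> * of_int (l q'))))"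
      by simp
    also have "\<dots> = (\<Sum>q\<in>P. \<Sum>m\<in>{M..<2 * M}. \<Sum>q'\<in>P. a q * cnj (a q') * ee (real m * (\<alpha> * of_int (l q) + - \<alpha> * of_int (l q'))))"
      by (rule sum.swap)
    also have "\<dots> = (\<Sum>q\<in>P. \<Sum>q'\<in>P. \<Sum>m\<in>{M..<2 * M}. a q * cnj (a q') * ee (real m * (\<alpha> * of_int (l q) + - \<alpha> * of_int (l q'))))"
      by (intro sum.cong refl sum.swap)
    finally show ?thesis
      by (simp add: sum_distrib_left)
  qed
  have "(\<Sum>m\<in>{M..<2 * M}. (norm (S m))\<^sup>2) = norm (complex_of_real (\<Sum>m\<in>{M..<2 * M}. (norm (S m))\<^sup>2))"
    by (simp only: norm_of_real) (simp add: sum_nonneg)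
  also have "\<dots> \<le> (\<Sum>q\<in>P. \<Sum>q'\<in>P. norm (cf (snd q)) * norm (cf (snd q')) * phi (real M) (\<alpha> * of_int (l q) + - \<alpha> * of_int (l q')))"
    unfolding sq
  proof (intro order.trans[OF norm_sum] sum_mono)
    fix q q'
    have "norm (\<Sum>m\<in>{M..<2 * M}. ee (real m * (\<alpha> * of_int (l q) + - \<alpha> * of_int (l q'))))
        \<le> phi (real M) (\<alpha> * of_int (l q) + - \<alpha> * of_int (l q'))"
      using norm_geometric_ee[of "\<alpha> * of_int (l q) + - \<alpha> * of_int (l q')" M "2 * M"] by simp
    then show "norm (a q * cnj (a q') * (\<Sum>m\<in>{M..<2 * M}. ee (real m * (\<alpha> * of_int (l q) + - \<alpha> * of_int (l q')))))
        \<le> norm (cf (snd q)) * norm (cf (snd q')) * phi (real M) (\<alpha> * of_int (l q) + - \<alpha> * of_int (l q'))"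
      using a_le by (simp add: norm_mult mult_mono)
  qed
  also have "\<dots> = (\<Sum>q'\<in>P. norm (cf (snd q')) * (\<Sum>(k, h)\<in>{1..K} \<times> Hs. norm (cf h) * phi (real M) (\<alpha> * of_int (h * int k) + - \<alpha> * of_int (l q'))))"
    by (subst sum.swap) (simp add: sum_distrib_left P_def l_def case_prod_beta mult_ac)
  also have "\<dots> \<le> (\<Sum>q'\<in>P. norm (cf (snd q')) * (2 * E * d0 * Z + E ^ 3 * (real K / u\<^sup>2) * Z))"
  proof (intro sum_mono mult_left_mono)
    fix q'
    show "(\<Sum>(k, h)\<in>{1..K} \<times> Hs. norm (cf h) * phi (real M) (\<alpha> * of_int (h * int k) + - \<alpha> * of_int (l q')))
        \<le> 2 * E * d0 * Z + E ^ 3 * (real K / u\<^sup>2) * Z"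
    proof (rule sum_cf_weighted[OF KX])
      fix s :: int assume s: "s = 1 \<or> s = - 1"
      show *: "(\<Sum>i\<in>{a..<a + B}. phi (real M) (\<alpha> * of_int (s * int i) + - \<alpha> * of_int (l q'))) \<le> Z" for a
        unfolding Z_def by (rule sum_phi_shift_block[OF _ s]) simp
      \<comment> \<open>With an arbitrary shift nothing is gained from omitting l = 0, so the
        initial block receives the bound of a full block.\<close>
      have "(\<Sum>i\<in>{1..<B}. phi (real M) (\<alpha> * of_int (s * int i) + - \<alpha> * of_int (l q')))
          \<le> (\<Sum>i\<in>{0..<0 + B}. phi (real M) (\<alpha> * of_int (s * int i) + - \<alpha> * of_int (l q')))"
        by (intro sum_mono2) (auto simp: phi_nonneg)
      then show "(\<Sum>i\<in>{1..<B}. phi (real M) (\<alpha> * of_int (s * int i) + - \<alpha> * of_int (l q'))) \<le> Z"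
        using *[of 0] by linarith
    qed (simp add: phi_nonneg)
  qed simp
  also have "\<dots> = real K * (\<Sum>h\<in>Hs. norm (cf h)) * (2 * E * d0 * Z + E ^ 3 * (real K / u\<^sup>2) * Z)"
    unfolding P_def sum_distrib_right[symmetric] by (simp add: sum.cartesian_product')
  also have "\<dots> \<le> real K * E * (2 * E ^ 3 * d0 * Z + 2 * E ^ 3 * (real K / u\<^sup>2) * Z)"
  proof (rule mult_mono)
    have Z0: "0 \<le> Z" by (simp add: Z_def)
    have "E \<le> E ^ 3" using power_increasing[of 1 3 E] E1 by simp
    then have "2 * E * d0 * Z \<le> 2 * E ^ 3 * d0 * Z"
      using Z0 d0_pos by (intro mult_right_mono mult_left_mono) auto
    moreover have "E ^ 3 * (real K / u\<^sup>2) * Z \<le> 2 * E ^ 3 * (real K / u\<^sup>2) * Z"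
      using Z0 E_pos by (intro mult_right_mono) auto
    ultimately show "2 * E * d0 * Z + E ^ 3 * (real K / u\<^sup>2) * Z \<le> 2 * E ^ 3 * d0 * Z + 2 * E ^ 3 * (real K / u\<^sup>2) * Z"
      by (rule add_mono)
    show "0 \<le> 2 * E * d0 * Z + E ^ 3 * (real K / u\<^sup>2) * Z"
      using Z0 E_pos d0_pos by auto
  qed (use sum_norm_cf E_pos in \<open>auto intro: mult_left_mono\<close>)
  also have "\<dots> = 2 * E ^ 4 * real K * (d0 + real K / u\<^sup>2) * Z"
  proof -
    have 1: "k * e * (2 * f * d * z + 2 * f * g * z) = 2 * (e * f) * k * (d + g) * z" for k e f d g z :: real
      by (simp add: algebra_simps)
    have 2: "E * E ^ 3 = E ^ 4"
      by (simp flip: power_Suc)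
    show ?thesis unfolding 1 2 ..
  qed
  finally have sq_le: "(\<Sum>m\<in>{M..<2 * M}. (norm (S m))\<^sup>2) \<le> 2 * E ^ 4 * real K * (d0 + real K / u\<^sup>2) * Z" .
  have Z_le: "Z \<le> 2 * E\<^sup>2 * (real M + u\<^sup>2)"
  proof -
    have "1 * real M \<le> E\<^sup>2 * real M"
      using one_le_power[OF E1, of 2] by (intro mult_right_mono) auto
    moreover have "0 \<le> E\<^sup>2 * u\<^sup>2" by simp
    moreover have "2 * E\<^sup>2 * (real M + u\<^sup>2) = 2 * (E\<^sup>2 * real M) + 2 * (E\<^sup>2 * u\<^sup>2)"
      by (simp add: algebra_simps)
    ultimately show ?thesis
      unfolding Z_def by linarith
  qed
  \<comment> \<open>Of the four products in the second factor, d0 M and d0 u^2 are at most d0 u^3.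
    The other two are at most u^2, by K M \<le> u^4 and K \<le> u^2, and u^2 \<le> d0 u^3 because d0
    u \<ge> 1.\<close>
  have poly: "real M * real K * ((d0 + real K / u\<^sup>2) * (real M + u\<^sup>2)) \<le> u ^ 4 * (4 * (d0 * u ^ 3))"
  proof (rule mult_mono)
    show MK: "real M * real K \<le> u ^ 4"
      unfolding u4 using KM by (metis mult.commute of_nat_le_iff of_nat_mult)
    have "u\<^sup>2 * 1 \<le> u\<^sup>2 * (d0 * u)"
      using d0 by (intro mult_left_mono) auto
    then have 1: "u\<^sup>2 \<le> d0 * u ^ 3"
      by (simp add: eval_nat_numeral mult_ac)
    have "real K / u\<^sup>2 * real M \<le> u\<^sup>2"
      using MK u_pos by (simp add: field_simps eval_nat_numeral)
    moreover have "real K / u\<^sup>2 * u\<^sup>2 \<le> u\<^sup>2"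
      using K u_pos by simp
    moreover have "d0 * real M \<le> d0 * u ^ 3" "d0 * u\<^sup>2 \<le> d0 * u ^ 3"
      using M u_powers_le d0_pos by (auto intro: mult_left_mono)
    ultimately show "(d0 + real K / u\<^sup>2) * (real M + u\<^sup>2) \<le> 4 * (d0 * u ^ 3)"
      unfolding distrib_left distrib_right using 1 by linarith
  qed (use u_pos d0_pos in auto)
  have "(\<Sum>m\<in>{M..<2 * M}. norm (S m))\<^sup>2 \<le> real (card {M..<2 * M}) * (\<Sum>m\<in>{M..<2 * M}. (norm (S m))\<^sup>2)"
    using Cauchy_Schwarz_ineq_sum[of "\<lambda>_. 1" "\<lambda>m. norm (S m)" "{M..<2 * M}"] by simp
  also have "\<dots> \<le> real M * (2 * E ^ 4 * real K * (d0 + real K / u\<^sup>2) * (2 * E\<^sup>2 * (real M + u\<^sup>2)))"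
  proof (rule mult_mono)
    have "2 * E ^ 4 * real K * (d0 + real K / u\<^sup>2) * Z \<le> 2 * E ^ 4 * real K * (d0 + real K / u\<^sup>2) * (2 * E\<^sup>2 * (real M + u\<^sup>2))"
      using E_pos d0_pos Z_le by (intro mult_left_mono) auto
    then show "(\<Sum>m\<in>{M..<2 * M}. (norm (S m))\<^sup>2) \<le> 2 * E ^ 4 * real K * (d0 + real K / u\<^sup>2) * (2 * E\<^sup>2 * (real M + u\<^sup>2))"
      using sq_le by linarith
  qed (auto intro: sum_nonneg)
  also have "\<dots> = 4 * E ^ 6 * (real M * real K * ((d0 + real K / u\<^sup>2) * (real M + u\<^sup>2)))"
  proof -
    have 1: "a * (2 * e * b * p * (2 * f * q)) = 4 * (e * f) * (a * b * (p * q))" for a b e f p q :: real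
      by (simp add: mult_ac)
    have 2: "E ^ 4 * E\<^sup>2 = E ^ 6"
      by (simp flip: power_add)
    show ?thesis unfolding 1 2 ..
  qed
  also have "\<dots> \<le> 4 * E ^ 6 * (u ^ 4 * (4 * (d0 * u ^ 3)))"
    using E_pos by (intro mult_left_mono poly) auto
  also have "\<dots> = (4 * E ^ 3)\<^sup>2 * (u ^ 7 * d0)"
  proof -
    have 1: "u ^ 7 = u ^ 4 * u ^ 3"
      by (simp flip: power_add)
    have 2: "(4 * E ^ 3)\<^sup>2 = 16 * E ^ 6"
      by (simp add: power_mult_distrib flip: power_mult)
    show ?thesis unfolding 1 2 by simp
  qed
  also have "\<dots> = (4 * E ^ 3 * F)\<^sup>2"
    unfolding power_mult_distrib[of "4 * E ^ 3" F] F_bounds(3) ..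
  finally have "(\<Sum>m\<in>{M..<2 * M}. norm (S m)) \<le> 4 * E ^ 3 * F"
    by (rule power2_le_imp_le) (use E_pos F_bounds(4) in simp)
  then show ?thesis
    unfolding S_def .
qed

end

section \<open>Linear sums, and bilinear sums with coupled variables\<close>

context expsum
begin

text \<open>Without a shift, the initial block is free of points close to 0, so the large value Y =
  X / M enters only with the weight M / u^2 of the later blocks and contributes about X / u^2 = u^2.
  The term of order M \<le> u^3 remains.\<close>

lemma typeI_dyadic:
  fixes M :: nat
  assumes M: "0 < M" "real M \<le> u ^ 3"
  shows "(\<Sum>m\<in>{M..<2 * M}. \<Sum>h\<in>Hs. norm (cf h) * phi (real X / real m) (\<alpha> * of_int (h * int m))) \<le> 12 * E ^ 5 * F"
proof -
  define Y where "Y = real X / real M"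
  have Y0: "0 \<le> Y" by (simp add: Y_def)
  have "(\<Sum>m\<in>{M..<2 * M}. \<Sum>h\<in>Hs. norm (cf h) * phi (real X / real m) (\<alpha> * of_int (h * int m)))
      \<le> (\<Sum>m\<in>{M..<2 * M}. \<Sum>h\<in>Hs. norm (cf h) * phi Y (\<alpha> * of_int (h * int m)))"
    using M unfolding Y_def
    by (intro sum_mono mult_left_mono phi_mono divide_left_mono) auto
  also have "\<dots> \<le> (\<Sum>m\<in>{1..2 * M}. \<Sum>h\<in>Hs. norm (cf h) * phi Y (\<alpha> * of_int (h * int m)))"
    using M Y0 by (intro sum_mono2) (auto intro!: sum_nonneg mult_nonneg_nonneg phi_nonneg)
  also have "\<dots> = (\<Sum>(k, h)\<in>{1..2 * M} \<times> Hs. norm (cf h) * phi Y (\<alpha> * of_int (h * int k)))"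
    by (simp add: sum.cartesian_product)
  also have "\<dots> \<le> 2 * E * d0 * (3 * E\<^sup>2 * u\<^sup>2) + E ^ 3 * (real (2 * M) / u\<^sup>2) * (2 * Y + E\<^sup>2 * u\<^sup>2)"
  proof (rule sum_cf_weighted)
    have "real (2 * M) \<le> real X"
      using M u_powers_le(3) by simp
    then show "2 * M \<le> X" by (simp only: of_nat_le_iff)
    show "0 \<le> phi Y (\<alpha> * of_int l)" for l
      using Y0 by (rule phi_nonneg)
    fix s :: int assume s: "s = 1 \<or> s = - 1"
    show "(\<Sum>l\<in>{a..<a + B}. phi Y (\<alpha> * of_int (s * int l))) \<le> 2 * Y + E\<^sup>2 * u\<^sup>2" for a
      using sum_phi_shift_block[OF Y0 s, of 0 a] by simp
    \<comment> \<open>For 0 < l < B the point \<alpha> l keeps distance 1 / (E u^2) from the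
      integers, so \<open>phi Y\<close> is dominated by \<open>phi (E * u\<^sup>2)\<close>, whose
      block sum does not involve \<open>Y\<close>.\<close>
    have "(\<Sum>l\<in>{1..<B}. phi Y (\<alpha> * of_int (s * int l))) \<le> (\<Sum>l\<in>{1..<B}. phi (E * u\<^sup>2) (\<alpha> * of_int (s * int l)))"
    proof (rule sum_mono, rule le_phi)
      fix l assume l: "l \<in> {1..<B}"
      have "1 / (E * u\<^sup>2) \<le> dist_nint (\<alpha> * of_int (s * int l) - \<alpha> * of_int 0)"
        using l s by (intro spacing_int) auto
      then have "phi Y (\<alpha> * of_int (s * int l)) * (1 / (E * u\<^sup>2)) \<le> phi Y (\<alpha> * of_int (s * int l)) * dist_nint (\<alpha> * of_int (s * int l))"
        using Y0 by (intro mult_left_mono phi_nonneg) auto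
      also have "\<dots> \<le> 1" by (rule phi_mult_le)
      finally show "phi Y (\<alpha> * of_int (s * int l)) \<le> E * u\<^sup>2"
        using E_pos u_pos by (simp add: field_simps)
    qed (rule phi_mult_le)
    also have "\<dots> \<le> (\<Sum>l\<in>{0..<0 + B}. phi (E * u\<^sup>2) (\<alpha> * of_int (s * int l)))"
      using E_pos by (intro sum_mono2) (auto intro!: phi_nonneg)
    also have "\<dots> \<le> 2 * (E * u\<^sup>2) + E\<^sup>2 * u\<^sup>2"
      using sum_phi_shift_block[OF _ s, of "E * u\<^sup>2" 0 0] E_pos by simp
    also have "\<dots> \<le> 3 * E\<^sup>2 * u\<^sup>2"
    proof -
      have "E * u\<^sup>2 \<le> E\<^sup>2 * u\<^sup>2"
        using power_increasing[of 1 2 E] E1 by (intro mult_right_mono) auto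
      then show ?thesis by simp
    qed
    finally show "(\<Sum>l\<in>{1..<B}. phi Y (\<alpha> * of_int (s * int l))) \<le> 3 * E\<^sup>2 * u\<^sup>2" .
  qed
  also have "\<dots> = 6 * E ^ 3 * (d0 * u\<^sup>2) + 4 * E ^ 3 * u\<^sup>2 + 2 * E ^ 5 * real M"
    using M u_pos unfolding Y_def u4[symmetric] by (simp add: field_simps eval_nat_numeral)
  also have "\<dots> \<le> 6 * E ^ 5 * F + 4 * E ^ 5 * F + 2 * E ^ 5 * F"
  proof -
    have E35: "E ^ 3 \<le> E ^ 5" using E1 by (intro power_increasing) auto
    have uF: "u\<^sup>2 \<le> F" "real M \<le> F" using F_bounds(1) u_powers_le M by linarith+
    show ?thesis
      using E35 E_pos uF F_bounds d0_pos by (intro add_mono mult_mono mult_left_mono) auto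
  qed
  also have "\<dots> = 12 * E ^ 5 * F" by algebra
  finally show ?thesis .
qed

lemma typeI:
  "(\<Sum>m\<in>{m. 0 < m \<and> real m \<le> u ^ 3}. \<Sum>h\<in>Hs. norm (cf h) * phi (real X / real m) (\<alpha> * of_int (h * int m))) \<le> 12 * E ^ 6 * F"
proof -
  obtain J :: nat where J: "X < 2 ^ J" "real J \<le> E"
    using dyadic by blast
  define G where "G m = (\<Sum>h\<in>Hs. norm (cf h) * phi (real X / real m) (\<alpha> * of_int (h * int m)))" for m :: nat
  define A where "A = {m::nat. 0 < m \<and> real m \<le> u ^ 3}"
  have AX: "m \<le> X" if "m \<in> A" for m
  proof -
    have "real m \<le> real X"
      using that u_powers_le(2) unfolding A_def by simp
    then show ?thesis by (simp only: of_nat_le_iff)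
  qed
  have finA: "finite A"
    by (rule finite_subset[of _ "{..X}"]) (use AX in auto)
  have G0: "0 \<le> G m" for m
    unfolding G_def by (intro sum_nonneg mult_nonneg_nonneg phi_nonneg) auto
  have "sum G A = (\<Sum>j\<in>{..<J}. sum G {m \<in> A. dyadic_log m = j})"
  proof (rule sum.group[symmetric])
    show "dyadic_log ` A \<subseteq> {..<J}"
    proof (intro image_subsetI)
      fix m assume m: "m \<in> A"
      have "m < 2 ^ J" using AX[OF m] J(1) by linarith
      then show "dyadic_log m \<in> {..<J}" using m dyadic_log_less[of m J] by (simp add: A_def)
    qed
  qed (auto simp: finA)
  also have "\<dots> \<le> (\<Sum>j\<in>{..<J}. 12 * E ^ 5 * F)"
  proof (rule sum_mono)
    fix j
    show "sum G {m \<in> A. dyadic_log m = j} \<le> 12 * E ^ 5 * F"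
    proof (cases "{m \<in> A. dyadic_log m = j} = {}")
      case True
      then show ?thesis unfolding True using E_pos F_bounds(4) by simp
    next
      case False
      then obtain m where m: "m \<in> A" "dyadic_log m = j" by blast
      then have "2 ^ j \<le> m" using dyadic_log(1)[of m] by (auto simp: A_def)
      then have "real (2 ^ j) \<le> real m" by (simp only: of_nat_le_iff)
      also have "\<dots> \<le> u ^ 3"
        using m(1) by (simp add: A_def)
      finally have j: "real (2 ^ j) \<le> u ^ 3" .
      have "sum G {m \<in> A. dyadic_log m = j} \<le> sum G {2 ^ j..<2 * 2 ^ j}"
        using dyadic_log(1,2)[of m for m] by (intro sum_mono2 G0) (auto simp: A_def)
      also have "\<dots> \<le> 12 * E ^ 5 * F"
        unfolding G_def by (rule typeI_dyadic) (use j in auto)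
      finally show ?thesis .
    qed
  qed
  also have "\<dots> = real J * (12 * E ^ 5 * F)" by simp
  also have "\<dots> \<le> E * (12 * E ^ 5 * F)"
    using J(2) E_pos F_bounds(4) by (intro mult_right_mono) auto
  finally show ?thesis
    by (simp add: A_def G_def eval_nat_numeral mult_ac)
qed

definition K0 :: nat where
  "K0 = nat \<lfloor>u\<^sup>2\<rfloor>"

lemma le_K0_iff: "k \<le> K0 \<longleftrightarrow> real k \<le> u\<^sup>2"
  by (simp add: K0_def le_nat_iff le_floor_iff)

text \<open>The terms are grouped by the dyadic size of \<open>N w\<close>; \<open>D\<close> bounds
  how often a value of \<open>N\<close> repeats. The exponent n + 5 is 3 from the dyadic estimate, n
  + 1 from the couplings including k N(w) \<le> X, and 1 from the number of blocks.\<close>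

lemma typeII:
  fixes \<Omega> :: "'w set" and N :: "'w \<Rightarrow> nat"
  assumes fin: "finite \<Omega>" and N: "\<And>w. w \<in> \<Omega> \<Longrightarrow> 0 < N w \<and> real (N w) \<le> u ^ 3"
    and D: "\<And>m. real (card {w \<in> \<Omega>. N w = m}) \<le> D"
    and g: "coupled \<Omega> {1..K0} n g"
  shows "(\<Sum>w\<in>\<Omega>. norm (\<Sum>k\<in>{1..K0}. of_bool (k * N w \<le> X) * g w k * W (k * N w)))
           \<le> 4 * D * E ^ (n + 5) * F"
proof -
  obtain J :: nat where J: "X < 2 ^ J" "real J \<le> E"
    using dyadic by blast
  define G where "G w = norm (\<Sum>k\<in>{1..K0}. of_bool (k * N w \<le> X) * g w k * W (k * N w))" for w
  define A where "A j = {w \<in> \<Omega>. dyadic_log (N w) = j}" for j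
  have NX: "N w \<le> X" if "w \<in> \<Omega>" for w
  proof -
    have "real (N w) \<le> real X"
      using N[OF that] u_powers_le(2) by simp
    then show ?thesis by (simp only: of_nat_le_iff)
  qed
  have D0: "0 \<le> D" using D[of 0] by (meson of_nat_0_le_iff order.trans)
  have K0X: "K0 + 2 \<le> X\<^sup>2"
  proof -
    have "real K0 \<le> real X"
      using le_K0_iff[of K0] u_powers_le(1) by linarith
    then have "real K0 + 2 \<le> 2 * real X" using X_large by linarith
    also have "\<dots> \<le> real X * real X" using X_large by (intro mult_right_mono) auto
    finally have "real (K0 + 2) \<le> real (X\<^sup>2)" by (simp add: power2_eq_square)
    then show ?thesis by (simp only: of_nat_le_iff)
  qed
  have "sum G \<Omega> = (\<Sum>j\<in>{..<J}. sum G (A j))"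
    unfolding A_def
  proof (rule sum.group[symmetric])
    show "(\<lambda>w. dyadic_log (N w)) ` \<Omega> \<subseteq> {..<J}"
    proof (intro image_subsetI)
      fix w assume w: "w \<in> \<Omega>"
      have "N w < 2 ^ J" using NX[OF w] J(1) by linarith
      then show "dyadic_log (N w) \<in> {..<J}" using N[OF w] dyadic_log_less[of "N w" J] by simp
    qed
  qed (auto simp: fin)
  also have "\<dots> \<le> (\<Sum>j\<in>{..<J}. 4 * D * E ^ (n + 4) * F)"
  proof (rule sum_mono)
    fix j
    show "sum G (A j) \<le> 4 * D * E ^ (n + 4) * F"
    proof (cases "A j = {}")
      case True
      then show ?thesis unfolding True using E_pos F_bounds(4) D0 by simp
    next
      case False
      define M :: nat where "M = 2 ^ j"
      \<comment> \<open>On this block N(w) \<ge> M, so k N(w) \<le> X forces k \<le> X div M. The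
        cut loses no term and supplies K M \<le> X.\<close>
      define K where "K = min K0 (X div M)"
      have range: "N w \<in> {M..<2 * M}" if "w \<in> A j" for w
        using that N dyadic_log[of "N w"] by (auto simp: A_def M_def)
      obtain w where w: "w \<in> A j" using False by blast
      have M0: "0 < M" by (simp add: M_def)
      have M3: "real M \<le> u ^ 3"
      proof -
        have "real M \<le> real (N w)" using range[OF w] by simp
        also have "\<dots> \<le> u ^ 3" using N[of w] w by (auto simp: A_def)
        finally show ?thesis .
      qed
      have base: "(\<Sum>w\<in>A j. norm (\<Sum>k\<in>{1..K}. b k * W (k * N w))) \<le> D * (4 * E ^ 3 * F)"
        if b: "\<forall>k. norm (b k) \<le> 1" for b
      proof -
        let ?f = "\<lambda>m. norm (\<Sum>k\<in>{1..K}. b k * W (k * m))"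
        have "(\<Sum>w\<in>A j. ?f (N w)) = (\<Sum>m\<in>{M..<2 * M}. \<Sum>w\<in>{w \<in> A j. N w = m}. ?f (N w))"
          using range fin by (intro sum.group[symmetric]) (auto simp: A_def)
        also have "\<dots> = (\<Sum>m\<in>{M..<2 * M}. real (card {w \<in> A j. N w = m}) * ?f m)"
          by (intro sum.cong refl) simp
        also have "\<dots> \<le> (\<Sum>m\<in>{M..<2 * M}. D * ?f m)"
        proof (intro sum_mono mult_right_mono)
          fix m
          have "card {w \<in> A j. N w = m} \<le> card {w \<in> \<Omega>. N w = m}"
            using fin by (intro card_mono) (auto simp: A_def)
          then show "real (card {w \<in> A j. N w = m}) \<le> D"
            using D[of m] by linarith
        qed auto
        also have "\<dots> = D * (\<Sum>m\<in>{M..<2 * M}. ?f m)" by (simp add: sum_distrib_left)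
        also have "\<dots> \<le> D * (4 * E ^ 3 * F)"
        proof (intro mult_left_mono D0 typeII_dyadic M0 M3 b)
          show "real K \<le> u\<^sup>2" using le_K0_iff[of K] by (simp add: K_def)
          have "K * M \<le> X div M * M" by (intro mult_le_mono1) (simp add: K_def)
          then show "K * M \<le> X" using div_times_less_eq_dividend order.trans by blast
        qed
        finally show ?thesis .
      qed
      have "sum G (A j) = (\<Sum>w\<in>A j. norm (\<Sum>k\<in>{1..K}. (of_bool (k * N w \<le> X) * g w k) * W (k * N w)))"
        unfolding G_def
      proof (rule sum.cong[OF refl], rule arg_cong[of _ _ norm], rule sum.mono_neutral_right, goal_cases)
        case (3 w)
        show ?case
        proof
          fix k assume k: "k \<in> {1..K0} - {1..K}"
          note w = 3
          have "\<not> k * N w \<le> X"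
          proof
            assume "k * N w \<le> X"
            moreover have "k * M \<le> k * N w" using range[OF w] by simp
            ultimately have "k * M \<le> X" by linarith
            then have "k \<le> X div M" using M0 by (simp add: less_eq_div_iff_mult_less_eq)
            then show False using k by (auto simp: K_def)
          qed
          then show "of_bool (k * N w \<le> X) * g w k * W (k * N w) = 0" by simp
        qed
      qed (auto simp: K_def)
      also have "\<dots> \<le> (1 + 2 * harm (card {1..K} + 2)) ^ Suc n * (D * (4 * E ^ 3 * F))"
      proof (rule coupled_bound)
        have "coupled (A j) {1..K} n g"
          by (rule coupled_subset[OF g]) (auto simp: A_def K_def)
        then show "coupled (A j) {1..K} (Suc n) (\<lambda>w k. of_bool (k * N w \<le> X) * g w k)"
          by (rule coupled.couple) (use coupling_mult_le[of "A j" "{1..K}" N "real X"] in \<open>simp only: of_nat_le_iff\<close>)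
      qed (use base fin in \<open>auto simp: A_def\<close>)
      also have "\<dots> \<le> E ^ Suc n * (D * (4 * E ^ 3 * F))"
      proof (intro mult_right_mono power_mono)
        have "card {1..K} + 2 \<le> X\<^sup>2" using K0X by (simp add: K_def)
        then show "1 + 2 * harm (card {1..K} + 2) \<le> E" by (rule harm_bound)
      qed (use D0 E_pos F_bounds(4) in \<open>auto intro!: add_nonneg_nonneg harm_nonneg\<close>)
      finally show ?thesis
        by (simp add: power_add eval_nat_numeral mult_ac)
    qed
  qed
  also have "\<dots> = real J * (4 * D * E ^ (n + 4) * F)" by simp
  also have "\<dots> \<le> E * (4 * D * E ^ (n + 4) * F)"
    using J(2) E_pos F_bounds(4) D0 by (intro mult_right_mono) auto
  also have "\<dots> = 4 * D * E ^ (n + 5) * F"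
    by (simp add: power_add eval_nat_numeral)
  finally show ?thesis
    unfolding G_def .
qed

end

section \<open>Decomposition of the sifted set\<close>

text \<open>Incomparable fibres would yield primes with p < q \<le> p' < q' \<le> p. On top of the
  order condition of \<open>top_split\<close>, the strict relation expresses coprimality.\<close>

lemma coupling_primes_less:
  fixes \<pi> :: "'w \<Rightarrow> nat"
  shows "coupling \<Omega> K (\<lambda>w k::nat. \<forall>p q. prime p \<and> p dvd \<pi> w \<and> prime q \<and> q dvd k \<longrightarrow> p < q)"
  unfolding coupling_def
proof (intro ballI, rule ccontr)
  let ?R = "\<lambda>w k. \<forall>p q. prime p \<and> p dvd \<pi> w \<and> prime q \<and> q dvd k \<longrightarrow> p < q"
  fix w w'
  assume "\<not> ({k\<in>K. ?R w k} \<subseteq> {k\<in>K. ?R w' k} \<or> {k\<in>K. ?R w' k} \<subseteq> {k\<in>K. ?R w k})"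
  then obtain k k' where k: "?R w k" "\<not> ?R w' k" and k': "?R w' k'" "\<not> ?R w k'"
    by blast
  obtain p' q where 1: "prime p'" "p' dvd \<pi> w'" "prime q" "q dvd k" "\<not> p' < q"
    using k(2) by blast
  obtain p q' where 2: "prime p" "p dvd \<pi> w" "prime q'" "q' dvd k'" "\<not> p < q'"
    using k'(2) by blast
  have "p < q" using k(1) 1 2 by blast
  moreover have "p' < q'" using k'(1) 1 2 by blast
  ultimately show False using 1 2 by linarith
qed

lemma coupling_primes_le:
  fixes \<pi> :: "'w \<Rightarrow> nat"
  shows "coupling \<Omega> K (\<lambda>w k::nat. \<forall>p q. prime p \<and> p dvd \<pi> w \<and> prime q \<and> q dvd k \<longrightarrow> p \<le> q)"
  unfolding coupling_def
proof (intro ballI, rule ccontr)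
  let ?R = "\<lambda>w k. \<forall>p q. prime p \<and> p dvd \<pi> w \<and> prime q \<and> q dvd k \<longrightarrow> p \<le> q"
  fix w w'
  assume "\<not> ({k\<in>K. ?R w k} \<subseteq> {k\<in>K. ?R w' k} \<or> {k\<in>K. ?R w' k} \<subseteq> {k\<in>K. ?R w k})"
  then obtain k k' where k: "?R w k" "\<not> ?R w' k" and k': "?R w' k'" "\<not> ?R w k'"
    by blast
  obtain p' q where 1: "prime p'" "p' dvd \<pi> w'" "prime q" "q dvd k" "\<not> p' \<le> q"
    using k(2) by blast
  obtain p q' where 2: "prime p" "p dvd \<pi> w" "prime q'" "q' dvd k'" "\<not> p \<le> q'"
    using k'(2) by blast
  have "p \<le> q" using k(1) 1 2 by blast
  moreover have "p' \<le> q'" using k'(1) 1 2 by blast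
  ultimately show False using 1 2 by linarith
qed

context expsum
begin

definition smooth :: "nat \<Rightarrow> bool" where
  "smooth n \<longleftrightarrow> (\<forall>p. prime p \<and> p dvd n \<longrightarrow> real p \<le> u\<^sup>2)"

lemma smooth_mult: "smooth (a * b) \<longleftrightarrow> smooth a \<and> smooth b"
  by (auto simp: smooth_def prime_dvd_mult_iff)

text \<open>Membership in the sifted set without the size condition. It can be tested on the factors
  of a product separately, so it never couples variables.\<close>

definition good :: "real \<Rightarrow> real \<Rightarrow> nat \<Rightarrow> bool" where
  "good y z n \<longleftrightarrow> 0 < n \<and> (\<forall>p. prime p \<and> p dvd n \<longrightarrow> y \<le> real p \<and> real p \<le> z)"

lemma good_mult: "good y z (a * b) \<longleftrightarrow> good y z a \<and> good y z b"
  by (auto simp: good_def prime_dvd_mult_iff)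

lemma good_prime: "prime p \<Longrightarrow> good y z p \<longleftrightarrow> y \<le> real p \<and> real p \<le> z"
  by (auto simp: good_def prime_gt_0_nat dest: primes_dvd_imp_eq)

lemma large_primes_mult_greater: "u\<^sup>2 < real p \<Longrightarrow> u\<^sup>2 < real q \<Longrightarrow> X < p * q"
proof -
  assume "u\<^sup>2 < real p" "u\<^sup>2 < real q"
  then have "u\<^sup>2 * u\<^sup>2 < real p * real q"
    by (intro mult_strict_mono') auto
  moreover have "u\<^sup>2 * u\<^sup>2 = real X"
    by (simp flip: u4 power_add)
  ultimately have "real X < real (p * q)" by simp
  then show ?thesis by (simp only: of_nat_less_iff)
qed

lemma large_prime_unique:
  assumes "0 < n" "n \<le> X" "prime p" "prime q" "p dvd n" "q dvd n" "u\<^sup>2 < real p" "u\<^sup>2 < real q"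
  shows "p = q"
proof (rule ccontr)
  assume "p \<noteq> q"
  then have "p * q dvd n"
    using assms by (intro divides_mult) (auto simp: primes_coprime)
  then have "p * q \<le> X"
    using assms(1,2) dvd_imp_le[of "p * q" n] by linarith
  then show False
    using large_primes_mult_greater[of p q] assms by linarith
qed

lemma cofactor_le:
  assumes "k * m \<le> X" "u ^ i \<le> real m" "i \<le> 4"
  shows "real k \<le> u ^ (4 - i)"
proof -
  have "real k * u ^ i \<le> real k * real m"
    using assms by (intro mult_left_mono) auto
  also have "\<dots> = real (k * m)" by simp
  also have "\<dots> \<le> real X" using assms(1) by (simp only: of_nat_le_iff)
  also have "\<dots> = u ^ (4 - i) * u ^ i"
    using assms(3) by (simp flip: u4 power_add)
  finally show ?thesis
    using u_pos by simp
qed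

lemma cofactor_less:
  assumes "k * m \<le> X" "u ^ i < real m" "i \<le> 4"
  shows "real k < u ^ (4 - i)"
proof (cases "k = 0")
  case True
  then show ?thesis using u_pos by simp
next
  case False
  then have "real k * u ^ i < real k * real m"
    using assms by (intro mult_strict_left_mono) auto
  also have "\<dots> = real (k * m)" by simp
  also have "\<dots> \<le> real X" using assms(1) by (simp only: of_nat_le_iff)
  also have "\<dots> = u ^ (4 - i) * u ^ i"
    using assms(3) by (simp flip: u4 power_add)
  finally show ?thesis
    using u_pos by simp
qed

text \<open>A product of two primes above u^2 exceeds X, so the prime p is determined by n, and its
  cofactor is below u^2. Apart from k p \<le> X, all conditions concern p or k alone, so no coupling
  is left for the weight.\<close>

lemma sum_medium_prime:
  "norm (\<Sum>n | good y z n \<and> n \<le> X \<and> (\<exists>p. prime p \<and> p dvd n \<and> u\<^sup>2 < real p \<and> real p \<le> u ^ 3). W n) \<le> 4 * E ^ 5 * F"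
proof -
  define A where "A = {n. good y z n \<and> n \<le> X \<and> (\<exists>p. prime p \<and> p dvd n \<and> u\<^sup>2 < real p \<and> real p \<le> u ^ 3)}"
  define \<Omega> where "\<Omega> = {p. prime p \<and> u\<^sup>2 < real p \<and> real p \<le> u ^ 3 \<and> good y z p}"
  define g :: "nat \<Rightarrow> nat \<Rightarrow> complex" where "g p k = 1 * of_bool (good y z k)" for p k
  define T where "T = {q \<in> \<Omega> \<times> {1..K0}. snd q * fst q \<le> X \<and> good y z (snd q)}"
  have "p \<le> X" if "p \<in> \<Omega>" for p
  proof -
    have "real p \<le> real X" using that u_powers_le(2) by (simp add: \<Omega>_def)
    then show ?thesis by simp
  qed
  then have "\<Omega> \<subseteq> {..X}" by auto
  then have fin\<Omega>: "finite \<Omega>"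
    by (rule finite_subset) simp
  have "bij_betw (\<lambda>q. snd q * fst q) T A"
    unfolding bij_betw_def
  proof
    show "inj_on (\<lambda>q. snd q * fst q) T"
    proof (rule inj_onI)
      fix q q' assume q: "q \<in> T" "q' \<in> T" "snd q * fst q = snd q' * fst q'"
      have "fst q = fst q'"
      proof (rule large_prime_unique)
        show "0 < snd q * fst q" "snd q * fst q \<le> X"
          using q(1) by (auto simp: T_def \<Omega>_def good_def)
        show "fst q dvd snd q * fst q" by simp
        show "fst q' dvd snd q * fst q" unfolding q(3) by simp
      qed (use q in \<open>auto simp: T_def \<Omega>_def\<close>)
      then show "q = q'"
        using q by (auto simp: T_def \<Omega>_def prod_eq_iff)
    qed
    show "(\<lambda>q. snd q * fst q) ` T = A"
    proof (intro equalityI subsetI)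
      fix n assume "n \<in> (\<lambda>q. snd q * fst q) ` T"
      then show "n \<in> A"
        by (auto simp: T_def \<Omega>_def A_def good_mult)
    next
      fix n assume n: "n \<in> A"
      then obtain p where p: "prime p" "p dvd n" "u\<^sup>2 < real p" "real p \<le> u ^ 3"
        by (auto simp: A_def)
      then obtain k where k: "n = k * p" by (metis dvd_def mult.commute)
      have gk: "good y z k" "good y z p" "k * p \<le> X"
        using n k by (auto simp: A_def good_mult)
      have "real k < u ^ (4 - 2)"
        using gk p by (intro cofactor_less[of k p]) auto
      then have "k \<in> {1..K0}"
        using gk le_K0_iff[of k] by (auto simp: good_def Suc_le_eq)
      then have "(p, k) \<in> T"
        using p gk by (auto simp: T_def \<Omega>_def)
      then show "n \<in> (\<lambda>q. snd q * fst q) ` T"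
        by (rule image_eqI[rotated]) (simp add: k)
    qed
  qed
  then have "sum W A = (\<Sum>q\<in>T. W (snd q * fst q))"
    by (rule sum.reindex_bij_betw[symmetric])
  also have "\<dots> = (\<Sum>q\<in>\<Omega> \<times> {1..K0}. of_bool (snd q * fst q \<le> X) * g (fst q) (snd q) * W (snd q * fst q))"
    unfolding T_def using fin\<Omega> by (intro sum.mono_neutral_cong_left) (auto simp: g_def)
  also have "\<dots> = (\<Sum>p\<in>\<Omega>. \<Sum>k\<in>{1..K0}. of_bool (k * p \<le> X) * g p k * W (k * p))"
    by (simp add: sum.cartesian_product case_prod_beta)
  finally have "norm (sum W A) \<le> (\<Sum>p\<in>\<Omega>. norm (\<Sum>k\<in>{1..K0}. of_bool (k * p \<le> X) * g p k * W (k * p)))"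
    by (simp only: norm_sum)
  also have "\<dots> \<le> 4 * 1 * E ^ (0 + 5) * F"
  proof (rule typeII[where N = "\<lambda>p. p" and g = g and D = 1 and n = 0, OF fin\<Omega>])
    show "0 < p \<and> real p \<le> u ^ 3" if "p \<in> \<Omega>" for p
      using that by (auto simp: \<Omega>_def prime_gt_0_nat)
    show "real (card {w \<in> \<Omega>. w = m}) \<le> 1" for m
      using card_mono[of "{m}" "{w \<in> \<Omega>. w = m}"] by auto
    show "coupled \<Omega> {1..K0} 0 g"
      unfolding g_def by (rule coupled.product) auto
  qed
  finally show ?thesis by (simp add: A_def)
qed

text \<open>In n = k m with \<open>top_split\<close>, k lies in [u, u^2] and hence m \<le> u^3. The
  order condition between the primes of m and k is the single coupling; the other conditions of
  \<open>top_split\<close> concern k alone and are collected in \<open>b\<close>.\<close>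

lemma sum_smooth:
  "norm (\<Sum>n | good y z n \<and> n \<le> X \<and> smooth n \<and> u \<le> real n. W n) \<le> 4 * E ^ 6 * F"
proof -
  define A where "A = {n. good y z n \<and> n \<le> X \<and> smooth n \<and> u \<le> real n}"
  define \<Omega> where "\<Omega> = {m::nat. 0 < m \<and> real m \<le> u ^ 3}"
  define R where "R m k \<longleftrightarrow> (\<forall>p q. prime p \<and> p dvd m \<and> prime q \<and> q dvd k \<longrightarrow> p \<le> q)" for m k :: nat
  define b where "b k \<longleftrightarrow> good y z k \<and> smooth k \<and> u \<le> real k \<and> (\<forall>q. prime q \<and> q dvd k \<longrightarrow> real k < u * real q)" for k
  define g :: "nat \<Rightarrow> nat \<Rightarrow> complex" where
    "g m k = of_bool (R m k) * (of_bool (good y z m \<and> smooth m) * of_bool (b k))" for m k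
  have "m \<le> X" if "m \<in> \<Omega>" for m
  proof -
    have "real m \<le> real X" using that u_powers_le(2) by (simp add: \<Omega>_def)
    then show ?thesis by simp
  qed
  then have "\<Omega> \<subseteq> {..X}" by auto
  then have fin\<Omega>: "finite \<Omega>"
    by (rule finite_subset) simp
  have mem: "top_split u k m \<and> k * m \<in> A \<longleftrightarrow>
      m \<in> \<Omega> \<and> k \<in> {1..K0} \<and> k * m \<le> X \<and> R m k \<and> good y z m \<and> smooth m \<and> b k" for k m
  proof
    assume *: "top_split u k m \<and> k * m \<in> A"
    then have 1: "good y z k" "good y z m" "smooth k" "smooth m" "k * m \<le> X"
      by (auto simp: A_def good_mult smooth_mult)
    have "u \<le> real k" "0 < m" using * by (auto simp: top_split_def)
    have "real m \<le> u ^ (4 - 1)"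
      using 1 \<open>u \<le> real k\<close> by (intro cofactor_le[of m k]) (auto simp: mult.commute)
    moreover have "real k \<le> u\<^sup>2"
      using top_split_le[of u k m] * u2 1(3) by (auto simp: smooth_def)
    ultimately show "m \<in> \<Omega> \<and> k \<in> {1..K0} \<and> k * m \<le> X \<and> R m k \<and> good y z m \<and> smooth m \<and> b k"
      using * 1 le_K0_iff[of k] by (auto simp: \<Omega>_def R_def b_def top_split_def Suc_le_eq)
  next
    assume *: "m \<in> \<Omega> \<and> k \<in> {1..K0} \<and> k * m \<le> X \<and> R m k \<and> good y z m \<and> smooth m \<and> b k"
    have "u \<le> real k * 1"
      using * by (simp add: b_def)
    also have "\<dots> \<le> real k * real m"
      using * by (intro mult_left_mono) (auto simp: \<Omega>_def)
    finally have "u \<le> real (k * m)" by simp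
    then show "top_split u k m \<and> k * m \<in> A"
      using * by (auto simp: A_def good_mult smooth_mult b_def R_def top_split_def \<Omega>_def)
  qed
  define T where "T = {q \<in> \<Omega> \<times> {1..K0}. snd q * fst q \<le> X \<and> R (fst q) (snd q) \<and>
     good y z (fst q) \<and> smooth (fst q) \<and> b (snd q)}"
  have "sum W A = (\<Sum>(k, m)\<in>{(k, m). top_split u k m \<and> k * m \<in> A}. W (k * m))"
  proof (rule sum_top_split)
    show "finite A" by (rule finite_subset[of _ "{..X}"]) (auto simp: A_def)
  qed (auto simp: A_def good_def)
  also have "\<dots> = (\<Sum>q\<in>T. W (snd q * fst q))"
    unfolding mem by (rule sum.reindex_bij_witness[of _ prod.swap prod.swap]) (auto simp: T_def)
  also have "\<dots> = (\<Sum>q\<in>\<Omega> \<times> {1..K0}. of_bool (snd q * fst q \<le> X) * g (fst q) (snd q) * W (snd q * fst q))"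
    unfolding T_def using fin\<Omega> by (intro sum.mono_neutral_cong_left) (auto simp: g_def)
  also have "\<dots> = (\<Sum>m\<in>\<Omega>. \<Sum>k\<in>{1..K0}. of_bool (k * m \<le> X) * g m k * W (k * m))"
    by (simp add: sum.cartesian_product case_prod_beta)
  finally have "norm (sum W A) \<le> (\<Sum>m\<in>\<Omega>. norm (\<Sum>k\<in>{1..K0}. of_bool (k * m \<le> X) * g m k * W (k * m)))"
    by (simp only: norm_sum)
  also have "\<dots> \<le> 4 * 1 * E ^ (Suc 0 + 5) * F"
  proof (rule typeII[where N = "\<lambda>m. m" and g = g and D = 1 and n = "Suc 0", OF fin\<Omega>])
    show "0 < m \<and> real m \<le> u ^ 3" if "m \<in> \<Omega>" for m
      using that by (auto simp: \<Omega>_def)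
    show "real (card {w \<in> \<Omega>. w = m}) \<le> 1" for m
      using card_mono[of "{m}" "{w \<in> \<Omega>. w = m}"] by auto
    show "coupled \<Omega> {1..K0} (Suc 0) g"
      unfolding g_def
    proof (rule coupled.couple)
      show "coupling \<Omega> {1..K0} R"
        unfolding R_def by (rule coupling_primes_le)
    qed (rule coupled.product; auto)
  qed
  finally show ?thesis by (simp add: A_def)
qed

text \<open>Below u there is no divisor of size u to split off, but at most u integers, so the
  trivial bound for \<open>W\<close> suffices.\<close>

lemma sum_short:
  "norm (\<Sum>n | good y z n \<and> n \<le> X \<and> smooth n \<and> real n < u. W n) \<le> u * E"
proof -
  let ?A = "{n. good y z n \<and> n \<le> X \<and> smooth n \<and> real n < u}"
  have sub: "?A \<subseteq> {1..nat \<lfloor>u\<rfloor>}"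
    by (auto simp: good_def le_nat_iff le_floor_iff)
  then have "card ?A \<le> nat \<lfloor>u\<rfloor>"
    using card_mono[OF _ sub] by simp
  then have c: "real (card ?A) \<le> u"
    using u_pos by linarith
  have "norm (sum W ?A) \<le> (\<Sum>n\<in>?A. E)"
    by (rule order.trans[OF norm_sum sum_mono]) (rule norm_W_le)
  also have "\<dots> = real (card ?A) * E" by simp
  also have "\<dots> \<le> u * E"
    using c E_pos by (intro mult_right_mono) auto
  finally show ?thesis .
qed

end

section \<open>Integers with a prime factor above \<open>u ^ 3\<close>\<close>

context expsum
begin

text \<open>As v \<le> X = (u^2)^2, a composite v has a prime factor at most u^2, so sieving up to
  u^2 detects primality exactly. The bound v > u^3 ensures that a prime v is not itself sifted
  out.\<close>

lemma prime_iff_sum_mu: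
  assumes "u ^ 3 < real v" "v \<le> X"
  shows "of_bool (prime v) = (\<Sum>d | d dvd v \<and> smooth d. mu d)"
proof -
  have v: "1 < v"
    using assms(1) one_le_power[of u 3] u2 by linarith
  have "prime v \<longleftrightarrow> (\<forall>p. prime p \<and> p dvd v \<longrightarrow> u\<^sup>2 < real p)"
  proof
    assume "prime v"
    show "\<forall>p. prime p \<and> p dvd v \<longrightarrow> u\<^sup>2 < real p"
    proof (intro allI impI)
      fix p assume "prime p \<and> p dvd v"
      then have "p = v" using \<open>prime v\<close> primes_dvd_imp_eq by blast
      then show "u\<^sup>2 < real p" using assms(1) u_powers_le(5) by linarith
    qed
  next
    assume *: "\<forall>p. prime p \<and> p dvd v \<longrightarrow> u\<^sup>2 < real p"
    obtain p where p: "prime p" "p dvd v"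
      using prime_factor_nat[of v] v by auto
    then obtain w where w: "v = p * w" by blast
    have "w = 1"
    proof (rule ccontr)
      assume "w \<noteq> 1"
      then obtain q where q: "prime q" "q dvd w"
        using prime_factor_nat by blast
      then have "q dvd v" using w by simp
      then have "X < p * q"
        using * p q by (intro large_primes_mult_greater) auto
      moreover have "p * q \<le> p * w"
        using q(2) v w by (intro mult_le_mono2 dvd_imp_le) (auto intro!: Nat.gr0I)
      ultimately show False
        using assms(2) w by linarith
    qed
    then show "prime v" using p w by simp
  qed
  then show ?thesis
    using sum_mu_smooth_divisors[of v "u\<^sup>2"] v by (simp add: smooth_def)
qed

lemma norm_sum_W_interval:
  fixes m a b :: nat
  assumes m: "0 < m" and b: "real (b - a) \<le> real X / real m"
  shows "norm (\<Sum>e\<in>{a..<b}. W (m * e)) \<le> (\<Sum>h\<in>Hs. norm (cf h) * phi (real X / real m) (\<alpha> * of_int (h * int m)))"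
proof -
  have "(\<Sum>e\<in>{a..<b}. W (m * e)) = (\<Sum>h\<in>Hs. cf h * (\<Sum>e\<in>{a..<b}. ee (real e * (\<alpha> * of_int (h * int m)))))"
    unfolding W_def by (subst sum.swap) (simp add: sum_distrib_left mult_ac)
  also have "norm \<dots> \<le> (\<Sum>h\<in>Hs. norm (cf h * (\<Sum>e\<in>{a..<b}. ee (real e * (\<alpha> * of_int (h * int m))))))"
    by (rule norm_sum)
  also have "\<dots> \<le> (\<Sum>h\<in>Hs. norm (cf h) * phi (real X / real m) (\<alpha> * of_int (h * int m)))"
    unfolding norm_mult
  proof (intro sum_mono mult_left_mono)
    fix h
    have "norm (\<Sum>e\<in>{a..<b}. ee (real e * (\<alpha> * of_int (h * int m)))) \<le> phi (real (b - a)) (\<alpha> * of_int (h * int m))"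
      by (rule norm_geometric_ee)
    also have "\<dots> \<le> phi (real X / real m) (\<alpha> * of_int (h * int m))"
      by (rule phi_mono) (use b in auto)
    finally show "norm (\<Sum>e\<in>{a..<b}. ee (real e * (\<alpha> * of_int (h * int m)))) \<le> phi (real X / real m) (\<alpha> * of_int (h * int m))" .
  qed simp
  finally show ?thesis .
qed

lemma mult_le_imp_le: "a * b \<le> X \<Longrightarrow> 0 < b \<Longrightarrow> a \<le> X" for a b :: nat
  by (cases b) auto

context
  fixes y z :: real
  assumes y: "2 \<le> y" "y < u\<^sup>2" and z: "y < z"
begin

definition G :: "nat set" where
  "G = {m. good y z m \<and> real m < u}"

text \<open>Here n = m v, where v = d e stands for the large prime and d is the sieving divisor. Of
  the range for primes only v \<le> z is recorded, because v > u^3 already exceeds y.\<close>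

definition Q :: "(nat \<times> nat \<times> nat) set" where
  "Q = {(m, d, e). m \<in> G \<and> 0 < d \<and> 0 < e \<and> smooth d \<and> u ^ 3 < real (d * e) \<and> real (d * e) \<le> z \<and> m * (d * e) \<le> X}"

lemma G_pos: "m \<in> G \<Longrightarrow> 0 < m"
  by (auto simp: G_def good_def)

lemma finite_Q: "finite Q"
proof (rule finite_subset)
  show "Q \<subseteq> {..X} \<times> {..X} \<times> {..X}"
  proof
    fix q assume "q \<in> Q"
    then obtain m d e where q: "q = (m, d, e)" "0 < m" "0 < d" "0 < e" "m * (d * e) \<le> X"
      by (auto simp: Q_def dest: G_pos)
    have "m \<le> X" using q mult_le_imp_le[of m "d * e"] by simp
    moreover have "d \<le> X" using q mult_le_imp_le[of d "m * e"] by (simp add: mult_ac)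
    moreover have "e \<le> X" using q mult_le_imp_le[of e "m * d"] by (simp add: mult_ac)
    ultimately show "q \<in> {..X} \<times> {..X} \<times> {..X}" using q by simp
  qed
qed simp

lemma sum_large_prime_eq:
  "(\<Sum>n | good y z n \<and> n \<le> X \<and> (\<exists>p. prime p \<and> p dvd n \<and> u ^ 3 < real p). W n) = (\<Sum>(m, d, e)\<in>Q. mu d * W (m * (d * e)))"
proof -
  define A where "A = {n. good y z n \<and> n \<le> X \<and> (\<exists>p. prime p \<and> p dvd n \<and> u ^ 3 < real p)}"
  define V where "V = {q. fst q \<in> G \<and> u ^ 3 < real (snd q) \<and> real (snd q) \<le> z \<and> fst q * snd q \<le> X}"
  have u32: "u\<^sup>2 < real p" if "u ^ 3 < real p" for p
    using that u_powers_le(5) by linarith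
  have Vpos: "0 < fst q" "0 < snd q" "snd q \<le> X" if "q \<in> V" for q
  proof -
    show 1: "0 < fst q" using that by (auto simp: V_def dest: G_pos)
    have "0 < u ^ 3" using u_pos by simp
    moreover have "u ^ 3 < real (snd q)" using that by (simp add: V_def)
    ultimately have "0 < real (snd q)" by linarith
    then show "0 < snd q" by simp
    show "snd q \<le> X"
      using that 1 mult_le_imp_le[of "snd q" "fst q"] by (auto simp: V_def mult.commute)
  qed
  have finV: "finite V"
  proof (rule finite_subset)
    show "V \<subseteq> {..X} \<times> {..X}"
    proof
      fix q assume q: "q \<in> V"
      then have "fst q \<le> X"
        using Vpos[OF q] mult_le_imp_le[of "fst q" "snd q"] by (auto simp: V_def)
      then show "q \<in> {..X} \<times> {..X}" using Vpos[OF q] by (simp add: mem_Times_iff)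
    qed
  qed simp
  have "bij_betw (\<lambda>q. fst q * snd q) {q \<in> V. prime (snd q)} A"
    unfolding bij_betw_def
  proof
    show "inj_on (\<lambda>q. fst q * snd q) {q \<in> V. prime (snd q)}"
    proof (rule inj_onI)
      fix q q' assume q: "q \<in> {q \<in> V. prime (snd q)}" "q' \<in> {q \<in> V. prime (snd q)}" "fst q * snd q = fst q' * snd q'"
      have "snd q = snd q'"
      proof (rule large_prime_unique)
        show "0 < fst q * snd q" using q(1) Vpos by auto
        show "fst q * snd q \<le> X" using q(1) by (simp add: V_def)
        show "snd q dvd fst q * snd q" by simp
        show "snd q' dvd fst q * snd q" unfolding q(3) by simp
        show "u\<^sup>2 < real (snd q)" "u\<^sup>2 < real (snd q')"
          using q by (auto simp: V_def intro: u32)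
      qed (use q in auto)
      then show "q = q'"
        using q Vpos[of q] by (auto simp: prod_eq_iff)
    qed
    show "(\<lambda>q. fst q * snd q) ` {q \<in> V. prime (snd q)} = A"
    proof (intro equalityI subsetI)
      fix n assume "n \<in> (\<lambda>q. fst q * snd q) ` {q \<in> V. prime (snd q)}"
      then obtain q where q: "q \<in> V" "prime (snd q)" "n = fst q * snd q" by blast
      \<comment> \<open>This is where y < X^(1/2) = u^2 enters: the large prime automatically
        respects the lower bound.\<close>
      have "y \<le> real (snd q)"
        using q(1) y u32[of "snd q"] by (auto simp: V_def)
      then have "good y z (snd q)"
        using q by (auto simp: good_prime V_def)
      moreover have "good y z (fst q)" "fst q * snd q \<le> X" "u ^ 3 < real (snd q)"
        using q by (auto simp: V_def G_def)
      ultimately show "n \<in> A"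
        unfolding A_def q(3) using q(2) by (auto simp: good_mult)
    next
      fix n assume n: "n \<in> A"
      then obtain p where p: "prime p" "p dvd n" "u ^ 3 < real p"
        by (auto simp: A_def)
      then obtain k where k: "n = k * p" by (metis dvd_def mult.commute)
      have gk: "good y z k" "good y z p" "k * p \<le> X"
        using n k by (auto simp: A_def good_mult)
      have "real k < u ^ (4 - 3)"
        using gk p by (intro cofactor_less[of k p]) auto
      then have "(k, p) \<in> {q \<in> V. prime (snd q)}"
        using gk p by (simp add: V_def G_def good_prime)
      then show "n \<in> (\<lambda>q. fst q * snd q) ` {q \<in> V. prime (snd q)}"
        by (rule image_eqI[rotated]) (simp add: k)
    qed
  qed
  then have "sum W A = (\<Sum>q\<in>{q \<in> V. prime (snd q)}. W (fst q * snd q))"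
    by (rule sum.reindex_bij_betw[symmetric])
  also have "\<dots> = (\<Sum>q\<in>V. of_bool (prime (snd q)) * W (fst q * snd q))"
    using finV by (intro sum.mono_neutral_cong_left) auto
  also have "\<dots> = (\<Sum>q\<in>V. \<Sum>d\<in>{d. d dvd snd q \<and> smooth d}. mu d * W (fst q * snd q))"
  proof (rule sum.cong[OF refl])
    fix q assume q: "q \<in> V"
    have "of_bool (prime (snd q)) = (\<Sum>d | d dvd snd q \<and> smooth d. mu d)"
      using q Vpos[OF q] by (intro prime_iff_sum_mu) (auto simp: V_def)
    then show "of_bool (prime (snd q)) * W (fst q * snd q) = (\<Sum>d\<in>{d. d dvd snd q \<and> smooth d}. mu d * W (fst q * snd q))"
      by (simp add: sum_distrib_right)
  qed
  also have "\<dots> = (\<Sum>(q, d)\<in>Sigma V (\<lambda>q. {d. d dvd snd q \<and> smooth d}). mu d * W (fst q * snd q))"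
    using finV Vpos by (intro sum.Sigma) auto
  also have "\<dots> = (\<Sum>(m, d, e)\<in>Q. mu d * W (m * (d * e)))"
  proof (rule sum.reindex_bij_witness[of _ "\<lambda>(m, d, e). ((m, d * e), d)" "\<lambda>(q, d). (fst q, d, snd q div d)"], goal_cases)
    case (1 a)
    then show ?case by auto
  next
    case (2 a)
    then obtain m v d where a: "a = ((m, v), d)" "(m, v) \<in> V" "d dvd v" "smooth d" by auto
    then obtain e where e: "v = d * e" by blast
    have "0 < v" using Vpos(2)[OF a(2)] by simp
    then show ?case using a e by (auto simp: Q_def V_def)
  next
    case (3 b)
    then show ?case by (auto simp: Q_def)
  next
    case (4 b)
    then show ?case by (auto simp: Q_def V_def)
  next
    case (5 a)
    then show ?case by auto
  qed
  finally show ?thesis by (simp add: A_def)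
qed

text \<open>All conditions on e are inequalities, so e runs over an interval and its sum is
  geometric with modulus m d. Each value of m d comes from at most \<open>E\<close> pairs, which
  turns the E^6 of \<open>typeI\<close> into E^7.\<close>

lemma sum_large_prime_typeI:
  "norm (\<Sum>(m, d, e)\<in>{(m, d, e)\<in>Q. real (m * d) \<le> u ^ 3}. mu d * W (m * (d * e))) \<le> 12 * E ^ 7 * F"
proof -
  define P where "P = {(m, d). m \<in> G \<and> 0 < d \<and> smooth d \<and> real (m * d) \<le> u ^ 3}"
  \<comment> \<open>The condition d e > u^3 is strict, so the range starts one past the integer
    part; the + 1 in \<open>hi\<close> belongs to an exclusive end.\<close>
  define lo where "lo d = nat \<lfloor>u ^ 3 / real d\<rfloor> + 1" for d
  define hi where "hi m d = min (nat \<lfloor>z / real d\<rfloor>) (X div (m * d)) + 1" for m d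
  define T where "T m = (\<Sum>h\<in>Hs. norm (cf h) * phi (real X / real m) (\<alpha> * of_int (h * int m)))" for m :: nat
  define C where "C = {m::nat. 0 < m \<and> real m \<le> u ^ 3}"
  have T0: "0 \<le> T m" for m
    unfolding T_def by (intro sum_nonneg mult_nonneg_nonneg phi_nonneg) auto
  have toX: "n \<le> X" if "real n \<le> u ^ 3" for n
  proof -
    have "real n \<le> real X" using that u_powers_le(2) by linarith
    then show ?thesis by simp
  qed
  have PC: "m * d \<in> C" "m \<le> X" "d \<le> X" if "(m, d) \<in> P" for m d
  proof -
    have md: "0 < m" "0 < d" "m * d \<le> X"
      using that toX[of "m * d"] by (auto simp: P_def dest: G_pos)
    then show "m \<le> X" "d \<le> X"
      using mult_le_imp_le[of m d] mult_le_imp_le[of d m] by (simp_all add: mult.commute)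
    show "m * d \<in> C" using that md by (simp add: P_def C_def)
  qed
  have finP: "finite P"
    by (rule finite_subset[of _ "{..X} \<times> {..X}"]) (use PC in auto)
  have finC: "finite C"
    by (rule finite_subset[of _ "{..X}"]) (use toX in \<open>auto simp: C_def\<close>)
  have e_range: "0 < e \<and> u ^ 3 < real (d * e) \<and> real (d * e) \<le> z \<and> m * (d * e) \<le> X \<longleftrightarrow> e \<in> {lo d..<hi m d}"
    if md: "0 < m" "0 < d" for m d e
  proof -
    have 1: "u ^ 3 < real (d * e) \<longleftrightarrow> lo d \<le> e"
    proof -
      have "u ^ 3 < real (d * e) \<longleftrightarrow> u ^ 3 / real d < real e"
        using md by (simp add: pos_divide_less_eq mult.commute)
      also have "\<dots> \<longleftrightarrow> \<lfloor>u ^ 3 / real d\<rfloor> < int e"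
        by (simp add: floor_less_iff)
      also have "\<dots> \<longleftrightarrow> lo d \<le> e"
      proof -
        have "0 \<le> \<lfloor>u ^ 3 / real d\<rfloor>" using u_pos by simp
        then show ?thesis unfolding lo_def by linarith
      qed
      finally show ?thesis .
    qed
    have 2: "real (d * e) \<le> z \<longleftrightarrow> e \<le> nat \<lfloor>z / real d\<rfloor>"
    proof -
      have "real (d * e) \<le> z \<longleftrightarrow> real e \<le> z / real d"
        using md by (simp add: pos_le_divide_eq mult.commute)
      also have "\<dots> \<longleftrightarrow> e \<le> nat \<lfloor>z / real d\<rfloor>"
      proof -
        have "0 \<le> \<lfloor>z / real d\<rfloor>" using y z by simp
        then show ?thesis by (simp add: le_nat_iff le_floor_iff)
      qed
      finally show ?thesis .
    qed
    have 3: "m * (d * e) \<le> X \<longleftrightarrow> e \<le> X div (m * d)"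
      using md by (simp add: less_eq_div_iff_mult_less_eq mult_ac)
    have 4: "0 < e" if "lo d \<le> e" using that by (simp add: lo_def)
    show ?thesis
      unfolding 1 2 3 hi_def using 4 by auto
  qed
  have len: "real (hi m d - lo d) \<le> real X / real (m * d)" if md: "0 < m" "0 < d" for m d
  proof -
    have "hi m d - lo d \<le> X div (m * d)"
      by (simp add: hi_def lo_def)
    then have "real (hi m d - lo d) \<le> real (X div (m * d))" by simp
    also have "\<dots> \<le> real X / real (m * d)" by (rule of_nat_div_le_of_nat)
    finally show ?thesis .
  qed
  have "(\<Sum>(m, d, e)\<in>{(m, d, e)\<in>Q. real (m * d) \<le> u ^ 3}. mu d * W (m * (d * e)))
     = (\<Sum>(q, e)\<in>Sigma P (\<lambda>q. {lo (snd q)..<hi (fst q) (snd q)}). mu (snd q) * W (fst q * snd q * e))"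
  proof (rule sum.reindex_bij_witness[of _ "\<lambda>(q, e). (fst q, snd q, e)" "\<lambda>(m, d, e). ((m, d), e)"], goal_cases)
    case (1 a)
    then show ?case by auto
  next
    case (2 a)
    then obtain m d e where a: "a = (m, d, e)" "(m, d, e) \<in> Q" "real (m * d) \<le> u ^ 3" by auto
    then have "0 < m" "0 < d" by (auto simp: Q_def dest: G_pos)
    then show ?case
      using a e_range[of m d e] by (auto simp: Q_def P_def)
  next
    case (3 b)
    then show ?case by auto
  next
    case (4 b)
    then obtain m d e where b: "b = ((m, d), e)" "(m, d) \<in> P" "e \<in> {lo d..<hi m d}" by auto
    then have "0 < m" "0 < d" by (auto simp: P_def dest: G_pos)
    then show ?case
      using b e_range[of m d e] by (auto simp: Q_def P_def)
  next
    case (5 a)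
    then show ?case by (auto simp: mult.assoc)
  qed
  also have "\<dots> = (\<Sum>q\<in>P. \<Sum>e\<in>{lo (snd q)..<hi (fst q) (snd q)}. mu (snd q) * W (fst q * snd q * e))"
    by (rule sum.Sigma[symmetric]) (auto simp: finP)
  finally have "norm (\<Sum>(m, d, e)\<in>{(m, d, e)\<in>Q. real (m * d) \<le> u ^ 3}. mu d * W (m * (d * e)))
     \<le> (\<Sum>q\<in>P. norm (\<Sum>e\<in>{lo (snd q)..<hi (fst q) (snd q)}. mu (snd q) * W (fst q * snd q * e)))"
    by (simp only: norm_sum)
  also have "\<dots> \<le> (\<Sum>q\<in>P. T (fst q * snd q))"
  proof (rule sum_mono)
    fix q assume q: "q \<in> P"
    then have q0: "0 < fst q" "0 < snd q" by (auto simp: P_def dest: G_pos)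
    have "norm (\<Sum>e\<in>{lo (snd q)..<hi (fst q) (snd q)}. mu (snd q) * W (fst q * snd q * e))
        = norm (mu (snd q)) * norm (\<Sum>e\<in>{lo (snd q)..<hi (fst q) (snd q)}. W (fst q * snd q * e))"
      by (simp flip: sum_distrib_left norm_mult)
    also have "\<dots> \<le> norm (\<Sum>e\<in>{lo (snd q)..<hi (fst q) (snd q)}. W (fst q * snd q * e))"
      using norm_mu_le by (intro mult_left_le_one_le) auto
    also have "\<dots> \<le> T (fst q * snd q)"
      unfolding T_def using q0 len by (intro norm_sum_W_interval) auto
    finally show "norm (\<Sum>e\<in>{lo (snd q)..<hi (fst q) (snd q)}. mu (snd q) * W (fst q * snd q * e)) \<le> T (fst q * snd q)" .
  qed
  also have "\<dots> = (\<Sum>m\<in>C. \<Sum>q\<in>{q \<in> P. fst q * snd q = m}. T (fst q * snd q))"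
    using finP finC PC by (intro sum.group[symmetric]) auto
  also have "\<dots> = (\<Sum>m\<in>C. real (card {q \<in> P. fst q * snd q = m}) * T m)"
    by (intro sum.cong refl) simp
  also have "\<dots> \<le> (\<Sum>m\<in>C. E * T m)"
  proof (intro sum_mono mult_right_mono T0)
    fix m assume m: "m \<in> C"
    have "card {q \<in> P. fst q * snd q = m} \<le> card {d. d dvd m}"
    proof (rule card_inj_on_le[of fst])
      show "inj_on fst {q \<in> P. fst q * snd q = m}"
        using m by (auto simp: inj_on_def C_def)
      show "finite {d. d dvd m}" using m by (intro finite_divisors_nat) (simp add: C_def)
    qed auto
    also have "real (card {d. d dvd m}) \<le> E"
    proof (rule divisors)
      have "m \<le> X" using m toX by (simp add: C_def)
      also have "X \<le> X\<^sup>2" by (simp add: power2_eq_square)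
      finally show "m \<le> X\<^sup>2" .
    qed (use m in \<open>simp add: C_def\<close>)
    finally show "real (card {q \<in> P. fst q * snd q = m}) \<le> E" by simp
  qed
  also have "\<dots> = E * sum T C" by (simp add: sum_distrib_left)
  also have "\<dots> \<le> E * (12 * E ^ 6 * F)"
    using typeI E_pos unfolding T_def C_def by (intro mult_left_mono) auto
  also have "\<dots> = 12 * E ^ 7 * F"
    by (simp add: eval_nat_numeral)
  finally show ?thesis .
qed

text \<open>The smooth divisor d is large enough to split as k d2 with k in [u, u^2]; the remaining
  variables form w = (m, d2, e) with m d2 e \<le> u^3. Four couplings remain: coprimality of k and
  d2, m d > u^3, v > u^3 and v \<le> z. A value of \<open>N w\<close> arises from at most E^2
  triples, since m and d2 are divisors of it; thus the exponent is 2 + 4 + 5 = 11.\<close>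

lemma sum_large_prime_typeII:
  "norm (\<Sum>(m, d, e)\<in>{(m, d, e)\<in>Q. \<not> real (m * d) \<le> u ^ 3}. mu d * W (m * (d * e))) \<le> 4 * E ^ 11 * F"
proof -
  define Q2 where "Q2 = {(m, d, e)\<in>Q. \<not> real (m * d) \<le> u ^ 3}"
  define N where "N w = fst w * (fst (snd w) * snd (snd w))" for w :: "nat \<times> nat \<times> nat"
  define \<Omega> where "\<Omega> = {w. fst w \<in> G \<and> 0 < fst (snd w) \<and> 0 < snd (snd w) \<and> smooth (fst (snd w)) \<and> real (N w) \<le> u ^ 3}"
  define R1 where "R1 w k \<longleftrightarrow> (\<forall>p q. prime p \<and> p dvd fst (snd w) \<and> prime q \<and> q dvd k \<longrightarrow> p < q)" for w :: "nat \<times> nat \<times> nat" and k :: nat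
  define R2 where "R2 w k \<longleftrightarrow> u ^ 3 < real (k * (fst w * fst (snd w)))" for w :: "nat \<times> nat \<times> nat" and k :: nat
  define R3 where "R3 w k \<longleftrightarrow> u ^ 3 < real (k * (fst (snd w) * snd (snd w)))" for w :: "nat \<times> nat \<times> nat" and k :: nat
  define R4 where "R4 w k \<longleftrightarrow> real (k * (fst (snd w) * snd (snd w))) \<le> z" for w :: "nat \<times> nat \<times> nat" and k :: nat
  define b where "b k \<longleftrightarrow> smooth k \<and> u \<le> real k \<and> (\<forall>q. prime q \<and> q dvd k \<longrightarrow> real k < u * real q)" for k
  define g where "g w k = of_bool (R4 w k) * (of_bool (R3 w k) * (of_bool (R2 w k) * (of_bool (R1 w k) *
      (mu (fst (snd w)) * (of_bool (b k) * mu k)))))" for w k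
  \<comment> \<open>\<open>T\<close> corresponds exactly to \<open>Q2\<close>, so it keeps the
    non-strict order condition of \<open>top_split\<close>, whereas \<open>g\<close> contains the
    strict one. Where the two differ, \<open>mu\<close> of the product vanishes.\<close>
  define T where "T = {q \<in> \<Omega> \<times> {1..K0}. snd q * N (fst q) \<le> X \<and> R4 (fst q) (snd q) \<and> R3 (fst q) (snd q) \<and>
      R2 (fst q) (snd q) \<and> b (snd q) \<and>
      (\<forall>p r. prime p \<and> p dvd fst (snd (fst q)) \<and> prime r \<and> r dvd snd q \<longrightarrow> p \<le> r)}"
  define f where "f q = (fst (fst q), snd q * fst (snd (fst q)), snd (snd (fst q)))" for q :: "(nat \<times> nat \<times> nat) \<times> nat"
  have toX: "n \<le> X" if "real n \<le> u ^ 3" for n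
  proof -
    have "real n \<le> real X" using that u_powers_le(2) by linarith
    then show ?thesis by simp
  qed
  have pos: "0 < fst w" "0 < fst (snd w)" "0 < snd (snd w)" "0 < N w" if "w \<in> \<Omega>" for w
    using that by (auto simp: \<Omega>_def N_def dest: G_pos)
  have fin\<Omega>: "finite \<Omega>"
  proof (rule finite_subset)
    show "\<Omega> \<subseteq> {..X} \<times> {..X} \<times> {..X}"
    proof
      fix w assume w: "w \<in> \<Omega>"
      obtain m d e where w': "w = (m, d, e)" by (cases w)
      have "m * (d * e) \<le> X" "0 < m" "0 < d" "0 < e"
        using w toX[of "N w"] pos[OF w] by (auto simp: \<Omega>_def N_def w')
      then show "w \<in> {..X} \<times> {..X} \<times> {..X}"
        using mult_le_imp_le[of m "d * e"] mult_le_imp_le[of d "m * e"] mult_le_imp_le[of e "m * d"]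
        by (simp add: w' mult_ac)
    qed
  qed simp
  have mem: "((m, d2, e), k) \<in> T \<longleftrightarrow> top_split u k d2 \<and> (m, k * d2, e) \<in> Q2" for m d2 e k
  proof
    assume "((m, d2, e), k) \<in> T"
    then have *: "m \<in> G" "0 < d2" "0 < e" "smooth d2" "1 \<le> k" "k * (m * (d2 * e)) \<le> X"
      "real (k * (d2 * e)) \<le> z" "u ^ 3 < real (k * (d2 * e))" "u ^ 3 < real (k * (m * d2))" "b k"
      "\<forall>p r. prime p \<and> p dvd d2 \<and> prime r \<and> r dvd k \<longrightarrow> p \<le> r"
      unfolding T_def \<Omega>_def N_def R2_def R3_def R4_def by auto
    have "top_split u k d2"
      using * by (simp add: top_split_def b_def)
    moreover have "(m, k * d2, e) \<in> Q2"
      using * unfolding Q2_def Q_def b_def by (simp add: smooth_mult mult_ac)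
    ultimately show "top_split u k d2 \<and> (m, k * d2, e) \<in> Q2" ..
  next
    assume "top_split u k d2 \<and> (m, k * d2, e) \<in> Q2"
    then have ts: "top_split u k d2" and *: "m \<in> G" "0 < k * d2" "0 < e" "smooth (k * d2)" "u ^ 3 < real (k * d2 * e)"
       "real (k * d2 * e) \<le> z" "m * (k * d2 * e) \<le> X" "u ^ 3 < real (m * (k * d2))"
      unfolding Q2_def Q_def by auto
    have k: "real k \<le> u\<^sup>2"
      using top_split_le[OF ts] u2 *(4) by (auto simp: smooth_def)
    have uk: "u \<le> real k" "0 < k" "0 < d2"
      using ts by (auto simp: top_split_def)
    have kN: "k * (m * (d2 * e)) \<le> X" using *(7) by (simp add: mult_ac)
    have "real (m * (d2 * e)) \<le> u ^ (4 - 1)"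
      using kN uk by (intro cofactor_le[of _ k]) (auto simp: mult.commute)
    then have N: "real (m * (d2 * e)) \<le> u ^ 3" by simp
    have "(m, d2, e) \<in> \<Omega>"
      unfolding \<Omega>_def N_def using * uk N by (simp add: smooth_mult)
    moreover have "k \<in> {1..K0}"
      using k uk by (simp add: le_K0_iff Suc_le_eq)
    moreover have "b k"
      unfolding b_def using * ts by (simp add: smooth_mult top_split_def)
    moreover have "R4 (m, d2, e) k" "R3 (m, d2, e) k" "R2 (m, d2, e) k"
      unfolding R4_def R3_def R2_def using * by (simp_all add: mult_ac)
    moreover have "\<forall>p r. prime p \<and> p dvd d2 \<and> prime r \<and> r dvd k \<longrightarrow> p \<le> r"
      using ts by (simp add: top_split_def)
    ultimately show "((m, d2, e), k) \<in> T"
      unfolding T_def using kN by (simp add: N_def)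
  qed
  have "bij_betw f T Q2"
    unfolding bij_betw_def
  proof
    show "inj_on f T"
    proof (rule inj_onI)
      fix q q' assume q: "q \<in> T" "q' \<in> T" "f q = f q'"
      obtain m d e k where q1: "q = ((m, d, e), k)" by (metis prod.exhaust)
      obtain m' d' e' k' where q2: "q' = ((m', d', e'), k')" by (metis prod.exhaust)
      have "k = k' \<and> d = d'"
        using q mem[of m d e k] mem[of m' d' e' k'] by (intro top_split_unique[of u]) (auto simp: f_def q1 q2)
      then show "q = q'" using q(3) by (simp add: f_def q1 q2)
    qed
    show "f ` T = Q2"
    proof (intro equalityI subsetI)
      fix x assume "x \<in> f ` T"
      then obtain q where q: "q \<in> T" "x = f q" by blast
      obtain m d e k where "q = ((m, d, e), k)" by (metis prod.exhaust)
      with q have "((m, d, e), k) \<in> T" "x = f ((m, d, e), k)" by simp_all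
      then show "x \<in> Q2" using mem[of m d e k] by (simp add: f_def)
    next
      fix x assume x: "x \<in> Q2"
      obtain m d e where x': "x = (m, d, e)" by (cases x)
      have "real m < u" "0 < m" "0 < d" "u ^ 3 < real (m * d)"
        using x by (auto simp: Q2_def Q_def G_def x' good_def)
      \<comment> \<open>From m d > u^3 and m < u it follows that d > u^2, so d can be split at
        u.\<close>
      have "u\<^sup>2 * u < real d * u"
      proof -
        have "u\<^sup>2 * u = u ^ 3" by (simp add: eval_nat_numeral)
        also have "\<dots> < real m * real d" using \<open>u ^ 3 < real (m * d)\<close> by simp
        also have "\<dots> \<le> u * real d" using \<open>real m < u\<close> by (intro mult_right_mono) auto
        finally show ?thesis by (simp add: mult.commute)
      qed
      then have "u\<^sup>2 < real d" using u_pos by simp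
      then have "u \<le> real d" using u_powers_le(4) by linarith
      then obtain k d2 where kd: "d = k * d2" "top_split u k d2"
        using top_split_exists[OF \<open>0 < d\<close>] by blast
      then have "((m, d2, e), k) \<in> T" using x mem[of m d2 e k] by (simp add: x')
      then show "x \<in> f ` T"
        by (rule image_eqI[rotated]) (simp add: f_def x' kd(1))
    qed
  qed
  then have "(\<Sum>x\<in>Q2. mu (fst (snd x)) * W (fst x * (fst (snd x) * snd (snd x))))
     = (\<Sum>q\<in>T. mu (fst (snd (f q))) * W (fst (f q) * (fst (snd (f q)) * snd (snd (f q)))))"
    by (rule sum.reindex_bij_betw[symmetric])
  also have "\<dots> = (\<Sum>q\<in>\<Omega> \<times> {1..K0}. of_bool (snd q * N (fst q) \<le> X) * g (fst q) (snd q) * W (snd q * N (fst q)))"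
  proof (rule sum.mono_neutral_cong_left)
    show "finite (\<Omega> \<times> {1..K0})" using fin\<Omega> by simp
    show "T \<subseteq> \<Omega> \<times> {1..K0}" by (auto simp: T_def)
    show "\<forall>q\<in>\<Omega> \<times> {1..K0} - T. of_bool (snd q * N (fst q) \<le> X) * g (fst q) (snd q) * W (snd q * N (fst q)) = 0"
    proof
      fix q assume q: "q \<in> \<Omega> \<times> {1..K0} - T"
      have "\<not> (snd q * N (fst q) \<le> X \<and> R4 (fst q) (snd q) \<and> R3 (fst q) (snd q) \<and> R2 (fst q) (snd q) \<and> b (snd q) \<and> R1 (fst q) (snd q))"
        using q unfolding T_def R1_def by (auto intro: less_imp_le)
      then show "of_bool (snd q * N (fst q) \<le> X) * g (fst q) (snd q) * W (snd q * N (fst q)) = 0"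
        unfolding g_def by auto
    qed
    fix q assume q: "q \<in> T"
    obtain m d e k where q': "q = ((m, d, e), k)" by (metis prod.exhaust)
    have T: "k * N (m, d, e) \<le> X" "R4 (m, d, e) k" "R3 (m, d, e) k" "R2 (m, d, e) k" "b k" "(m, d, e) \<in> \<Omega>" "0 < k"
      "\<And>p r. prime p \<Longrightarrow> p dvd d \<Longrightarrow> prime r \<Longrightarrow> r dvd k \<Longrightarrow> p \<le> r"
      using q unfolding T_def q' by auto
    have "m * (k * d * e) = k * N (m, d, e)" by (simp add: N_def)
    then have arg: "W (m * (k * d * e)) = W (k * N (m, d, e))" by (simp only:)
    \<comment> \<open>Given the non-strict order, a failure of strictness is a common prime and the
      product is not squarefree; strictness makes k and d coprime, and \<open>mu\<close>
      factors.\<close>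
    have "mu (k * d) = of_bool (R1 (m, d, e) k) * (mu d * mu k)"
    proof (cases "R1 (m, d, e) k")
      case True
      have "coprime k d"
      proof (rule ccontr)
        assume "\<not> coprime k d"
        then have "gcd k d \<noteq> 1" by (simp add: coprime_iff_gcd_eq_1)
        then obtain p where p: "prime p" "p dvd gcd k d"
          using prime_factor_nat by blast
        then have "p dvd k" "p dvd d" by simp_all
        moreover have "\<forall>p q. prime p \<and> p dvd d \<and> prime q \<and> q dvd k \<longrightarrow> p < q"
          using True by (simp add: R1_def)
        ultimately show False using p(1) by blast
      qed
      then show ?thesis
        using True T(7) pos(2)[OF T(6)] by (simp add: mu_mult_coprime)
    next
      case False
      then obtain p r where pr: "prime p" "p dvd d" "prime r" "r dvd k" "\<not> p < r"
        by (auto simp: R1_def)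
      then have "p = r" using T(8)[of p r] by simp
      then show ?thesis
        using mu_mult_common_prime[of p k d] pr False by simp
    qed
    then show "mu (fst (snd (f q))) * W (fst (f q) * (fst (snd (f q)) * snd (snd (f q)))) =
       of_bool (snd q * N (fst q) \<le> X) * g (fst q) (snd q) * W (snd q * N (fst q))"
      using T(1-5) arg by (simp add: f_def q' g_def)
  qed
  also have "\<dots> = (\<Sum>w\<in>\<Omega>. \<Sum>k\<in>{1..K0}. of_bool (k * N w \<le> X) * g w k * W (k * N w))"
    by (simp add: sum.cartesian_product case_prod_beta)
  finally have "norm (\<Sum>x\<in>Q2. mu (fst (snd x)) * W (fst x * (fst (snd x) * snd (snd x))))
     \<le> (\<Sum>w\<in>\<Omega>. norm (\<Sum>k\<in>{1..K0}. of_bool (k * N w \<le> X) * g w k * W (k * N w)))"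
    by (simp only: norm_sum)
  also have "\<dots> \<le> 4 * E\<^sup>2 * E ^ (Suc (Suc (Suc (Suc 0))) + 5) * F"
  proof (rule typeII[where N = N and g = g and D = "E\<^sup>2" and n = "Suc (Suc (Suc (Suc 0)))", OF fin\<Omega>])
    show "0 < N w \<and> real (N w) \<le> u ^ 3" if "w \<in> \<Omega>" for w
      using that pos[OF that] by (simp add: \<Omega>_def)
    show "real (card {w \<in> \<Omega>. N w = m}) \<le> E\<^sup>2" for m
    proof (cases "{w \<in> \<Omega>. N w = m} = {}")
      case True
      show ?thesis unfolding True by simp
    next
      case False
      then obtain w where w: "w \<in> \<Omega>" "N w = m" by blast
      have m: "0 < m" "m \<le> X"
        using pos(4)[OF w(1)] w toX[of m] by (auto simp: \<Omega>_def)
      define dv where "dv = {d. d dvd m}"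
      have fdv: "finite dv" unfolding dv_def using m(1) by (rule finite_divisors_nat)
      have "card {w \<in> \<Omega>. N w = m} \<le> card (dv \<times> dv)"
      proof (rule card_inj_on_le[of "\<lambda>w. (fst w, fst (snd w))"])
        show "inj_on (\<lambda>w. (fst w, fst (snd w))) {w \<in> \<Omega>. N w = m}"
        proof (rule inj_onI)
          fix w w' assume w: "w \<in> {w \<in> \<Omega>. N w = m}" "w' \<in> {w \<in> \<Omega>. N w = m}"
            "(fst w, fst (snd w)) = (fst w', fst (snd w'))"
          then have "fst w * fst (snd w) * snd (snd w) = fst w * fst (snd w) * snd (snd w')"
            by (simp add: N_def mult.assoc)
          moreover have "0 < fst w" "0 < fst (snd w)" using pos[of w] w by auto
          ultimately show "w = w'" using w(3) by (simp add: prod_eq_iff)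
        qed
        show "(\<lambda>w. (fst w, fst (snd w))) ` {w \<in> \<Omega>. N w = m} \<subseteq> dv \<times> dv"
          by (auto simp: dv_def N_def)
      qed (simp add: fdv)
      also have "\<dots> = card dv * card dv" by (rule card_cartesian_product)
      finally have "real (card {w \<in> \<Omega>. N w = m}) \<le> real (card dv * card dv)"
        by (simp only: of_nat_le_iff)
      also have "\<dots> = real (card dv) * real (card dv)" by simp
      also have "\<dots> \<le> E * E"
      proof -
        have "m \<le> X\<^sup>2"
          using m(2) le_square[of X] unfolding power2_eq_square by linarith
        then have "real (card dv) \<le> E"
          unfolding dv_def using m(1) by (intro divisors)
        then show ?thesis using E_pos by (intro mult_mono) auto
      qed
      finally show ?thesis by (simp add: power2_eq_square)
    qed
    show "coupled \<Omega> {1..K0} (Suc (Suc (Suc (Suc 0)))) g"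
      unfolding g_def
    proof (intro coupled.couple)
      show "coupled \<Omega> {1..K0} 0 (\<lambda>w k. mu (fst (snd w)) * (of_bool (b k) * mu k))"
        by (rule coupled.product) (auto simp: norm_mu_le norm_mult)
      show "coupling \<Omega> {1..K0} R1"
        unfolding R1_def by (rule coupling_primes_less)
      show "coupling \<Omega> {1..K0} R2"
        unfolding R2_def by (rule coupling_less_mult)
      show "coupling \<Omega> {1..K0} R3"
        unfolding R3_def by (rule coupling_less_mult)
      show "coupling \<Omega> {1..K0} R4"
        unfolding R4_def by (rule coupling_mult_le)
    qed
  qed
  also have "\<dots> = 4 * E ^ 11 * F"
    by (simp add: power_add eval_nat_numeral)
  finally show ?thesis
    unfolding Q2_def[symmetric] by (simp add: case_prod_beta)
qed

lemma sum_large_prime: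
  "norm (\<Sum>n | good y z n \<and> n \<le> X \<and> (\<exists>p. prime p \<and> p dvd n \<and> u ^ 3 < real p). W n) \<le> 12 * E ^ 7 * F + 4 * E ^ 11 * F"
proof -
  let ?f = "\<lambda>(m, d, e). mu d * W (m * (d * e))"
  let ?Q1 = "{(m, d, e)\<in>Q. real (m * d) \<le> u ^ 3}" and ?Q2 = "{(m, d, e)\<in>Q. \<not> real (m * d) \<le> u ^ 3}"
  have "Q = ?Q1 \<union> ?Q2" by auto
  then have "sum ?f Q = sum ?f (?Q1 \<union> ?Q2)" by (rule arg_cong)
  also have "\<dots> = sum ?f ?Q1 + sum ?f ?Q2"
  proof (rule sum.union_disjoint)
    show "finite ?Q1" "finite ?Q2"
      by (rule finite_subset[OF _ finite_Q]; auto)+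
  qed auto
  finally show ?thesis
    unfolding sum_large_prime_eq
    using norm_triangle_le[OF add_mono[OF sum_large_prime_typeI sum_large_prime_typeII]] by simp
qed

text \<open>An integer up to X has at most one prime factor above u^2, so the short smooth, long
  smooth, medium prime and large prime classes are disjoint. The constant is 1 + 4 + 4 + 12 +
  4.\<close>

lemma norm_sum_W_S_set: "norm (\<Sum>n\<in>S_set (real X) y z. W n) \<le> 25 * E ^ 11 * F"
proof -
  define A where "A P = {n. good y z n \<and> n \<le> X \<and> P n}" for P
  define P0 where "P0 n \<longleftrightarrow> smooth n \<and> real n < u" for n
  define P1 where "P1 n \<longleftrightarrow> (\<exists>p. prime p \<and> p dvd n \<and> u\<^sup>2 < real p \<and> real p \<le> u ^ 3)" for n
  define P2 where "P2 n \<longleftrightarrow> smooth n \<and> u \<le> real n" for n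
  define P3 where "P3 n \<longleftrightarrow> (\<exists>p. prime p \<and> p dvd n \<and> u ^ 3 < real p)" for n
  have fin: "finite (A P)" for P
    by (rule finite_subset[of _ "{..X}"]) (auto simp: A_def)
  have P13: "\<not> (P1 n \<and> P3 n)" if n: "good y z n" "n \<le> X" for n
  proof
    assume "P1 n \<and> P3 n"
    then obtain p q where pq: "prime p" "p dvd n" "u\<^sup>2 < real p" "real p \<le> u ^ 3" "prime q" "q dvd n" "u ^ 3 < real q"
      by (auto simp: P1_def P3_def)
    have "p = q"
      using n pq u_powers_le(5) by (intro large_prime_unique[of n]) (auto simp: good_def)
    then show False using pq by simp
  qed
  have not_smooth: "P1 n \<or> P3 n \<longleftrightarrow> \<not> smooth n" for n
  proof
    assume "P1 n \<or> P3 n"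
    then obtain p where p: "prime p" "p dvd n" "u\<^sup>2 < real p \<or> u ^ 3 < real p"
      unfolding P1_def P3_def by blast
    then have "\<not> real p \<le> u\<^sup>2" using u_powers_le(5) by linarith
    then show "\<not> smooth n" using p(1,2) unfolding smooth_def by blast
  next
    assume "\<not> smooth n"
    then obtain p where "prime p" "p dvd n" "u\<^sup>2 < real p"
      by (auto simp: smooth_def not_le)
    moreover have "real p \<le> u ^ 3 \<or> u ^ 3 < real p" by linarith
    ultimately show "P1 n \<or> P3 n"
      unfolding P1_def P3_def by blast
  qed
  have S: "S_set (real X) y z = (A P0 \<union> A P2) \<union> (A P1 \<union> A P3)"
  proof -
    have "n \<in> S_set (real X) y z \<longleftrightarrow> good y z n \<and> n \<le> X" for n
      by (auto simp: S_set_def good_def Suc_le_eq)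
    then show ?thesis
      using not_smooth by (auto simp: A_def P0_def P2_def)
  qed
  have "sum W (S_set (real X) y z) = sum W (A P0 \<union> A P2) + sum W (A P1 \<union> A P3)"
    unfolding S using fin not_smooth by (intro sum.union_disjoint) (auto simp: A_def P0_def P2_def)
  also have "sum W (A P0 \<union> A P2) = sum W (A P0) + sum W (A P2)"
    using fin by (intro sum.union_disjoint) (auto simp: A_def P0_def P2_def)
  also have "sum W (A P1 \<union> A P3) = sum W (A P1) + sum W (A P3)"
    using fin P13 by (intro sum.union_disjoint) (auto simp: A_def)
  finally have "norm (sum W (S_set (real X) y z)) \<le> (norm (sum W (A P0)) + norm (sum W (A P2))) + (norm (sum W (A P1)) + norm (sum W (A P3)))"
    by (simp only:) (intro norm_triangle_mono order_refl)
  also have "\<dots> \<le> (u * E + 4 * E ^ 6 * F) + (4 * E ^ 5 * F + (12 * E ^ 7 * F + 4 * E ^ 11 * F))"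
    using sum_short[of y z] sum_smooth[of y z] sum_medium_prime[of y z] sum_large_prime
    unfolding A_def P0_def P1_def P2_def P3_def by (intro add_mono) auto
  also have "\<dots> \<le> (1 * E ^ 11 * F + 4 * E ^ 11 * F) + (4 * E ^ 11 * F + (12 * E ^ 11 * F + 4 * E ^ 11 * F))"
  proof -
    have p: "E ^ i \<le> E ^ 11" if "i \<le> 11" for i
      using that E1 by (intro power_increasing) auto
    have "u * E \<le> F * E ^ 11"
      using F_bounds u_powers_le p[of 1] E_pos by (intro mult_mono) auto
    then show ?thesis
      using p[of 5] p[of 6] p[of 7] F_bounds(4) by (intro add_mono mult_right_mono mult_left_mono) (auto simp: mult.commute)
  qed
  also have "\<dots> = 25 * E ^ 11 * F" by algebra
  finally show ?thesis .
qed

end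

end

section \<open>Counting\<close>

context expsum
begin

text \<open>There are about E u^2 blocks, each costing at most 3 E^2 X. Divided by the kernel length
  X this is of order E^3 u^2, below \<open>F\<close> up to powers of \<open>E\<close>, so the
  approximation error may be summed over all n \<le> X.\<close>

lemma sum_phi_upto_X: "(\<Sum>n\<in>{1..X}. phi (real X) (\<alpha> * real n + \<theta>)) \<le> 6 * E ^ 3 * u\<^sup>2 * real X"
proof -
  define T where "T j = {n \<in> {1..X}. n div B = j}" for j
  define J where "J = X div B"
  have "(\<Sum>n\<in>{1..X}. phi (real X) (\<alpha> * real n + \<theta>)) = (\<Sum>j\<in>{0..J}. \<Sum>n\<in>T j. phi (real X) (\<alpha> * real n + \<theta>))"
    unfolding T_def J_def by (rule sum.group[symmetric]) (auto intro!: div_le_mono)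
  also have "\<dots> \<le> (\<Sum>j\<in>{0..J}. 3 * E\<^sup>2 * real X)"
  proof (rule sum_mono)
    fix j
    have "(\<Sum>n\<in>T j. phi (real X) (\<alpha> * real n + \<theta>)) \<le> (\<Sum>n\<in>{j * B..<j * B + B}. phi (real X) (\<alpha> * of_int (1 * int n) + \<theta>))"
    proof -
      have "T j \<subseteq> {j * B..<j * B + B}"
      proof
        fix n assume "n \<in> T j"
        then have "n = j * B + n mod B"
          using div_mult_mod_eq[of n B] by (simp add: T_def)
        then show "n \<in> {j * B..<j * B + B}"
          using mod_less_divisor[OF B_bounds(1), of n] by simp
      qed
      then have "(\<Sum>n\<in>T j. phi (real X) (\<alpha> * real n + \<theta>)) \<le> (\<Sum>n\<in>{j * B..<j * B + B}. phi (real X) (\<alpha> * real n + \<theta>))"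
        by (intro sum_mono2) (auto simp: phi_nonneg)
      then show ?thesis by simp
    qed
    also have "\<dots> \<le> 2 * real X + E\<^sup>2 * u\<^sup>2"
      by (rule sum_phi_shift_block) auto
    also have "\<dots> \<le> 2 * (E\<^sup>2 * real X) + E\<^sup>2 * real X"
    proof (rule add_mono)
      have "1 * real X \<le> E\<^sup>2 * real X"
        using one_le_power[OF E1, of 2] by (intro mult_right_mono) auto
      then show "2 * real X \<le> 2 * (E\<^sup>2 * real X)" by simp
      show "E\<^sup>2 * u\<^sup>2 \<le> E\<^sup>2 * real X"
        using u_powers_le(1) by (intro mult_left_mono) auto
    qed
    finally show "(\<Sum>n\<in>T j. phi (real X) (\<alpha> * real n + \<theta>)) \<le> 3 * E\<^sup>2 * real X" by (simp add: mult_ac)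
  qed
  also have "\<dots> = (real J + 1) * (3 * E\<^sup>2 * real X)" by (simp add: algebra_simps)
  also have "\<dots> \<le> (2 * E * u\<^sup>2) * (3 * E\<^sup>2 * real X)"
  proof (rule mult_right_mono)
    have "real J \<le> real X / real B" unfolding J_def by (rule of_nat_div_le_of_nat)
    also have "\<dots> \<le> real X / (u\<^sup>2 / E)"
      using B_bounds E_pos u_pos by (intro divide_left_mono) auto
    also have "\<dots> = E * u\<^sup>2"
      using u_pos by (simp add: eval_nat_numeral flip: u4)
    finally have "real J \<le> E * u\<^sup>2" .
    moreover have "1 * 1 \<le> E * u\<^sup>2"
      using E1 u2 u_powers_le(4) by (intro mult_mono) auto
    ultimately show "real J + 1 \<le> 2 * E * u\<^sup>2" by linarith
  qed simp
  also have "\<dots> = 6 * E ^ 3 * u\<^sup>2 * real X"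
    by (simp add: eval_nat_numeral)
  finally show ?thesis .
qed

end

text \<open>The kernel length is X, so that replacing the zeroth coefficient by 2 \<delta> costs at
  most 1 in total. The constant 38 is 12 for the approximation error, 25 for the exponential sum and
  1 for this replacement.\<close>

lemma count_estimate:
  fixes \<alpha> \<beta> y z \<delta> E u :: real and X :: nat
  assumes u4: "u ^ 4 = real X" and u2: "2 \<le> u" and E: "1 \<le> E" "E \<le> u"
    and spacing: "\<And>l::nat. 0 < l \<Longrightarrow> E * real l \<le> u\<^sup>2 \<Longrightarrow> 1 / (E * u\<^sup>2) \<le> dist_nint (\<alpha> * real l)"
    and divisors: "\<And>n. 0 < n \<Longrightarrow> n \<le> X\<^sup>2 \<Longrightarrow> real (card {d. d dvd n}) \<le> E"
    and harm_X: "1 + 2 * harm (X\<^sup>2) \<le> E"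
    and dyadic: "\<exists>J::nat. X < 2 ^ J \<and> real J \<le> E"
    and \<delta>: "1 \<le> \<delta> * u" "3 * \<delta> \<le> 1"
    and y: "2 \<le> y" "y < u\<^sup>2" and z: "y < z"
  shows "\<bar>real (card {n \<in> S_set (real X) y z. dist_nint (\<alpha> * real n + \<beta>) < \<delta>}) - 2 * \<delta> * real (Psi (real X) y z)\<bar>
           \<le> 38 * E ^ 11 * (u ^ 3 * sqrt (3 * (u * \<delta>)))"
proof -
  have u0: "0 < u" and X16: "16 \<le> real X"
    using u2 power_mono[OF u2, of 4] u4 by auto
  have X0: "0 < X" using X16 by simp
  have \<delta>0: "0 < \<delta>"
  proof -
    have "0 < \<delta> * u" using \<delta>(1) by linarith
    then show ?thesis using u0 zero_less_mult_pos2 by blast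
  qed
  have X_\<delta>: "1 / real X \<le> \<delta>"
  proof -
    have "1 / real X \<le> 1 / u"
    proof -
      have "u ^ 1 \<le> u ^ 4" using u2 by (intro power_increasing) auto
      then show ?thesis unfolding u4[symmetric] using u0 by (intro divide_left_mono) auto
    qed
    also have "1 / u \<le> \<delta>" using \<delta>(1) u0 by (simp add: field_simps)
    finally show ?thesis .
  qed
  have \<delta>2: "\<delta> < 1 / 2" using \<delta>(2) \<delta>0 by linarith
  obtain c :: "int \<Rightarrow> complex" where c: "\<And>h. norm (c h) \<le> 2 * \<delta> + 1 / real X"
    "\<And>h. \<bar>h\<bar> < int X \<Longrightarrow> of_int \<bar>h\<bar> * norm (c h) \<le> 1"
    "norm (c 0 - 2 * \<delta>) \<le> 1 / real X"
    "\<And>t. norm (of_bool (dist_nint t < \<delta>) - (\<Sum>h\<in>{- int X<..<int X}. c h * ee (of_int h * t)))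
           \<le> (1 + 2 * harm X) * (phi (real X) (t - \<delta>) + phi (real X) (t + \<delta>)) / real X"
    using fejer_approximation[OF X0 less_imp_le[OF \<delta>0] \<delta>2] by blast
  \<comment> \<open>The shift \<beta> only rotates the coefficients and disappears from all later
    estimates.\<close>
  define cf where "cf h = c h * ee (of_int h * \<beta>)" for h
  have norm_cf: "norm (cf h) = norm (c h)" for h
    by (simp add: cf_def norm_mult)
  \<comment> \<open>The coefficients are bounded by 2 \<delta> + 1/X \<le> 3 \<delta>.\<close>
  interpret expsum \<alpha> X u E "3 * \<delta>" cf
  proof
    show "1 \<le> 3 * \<delta> * u" using \<delta>(1) by linarith
    show "norm (cf h) \<le> 3 * \<delta>" for h
      using c(1)[of h] X_\<delta> by (simp add: norm_cf)
    show "of_int \<bar>h\<bar> * norm (cf h) \<le> 1" if "\<bar>h\<bar> < int X" for h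
      using c(2)[OF that] by (simp add: norm_cf)
  qed (use assms in auto)
  define S where "S = S_set (real X) y z"
  have SX: "S \<subseteq> {1..X}"
    by (auto simp: S_def S_set_def)
  have finS: "finite S"
    using SX by (rule finite_subset) simp
  define G where "G n = (\<Sum>h\<in>{- int X<..<int X}. c h * ee (of_int h * (\<alpha> * real n + \<beta>)))" for n
  have G: "G n = c 0 + W n" for n
  proof -
    have "{- int X<..<int X} = insert 0 Hs"
      using X0 by (auto simp: Hs_def)
    moreover have "0 \<notin> Hs" by (simp add: Hs_def)
    ultimately have "G n = c 0 + (\<Sum>h\<in>Hs. c h * ee (of_int h * (\<alpha> * real n + \<beta>)))"
      unfolding G_def by simp
    also have "(\<Sum>h\<in>Hs. c h * ee (of_int h * (\<alpha> * real n + \<beta>))) = W n"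
      unfolding W_def cf_def by (intro sum.cong refl) (simp add: algebra_simps ee_add)
    finally show ?thesis .
  qed
  have "complex_of_real (real (card {n \<in> S. dist_nint (\<alpha> * real n + \<beta>) < \<delta>}) - 2 * \<delta> * real (card S))
      = (\<Sum>n\<in>S. (of_bool (dist_nint (\<alpha> * real n + \<beta>) < \<delta>) :: complex) - 2 * \<delta>)"
    using finS by (simp add: sum_subtractf Int_def mult.commute of_real_of_nat_eq conj_commute)
  also have "\<dots> = (\<Sum>n\<in>S. (of_bool (dist_nint (\<alpha> * real n + \<beta>) < \<delta>) - G n) + (W n + (c 0 - 2 * \<delta>)))"
    by (simp add: G)
  also have "\<dots> = (\<Sum>n\<in>S. of_bool (dist_nint (\<alpha> * real n + \<beta>) < \<delta>) - G n) + ((\<Sum>n\<in>S. W n) + of_nat (card S) * (c 0 - 2 * \<delta>))"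
    by (simp add: sum.distrib)
  finally have eq: "complex_of_real (real (card {n \<in> S. dist_nint (\<alpha> * real n + \<beta>) < \<delta>}) - 2 * \<delta> * real (card S))
      = (\<Sum>n\<in>S. of_bool (dist_nint (\<alpha> * real n + \<beta>) < \<delta>) - G n) + ((\<Sum>n\<in>S. W n) + of_nat (card S) * (c 0 - 2 * \<delta>))" .
  have "\<bar>real (card {n \<in> S. dist_nint (\<alpha> * real n + \<beta>) < \<delta>}) - 2 * \<delta> * real (card S)\<bar>
      = norm (complex_of_real (real (card {n \<in> S. dist_nint (\<alpha> * real n + \<beta>) < \<delta>}) - 2 * \<delta> * real (card S)))"
    by (simp only: norm_of_real)
  also have "\<dots> = norm ((\<Sum>n\<in>S. of_bool (dist_nint (\<alpha> * real n + \<beta>) < \<delta>) - G n) + ((\<Sum>n\<in>S. W n) + of_nat (card S) * (c 0 - 2 * \<delta>)))"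
    by (simp only: eq)
  also have "\<dots> \<le> 12 * E ^ 11 * F + (25 * E ^ 11 * F + 1 * E ^ 11 * F)"
  proof (intro norm_triangle_mono)
    have EF: "1 \<le> E ^ i * F" for i
    proof -
      have "1 \<le> u ^ 3" using u2 by (intro one_le_power) auto
      then have "1 \<le> F" using F_bounds(1) by linarith
      then have "1 * 1 \<le> E ^ i * F"
        using E(1) by (intro mult_mono one_le_power) auto
      then show ?thesis by simp
    qed
    show "norm (\<Sum>n\<in>S. W n) \<le> 25 * E ^ 11 * F"
      unfolding S_def by (rule norm_sum_W_S_set[OF y z])
    have "card S \<le> X" using card_mono[OF _ SX] by simp
    then have "norm (of_nat (card S) * (c 0 - 2 * \<delta>)) \<le> real X * (1 / real X)"
      unfolding norm_mult norm_of_nat by (intro mult_mono c(3)) auto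
    also have "\<dots> = 1" using X0 by simp
    also have "\<dots> \<le> 1 * E ^ 11 * F" using EF[of 11] by simp
    finally show "norm (of_nat (card S) * (c 0 - 2 * \<delta>)) \<le> 1 * E ^ 11 * F" .
    have "norm (\<Sum>n\<in>S. of_bool (dist_nint (\<alpha> * real n + \<beta>) < \<delta>) - G n)
        \<le> (\<Sum>n\<in>S. (1 + 2 * harm X) * (phi (real X) (\<alpha> * real n + \<beta> - \<delta>) + phi (real X) (\<alpha> * real n + \<beta> + \<delta>)) / real X)"
      unfolding G_def by (rule order.trans[OF norm_sum sum_mono]) (rule c(4))
    also have "\<dots> \<le> (\<Sum>n\<in>S. E * (phi (real X) (\<alpha> * real n + (\<beta> - \<delta>)) + phi (real X) (\<alpha> * real n + (\<beta> + \<delta>))) / real X)"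
    proof (intro sum_mono divide_right_mono)
      fix n
      have "X \<le> X\<^sup>2" by (simp add: power2_eq_square)
      then have "1 + 2 * harm X \<le> E" by (rule harm_bound)
      then show "(1 + 2 * harm X) * (phi (real X) (\<alpha> * real n + \<beta> - \<delta>) + phi (real X) (\<alpha> * real n + \<beta> + \<delta>))
          \<le> E * (phi (real X) (\<alpha> * real n + (\<beta> - \<delta>)) + phi (real X) (\<alpha> * real n + (\<beta> + \<delta>)))"
        unfolding add_diff_eq add.assoc[symmetric]
        by (intro mult_right_mono add_nonneg_nonneg phi_nonneg) auto
    qed simp
    also have "\<dots> \<le> (\<Sum>n\<in>{1..X}. E * (phi (real X) (\<alpha> * real n + (\<beta> - \<delta>)) + phi (real X) (\<alpha> * real n + (\<beta> + \<delta>))) / real X)"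
      using SX E(1) by (intro sum_mono2) (auto intro!: divide_nonneg_nonneg mult_nonneg_nonneg add_nonneg_nonneg phi_nonneg)
    also have "\<dots> = E * ((\<Sum>n\<in>{1..X}. phi (real X) (\<alpha> * real n + (\<beta> - \<delta>))) + (\<Sum>n\<in>{1..X}. phi (real X) (\<alpha> * real n + (\<beta> + \<delta>)))) / real X"
      by (simp only: sum_divide_distrib sum_distrib_left sum.distrib[symmetric])
    also have "\<dots> \<le> E * (6 * E ^ 3 * u\<^sup>2 * real X + 6 * E ^ 3 * u\<^sup>2 * real X) / real X"
      using E(1) by (intro divide_right_mono mult_left_mono add_mono sum_phi_upto_X) auto
    also have "\<dots> = 12 * (E ^ 4 * u\<^sup>2)"
      using X0 by (simp add: eval_nat_numeral)
    also have "\<dots> \<le> 12 * (E ^ 11 * F)"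
    proof -
      have "E ^ 4 \<le> E ^ 11" using E(1) by (intro power_increasing) auto
      moreover have "u\<^sup>2 \<le> F" using u_powers_le(5) F_bounds(1) by linarith
      ultimately show ?thesis using E(1) by (intro mult_left_mono mult_mono) auto
    qed
    finally show "norm (\<Sum>n\<in>S. of_bool (dist_nint (\<alpha> * real n + \<beta>) < \<delta>) - G n) \<le> 12 * E ^ 11 * F" by simp
  qed
  also have "\<dots> = 38 * E ^ 11 * F" by algebra
  also have "F = u ^ 3 * sqrt (3 * (u * \<delta>))" unfolding F_def by (simp add: mult_ac)
  finally show ?thesis
    by (simp add: S_def Psi_def)
qed

section \<open>Diophantine approximation\<close>

lemma cf_complete_quotient_irrational:
  assumes "\<alpha> \<notin> \<rat>"
  shows "cf_complete_quotient \<alpha> j \<notin> \<rat>"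
proof (induction j)
  case (Suc j)
  let ?t = "cf_complete_quotient \<alpha> j"
  show ?case
  proof
    assume "cf_complete_quotient \<alpha> (Suc j) \<in> \<rat>"
    then have "inverse (cf_complete_quotient \<alpha> (Suc j)) \<in> \<rat>"
      by (rule Rats_inverse)
    then have "?t - of_int \<lfloor>?t\<rfloor> \<in> \<rat>" by simp
    then have "?t - of_int \<lfloor>?t\<rfloor> + of_int \<lfloor>?t\<rfloor> \<in> \<rat>"
      by (rule Rats_add) simp
    then show False using Suc by simp
  qed
qed (use assms in simp)

text \<open>The next complete quotient 1/f is below A + 1, which bounds f from below. The same lower
  bound one index later shows that 1/f exceeds 1 + 1 / (A + 1), so f < (A + 1) / (A + 2).\<close>

lemma cf_fractional_part_bounds:
  assumes \<alpha>: "\<alpha> \<in> bounded_quotients A" and f: "f = cf_complete_quotient \<alpha> j - of_int \<lfloor>cf_complete_quotient \<alpha> j\<rfloor>"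
  shows "f * cf_complete_quotient \<alpha> (Suc j) = 1" "1 / (real A + 2) \<le> f" "1 / (real A + 2) \<le> 1 - f"
proof -
  note [simp del] = cf_complete_quotient.simps(2)
  have irr: "\<alpha> \<notin> \<rat>" and bd: "\<lfloor>cf_complete_quotient \<alpha> j\<rfloor> \<le> int A" for j
    using \<alpha> unfolding bounded_quotients_def cf_partial_quotient_def by (auto simp: abs_le_iff)
  define fr where "fr j = cf_complete_quotient \<alpha> j - of_int \<lfloor>cf_complete_quotient \<alpha> j\<rfloor>" for j
  have fr: "0 < fr j" "fr j < 1" "fr j * cf_complete_quotient \<alpha> (Suc j) = 1" for j
  proof -
    have "fr j \<noteq> 0"
    proof
      assume "fr j = 0"
      then have "cf_complete_quotient \<alpha> j = of_int \<lfloor>cf_complete_quotient \<alpha> j\<rfloor>" by (simp add: fr_def)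
      then have "cf_complete_quotient \<alpha> j \<in> \<rat>" by (metis Rats_of_int)
      then show False using cf_complete_quotient_irrational[OF irr] by blast
    qed
    then show "fr j * cf_complete_quotient \<alpha> (Suc j) = 1"
      by (simp add: fr_def cf_complete_quotient.simps(2))
    have "0 \<le> fr j" "fr j < 1" unfolding fr_def by linarith+
    then show "0 < fr j" "fr j < 1" using \<open>fr j \<noteq> 0\<close> by auto
  qed
  have low: "1 / (real A + 1) < fr j" for j
  proof -
    have "cf_complete_quotient \<alpha> (Suc j) < real A + 1"
      using bd[of "Suc j"] by linarith
    then have "fr j * cf_complete_quotient \<alpha> (Suc j) < fr j * (real A + 1)"
      using fr(1)[of j] by (rule mult_strict_left_mono)
    then show ?thesis using fr(3)[of j] by (simp add: divide_less_eq)
  qed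
  have ff: "f = fr j" by (simp add: f fr_def)
  show "f * cf_complete_quotient \<alpha> (Suc j) = 1" using fr(3)[of j] by (simp only: ff)
  have "1 / (real A + 2) \<le> 1 / (real A + 1)" by (intro divide_left_mono) auto
  then show "1 / (real A + 2) \<le> f" using low[of j] by (simp add: ff)
  have "1 \<le> \<lfloor>cf_complete_quotient \<alpha> (Suc j)\<rfloor>"
  proof -
    have "fr j * 1 < fr j * cf_complete_quotient \<alpha> (Suc j)" using fr[of j] by simp
    then have "1 < cf_complete_quotient \<alpha> (Suc j)" using fr(1)[of j] by (simp only: mult_less_cancel_left_pos)
    then show ?thesis by linarith
  qed
  then have "1 + 1 / (real A + 1) < cf_complete_quotient \<alpha> (Suc j)"
    using low[of "Suc j"] unfolding fr_def by linarith
  then have "fr j * (1 + 1 / (real A + 1)) < fr j * cf_complete_quotient \<alpha> (Suc j)"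
    using fr(1)[of j] by (rule mult_strict_left_mono)
  then have "fr j * ((real A + 2) / (real A + 1)) < 1"
    using fr(3)[of j] by (simp add: field_simps)
  then have "fr j * (real A + 2) < real A + 1" by (simp add: field_simps)
  then have "1 \<le> (1 - fr j) * (real A + 2)" by (simp add: algebra_simps)
  then show "1 / (real A + 2) \<le> 1 - f" by (simp add: ff divide_le_eq)
qed

text \<open>The factor \<open>1 + 1/l\<close> makes the induction go through: passing from \<open>\<alpha>\<^sub>j\<close> to \<open>\<alpha>\<^sub>j\<^sub>+\<^sub>1\<close> loses a factor
  \<open>1 - O(1/(l m))\<close>, which the gain \<open>(1 + 1/m) / (1 + 1/l)\<close> compensates.\<close>

lemma bounded_quotients_approximation:
  fixes l :: nat and m :: int
  assumes \<alpha>: "\<alpha> \<in> bounded_quotients A" and c: "c = 1 / (4 * (real A + 2))" and l: "0 < l"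
  shows "c / real l * (1 + 1 / real l) \<le> \<bar>real l * cf_complete_quotient \<alpha> j - of_int m\<bar>"
  using l
proof (induction l arbitrary: j m rule: less_induct)
  case (less l)
  note [simp del] = cf_complete_quotient.simps(2)
  define \<theta> where "\<theta> = cf_complete_quotient \<alpha> j"
  define f where "f = \<theta> - of_int \<lfloor>\<theta>\<rfloor>"
  define m' where "m' = m - int l * \<lfloor>\<theta>\<rfloor>"
  note fb = cf_fractional_part_bounds[OF \<alpha> f_def[unfolded \<theta>_def]]
  have c0: "0 < c" "4 * c \<le> 1" "2 * c \<le> 1 / (real A + 2)"
    unfolding c by (auto simp: field_simps)
  have l1: "1 \<le> real l" using less.prems by simp
  have "0 < 1 / (real A + 2)" by simp
  then have f01: "0 < f" "0 < 1 - f" using fb(2,3) by linarith+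
  have small: "c / real l * (1 + 1 / real l) \<le> 2 * c / real l"
  proof -
    have "c / real l * (1 + 1 / real l) \<le> c / real l * 2"
      using c0 l1 by (intro mult_left_mono) auto
    then show ?thesis by simp
  qed
  have small2: "2 * c / real l \<le> 1 / (real A + 2)"
  proof -
    have "2 * c / real l \<le> 2 * c / 1" using c0 l1 by (intro divide_left_mono) auto
    then show ?thesis using c0 by simp
  qed
  have eq: "real l * \<theta> - of_int m = real l * f - of_int m'"
    by (simp add: f_def m'_def algebra_simps)
  \<comment> \<open>For m' outside 1, ..., l - 1 the distance is at least f or 1 - f, and 2 c is at
    most both. Only the third case needs the induction.\<close>
  consider "m' \<le> 0" | "int l \<le> m'" | "0 < m'" "m' < int l" by linarith
  then have "c / real l * (1 + 1 / real l) \<le> \<bar>real l * f - of_int m'\<bar>"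
  proof cases
    case 1
    have "1 * f \<le> real l * f"
      using l1 f01 by (intro mult_right_mono) auto
    moreover have "real_of_int m' \<le> 0" using 1 by simp
    ultimately show ?thesis using fb(2) small small2 by linarith
  next
    case 2
    have "1 * (1 - f) \<le> real l * (1 - f)"
      using l1 f01 by (intro mult_right_mono) auto
    moreover have "real l \<le> real_of_int m'" using 2 by linarith
    ultimately have "1 - f \<le> of_int m' - real l * f" by (simp add: algebra_simps)
    then show ?thesis using fb(3) small small2 by linarith
  next
    case 3
    define M where "M = real_of_int m'"
    define L where "L = real l"
    have bnd: "1 \<le> M" "M + 1 \<le> L" using 3 unfolding M_def L_def by linarith+
    note f0 = f01(1)
    have nm: "real (nat m') = M" using 3 by (simp add: M_def)
    \<comment> \<open>One step of the Euclidean algorithm: since f times the next complete quotient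
      is 1, multiplication by f turns the pair (M, L) at index j + 1 into (L, M) at index j, and M <
      L.\<close>
    have "c / M * (1 + 1 / M) \<le> \<bar>M * cf_complete_quotient \<alpha> (Suc j) - L\<bar>"
      using less.IH[of "nat m'" "Suc j" "int l"] 3 nm by (simp add: L_def)
    then have "f * (c / M * (1 + 1 / M)) \<le> f * \<bar>M * cf_complete_quotient \<alpha> (Suc j) - L\<bar>"
      using f0 by (intro mult_left_mono) auto
    also have "\<dots> = \<bar>f * (M * cf_complete_quotient \<alpha> (Suc j) - L)\<bar>"
      using f0 by (simp add: abs_mult)
    also have "f * (M * cf_complete_quotient \<alpha> (Suc j) - L) = M - L * f"
      using fb(1) by (simp add: algebra_simps)
    finally have ge: "f * (c / M * (1 + 1 / M)) \<le> \<bar>L * f - M\<bar>" by (simp add: abs_minus_commute)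
    have "c / L * (1 + 1 / L) \<le> \<bar>L * f - M\<bar>"
    proof (rule ccontr)
      assume "\<not> c / L * (1 + 1 / L) \<le> \<bar>L * f - M\<bar>"
      then have lt: "\<bar>L * f - M\<bar> < c / L * (1 + 1 / L)" by simp
      then have "M - 2 * c / L < L * f"
        using small unfolding L_def[symmetric] by linarith
      moreover have "2 * c / L \<le> 1 / (2 * L)"
        using c0 bnd by (simp add: field_simps)
      ultimately have Lf: "M - 1 / (2 * L) \<le> L * f" by linarith
      \<comment> \<open>Multiplied by L, the claim reads M^2 + (M + 1)/2 \<le> M L after
        cancellation. It follows from M \<le> M (L - M) and (M + 1)/2 \<le> M.\<close>
      have "M * M * (1 + 1 / L) \<le> (M - 1 / (2 * L)) * (M + 1)"
      proof -
        have "M * 1 \<le> M * (L - M)" using bnd by (intro mult_left_mono) auto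
        moreover have "M * (L - M) = M * L - M * M" by (simp add: algebra_simps)
        moreover have "(M + 1) / 2 \<le> M" using bnd by simp
        ultimately have "M * M + (M + 1) / 2 \<le> M * L" by linarith
        then have "(M * M + (M + 1) / 2) / L \<le> M * L / L" using bnd by (intro divide_right_mono) auto
        then have 1: "M * M / L + (M + 1) / 2 / L \<le> M"
          using bnd by (simp add: add_divide_distrib)
        have 2: "M * M * (1 + 1 / L) = M * M + M * M / L"
          by (simp add: distrib_left)
        have 3: "(M - 1 / (2 * L)) * (M + 1) = M * M + (M - (M + 1) / 2 / L)"
          using bnd by (simp add: field_simps)
        have "b \<le> r - s" if "b + s \<le> r" for b r s :: real using that by simp
        then show ?thesis unfolding 2 3 using 1 by (intro add_left_mono) blast
      qed
      also have "\<dots> \<le> L * f * (M + 1)" using Lf bnd by (intro mult_right_mono) auto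
      finally have *: "M * M * (1 + 1 / L) \<le> L * f * (M + 1)" .
      have "c / L * (1 + 1 / L) = c / (L * (M * M)) * (M * M * (1 + 1 / L))"
        using bnd by (simp add: field_simps)
      also have "\<dots> \<le> c / (L * (M * M)) * (L * f * (M + 1))"
        using c0 bnd by (intro mult_left_mono *) auto
      also have "\<dots> = f * (c / M * (1 + 1 / M))"
        using bnd by (simp add: field_simps)
      finally show False using ge lt by linarith
    qed
    then show ?thesis by (simp add: M_def L_def)
  qed
  then show ?case unfolding \<theta>_def[symmetric] eq .
qed

lemma bounded_quotients_dist_nint:
  fixes l :: nat
  assumes "\<alpha> \<in> bounded_quotients A" "0 < l"
  shows "1 / (4 * (real A + 2)) / real l \<le> dist_nint (\<alpha> * real l)"
proof -
  obtain v :: int where v: "dist_nint (\<alpha> * real l) = \<bar>\<alpha> * real l - of_int v\<bar>"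
    using dist_nint_attained by blast
  define c where "c = 1 / (4 * (real A + 2))"
  have "c / real l * 1 \<le> c / real l * (1 + 1 / real l)"
    by (intro mult_left_mono) (auto simp: c_def)
  also have "\<dots> \<le> \<bar>real l * cf_complete_quotient \<alpha> 0 - of_int v\<bar>"
    by (rule bounded_quotients_approximation[OF assms(1) c_def assms(2)])
  finally show ?thesis using v by (simp add: c_def mult.commute)
qed

text \<open>As h is coprime to q and 0 < l < q, the fraction h l / q is at least 1/q away from the
  integers. Replacing h/q by \<alpha> moves it by at most l / q^2 \<le> 1 / (E q), which is at most
  half of that.\<close>

lemma approx_set_dist_nint:
  fixes l q :: nat and E :: real
  assumes q: "(h, int q) \<in> approx_set \<alpha>" and E: "2 \<le> E" and l: "0 < l" "E * real l \<le> real q"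
  shows "1 / (E * real q) \<le> dist_nint (\<alpha> * real l)"
proof -
  have q0: "0 < q" "coprime h (int q)" "\<bar>\<alpha> - of_int h / real q\<bar> < 1 / (real q)\<^sup>2"
    using q by (auto simp: approx_set_def)
  obtain v :: int where v: "dist_nint (\<alpha> * real l) = \<bar>\<alpha> * real l - of_int v\<bar>"
    using dist_nint_attained by blast
  have "2 * real l \<le> E * real l" using E by (intro mult_right_mono) auto
  then have lq: "l < q" using l by linarith
  have "\<not> int q dvd h * int l"
  proof
    assume "int q dvd h * int l"
    then have "int q dvd int l"
      using q0(2) by (simp add: coprime_commute coprime_dvd_mult_right_iff)
    then have "q \<le> l" using l(1) by (simp add: dvd_imp_le)
    then show False using lq by simp
  qed
  then have "1 / real_of_int (int q) \<le> dist_nint (of_int (h * int l) / of_int (int q))"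
    using q0 by (intro dist_nint_fraction_ge) auto
  also have "\<dots> \<le> \<bar>of_int h / real q * real l - of_int v\<bar>"
    using dist_nint_le[of "of_int (h * int l) / of_int (int q)" v] by simp
  finally have 1: "1 / real q \<le> \<bar>of_int h / real q * real l - of_int v\<bar>" by simp
  have "\<bar>\<alpha> * real l - of_int h / real q * real l\<bar> = \<bar>\<alpha> - of_int h / real q\<bar> * real l"
    by (simp only: left_diff_distrib[symmetric] abs_mult abs_of_nat)
  also have "\<dots> \<le> 1 / (real q)\<^sup>2 * (real q / E)"
    using q0(3) l E by (intro mult_mono) (auto simp: field_simps)
  also have "\<dots> = 1 / (E * real q)"
    using q0(1) E by (simp add: power2_eq_square)
  finally have 2: "\<bar>\<alpha> * real l - of_int h / real q * real l\<bar> \<le> 1 / (E * real q)" .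
  have "2 * (1 / (E * real q)) \<le> 1 / real q"
    using E q0(1) by (simp add: field_simps)
  then show ?thesis using v 1 2 by linarith
qed

section \<open>The asymptotic formula\<close>

lemma asymptotic_formula_from_spacing:
  fixes B :: "real set" and x :: "nat \<Rightarrow> nat"
  assumes x: "filterlim x at_top sequentially"
    and spacing: "\<And>\<eta>. 0 < \<eta> \<Longrightarrow> \<forall>\<^sub>F k in sequentially. \<forall>\<alpha>\<in>B. \<forall>l::nat. 0 < l \<and>
         real (x k) powr \<eta> * real l \<le> real (x k) powr (1 / 2) \<longrightarrow>
         1 / (real (x k) powr \<eta> * real (x k) powr (1 / 2)) \<le> dist_nint (\<alpha> * real l)"
  shows "asymptotic_formula B \<beta> x"
  unfolding asymptotic_formula_def
proof (intro allI impI)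
  fix \<epsilon> \<eta> :: real assume \<epsilon>\<eta>: "0 < \<epsilon> \<and> \<epsilon> < 1 / 4 \<and> 0 < \<eta>"
  \<comment> \<open>With E = X^\<kappa>, the factor E^11 of \<open>count_estimate\<close> must not
    exceed X^\<eta>, and E \<le> u = X^(1/4) is required.\<close>
  define \<kappa> where "\<kappa> = min (1 / 4) (\<eta> / 11)"
  have \<kappa>: "0 < \<kappa>" "\<kappa> \<le> 1 / 4" "11 * \<kappa> \<le> \<eta>"
    using \<epsilon>\<eta> by (auto simp: \<kappa>_def min_def)
  \<comment> \<open>The divisor bound is applied up to X^2, so \<kappa>/4 costs X^(\<kappa>/2) and
    leaves X^(\<kappa>/2) for the constant \<open>D\<close>.\<close>
  obtain D where D: "\<And>n. 0 < n \<Longrightarrow> real (card {d. d dvd n}) \<le> D * real n powr (\<kappa> / 4)"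
    using divisor_bound[of "\<kappa> / 4"] \<kappa>(1) by auto
  have "\<forall>\<^sub>F X::nat in at_top. 16 \<le> X" by (rule eventually_ge_at_top)
  moreover have "\<forall>\<^sub>F X::nat in at_top. D \<le> real X powr (\<kappa> / 2)"
  proof -
    have "filterlim (\<lambda>X::nat. real X powr (\<kappa> / 2)) at_top at_top"
      using \<kappa>(1) by real_asymp
    then show ?thesis by (simp add: filterlim_at_top)
  qed
  moreover have "\<forall>\<^sub>F X::nat in at_top. 1 + 2 * (ln ((real X)\<^sup>2) + 1) \<le> real X powr \<kappa>"
    using \<kappa>(1) by real_asymp
  moreover have "\<forall>\<^sub>F X::nat in at_top. log 2 (real X) + 1 \<le> real X powr \<kappa>"
    using \<kappa>(1) by real_asymp
  moreover have "\<forall>\<^sub>F X::nat in at_top. 3 * real X powr (- 1 / 4 + \<epsilon>) \<le> 1"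
    using \<epsilon>\<eta> by real_asymp
  ultimately have "\<forall>\<^sub>F X::nat in at_top. 16 \<le> X \<and> D \<le> real X powr (\<kappa> / 2) \<and>
      1 + 2 * (ln ((real X)\<^sup>2) + 1) \<le> real X powr \<kappa> \<and> log 2 (real X) + 1 \<le> real X powr \<kappa> \<and>
      3 * real X powr (- 1 / 4 + \<epsilon>) \<le> 1"
    by eventually_elim simp
  then have ev: "\<forall>\<^sub>F k in sequentially. 16 \<le> x k \<and> D \<le> real (x k) powr (\<kappa> / 2) \<and>
      1 + 2 * (ln ((real (x k))\<^sup>2) + 1) \<le> real (x k) powr \<kappa> \<and> log 2 (real (x k)) + 1 \<le> real (x k) powr \<kappa> \<and>
      3 * real (x k) powr (- 1 / 4 + \<epsilon>) \<le> 1"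
    using x by (rule eventually_compose_filterlim)
  show "\<exists>C. \<forall>\<^sub>F k in sequentially. \<forall>\<alpha>\<in>B. \<forall>y z \<delta> :: real.
          2 \<le> y \<and> y < real (x k) powr (1 / 2) \<and> y < z \<and> z \<le> real (x k) \<and>
          \<delta> = real (x k) powr (- 1 / 4 + \<epsilon>) \<longrightarrow>
          \<bar>real (card {n \<in> S_set (x k) y z. dist_nint (\<alpha> * real n + \<beta>) < \<delta>})
             - 2 * \<delta> * real (Psi (x k) y z)\<bar>
            \<le> C * real (x k) powr (3 / 4 + \<epsilon> / 2 + \<eta>)"
  \<comment> \<open>38 comes from \<open>count_estimate\<close>, the root from d0 = 3 \<delta>. All
    other dependence sits in the threshold for k.\<close>
  proof (rule exI[of _ "38 * sqrt 3"])
    show "\<forall>\<^sub>F k in sequentially. \<forall>\<alpha>\<in>B. \<forall>y z \<delta> :: real.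
          2 \<le> y \<and> y < real (x k) powr (1 / 2) \<and> y < z \<and> z \<le> real (x k) \<and>
          \<delta> = real (x k) powr (- 1 / 4 + \<epsilon>) \<longrightarrow>
          \<bar>real (card {n \<in> S_set (x k) y z. dist_nint (\<alpha> * real n + \<beta>) < \<delta>})
             - 2 * \<delta> * real (Psi (x k) y z)\<bar>
            \<le> 38 * sqrt 3 * real (x k) powr (3 / 4 + \<epsilon> / 2 + \<eta>)"
      using ev spacing[OF \<kappa>(1)]
    proof eventually_elim
      case (elim k)
      define X where "X = x k"
      define u where "u = real X powr (1 / 4)"
      define E where "E = real X powr \<kappa>"
      have X: "16 \<le> X" "D \<le> real X powr (\<kappa> / 2)" "1 + 2 * (ln ((real X)\<^sup>2) + 1) \<le> E"
        "log 2 (real X) + 1 \<le> E" "3 * real X powr (- 1 / 4 + \<epsilon>) \<le> 1"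
        using elim(1) by (auto simp: X_def E_def)
      have X1: "1 \<le> real X" and X0: "0 < X" using X(1) by auto
      have u2p: "u\<^sup>2 = real X powr (1 / 2)" and u3p: "u ^ 3 = real X powr (3 / 4)"
        and u4: "u ^ 4 = real X"
        using X0 by (simp_all add: u_def powr_power)
      have u2: "2 \<le> u"
      proof (rule ccontr)
        assume "\<not> 2 \<le> u"
        then have "u ^ 4 < 2 ^ 4" by (intro power_strict_mono) (auto simp: u_def)
        then show False using u4 X(1) by simp
      qed
      have E: "1 \<le> E" "E \<le> u"
        using X1 \<kappa> by (auto simp: E_def u_def intro!: ge_one_powr_ge_zero powr_mono)
      have divisors: "real (card {d. d dvd n}) \<le> E" if n: "0 < n" "n \<le> X\<^sup>2" for n
      proof -
        have "1 \<le> D" using D[of 1] by simp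
        have "real n \<le> real (X\<^sup>2)" using n(2) by (simp only: of_nat_le_iff)
        then have "real n powr (\<kappa> / 4) \<le> ((real X)\<^sup>2) powr (\<kappa> / 4)"
          using \<kappa>(1) by (intro powr_mono2) auto
        also have "\<dots> = real X powr (\<kappa> / 2)"
          using X0 by (simp add: powr_powr flip: powr_numeral)
        finally have "D * real n powr (\<kappa> / 4) \<le> real X powr (\<kappa> / 2) * real X powr (\<kappa> / 2)"
          using X(2) \<open>1 \<le> D\<close> by (intro mult_mono) auto
        also have "\<dots> = E" by (simp add: E_def flip: powr_add)
        finally show ?thesis using D[OF n(1)] by linarith
      qed
      have harm: "1 + 2 * harm (X\<^sup>2) \<le> E"
      proof -
        have "harm (X\<^sup>2) - ln (real (X\<^sup>2)) \<le> harm 1 - ln (real 1)"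
          using X0 by (intro euler_mascheroni_sequence_decreasing) (auto simp: Suc_le_eq)
        then have "(harm (X\<^sup>2) :: real) \<le> ln ((real X)\<^sup>2) + 1" by (simp add: harm_expand)
        then have "1 + 2 * harm (X\<^sup>2) \<le> 1 + 2 * (ln ((real X)\<^sup>2) + 1)"
          by (intro add_left_mono mult_left_mono) auto
        then show ?thesis using X(3) by (rule order.trans)
      qed
      have dyadic: "\<exists>J::nat. X < 2 ^ J \<and> real J \<le> E"
      proof (intro exI[of _ "Suc (dyadic_log X)"] conjI)
        show "X < 2 ^ Suc (dyadic_log X)" using dyadic_log(2)[OF X0] by simp
        have "real (dyadic_log X) \<le> log 2 (real X)"
          using dyadic_log(1)[OF X0] by (rule le_log2_of_power)
        then show "real (Suc (dyadic_log X)) \<le> E" using X(4) by simp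
      qed
      show ?case
      proof (intro ballI allI impI)
        fix \<alpha> y z \<delta> :: real
        assume \<alpha>: "\<alpha> \<in> B" and a: "2 \<le> y \<and> y < real (x k) powr (1 / 2) \<and> y < z \<and> z \<le> real (x k) \<and>
          \<delta> = real (x k) powr (- 1 / 4 + \<epsilon>)"
        have \<delta>: "\<delta> = real X powr (- 1 / 4 + \<epsilon>)" using a by (simp add: X_def)
        have u\<delta>: "u * \<delta> = real X powr \<epsilon>"
          by (simp add: \<delta> u_def flip: powr_add)
        have "\<bar>real (card {n \<in> S_set (real X) y z. dist_nint (\<alpha> * real n + \<beta>) < \<delta>}) - 2 * \<delta> * real (Psi (real X) y z)\<bar>
           \<le> 38 * E ^ 11 * (u ^ 3 * sqrt (3 * (u * \<delta>)))"
        proof (rule count_estimate[OF u4 u2 E _ divisors harm dyadic])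
          show "1 / (E * u\<^sup>2) \<le> dist_nint (\<alpha> * real l)" if "0 < l" "E * real l \<le> u\<^sup>2" for l
            using elim(2) \<alpha> that unfolding u2p E_def X_def by blast
          show "1 \<le> \<delta> * u" using X1 \<epsilon>\<eta> u\<delta> by (simp add: mult.commute ge_one_powr_ge_zero)
          show "3 * \<delta> \<le> 1" using X(5) by (simp add: \<delta>)
          show "2 \<le> y" "y < u\<^sup>2" "y < z" using a by (auto simp: u2p X_def)
        qed
        also have "38 * E ^ 11 * (u ^ 3 * sqrt (3 * (u * \<delta>))) = 38 * sqrt 3 * real X powr (11 * \<kappa> + 3 / 4 + \<epsilon> / 2)"
        proof -
          have "E ^ 11 = real X powr (11 * \<kappa>)"
            using X0 by (simp add: E_def powr_power mult.commute)
          moreover have "sqrt (real X powr \<epsilon>) = real X powr (\<epsilon> / 2)"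
            by (simp add: powr_powr flip: powr_half_sqrt)
          ultimately show ?thesis
            by (simp add: u\<delta> u3p real_sqrt_mult powr_add)
        qed
        also have "\<dots> \<le> 38 * sqrt 3 * real X powr (3 / 4 + \<epsilon> / 2 + \<eta>)"
          using X1 \<kappa>(3) by (intro mult_left_mono powr_mono) auto
        finally show "\<bar>real (card {n \<in> S_set (x k) y z. dist_nint (\<alpha> * real n + \<beta>) < \<delta>})
             - 2 * \<delta> * real (Psi (x k) y z)\<bar> \<le> 38 * sqrt 3 * real (x k) powr (3 / 4 + \<epsilon> / 2 + \<eta>)"
          by (simp add: X_def)
      qed
    qed
  qed
qed

text \<open>Here \<parallel>\<alpha> l\<parallel> \<ge> c / l at every scale with c depending only
  on A. A small power of k exceeds 1/c eventually, which gives the spacing uniformly in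
  \<alpha>.\<close>

lemma asymptotic_formula_bounded_quotients: "asymptotic_formula (bounded_quotients A) \<beta> (\<lambda>k. k)"
proof (rule asymptotic_formula_from_spacing)
  show "filterlim (\<lambda>k::nat. k) at_top sequentially" by (rule filterlim_ident)
  fix \<eta> :: real assume \<eta>: "0 < \<eta>"
  define c where "c = 1 / (4 * (real A + 2))"
  have c0: "0 < c" "c \<le> 1" by (auto simp: c_def)
  have "filterlim (\<lambda>k::nat. real k powr \<eta>) at_top sequentially"
    using \<eta> by real_asymp
  then have "\<forall>\<^sub>F k::nat in sequentially. 1 / c \<le> real k powr \<eta>"
    by (simp add: filterlim_at_top)
  moreover have "\<forall>\<^sub>F k::nat in sequentially. 0 < k"
    by (rule eventually_gt_at_top)
  ultimately show "\<forall>\<^sub>F k in sequentially. \<forall>\<alpha>\<in>bounded_quotients A. \<forall>l::nat. 0 < l \<and>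
         real k powr \<eta> * real l \<le> real k powr (1 / 2) \<longrightarrow>
         1 / (real k powr \<eta> * real k powr (1 / 2)) \<le> dist_nint (\<alpha> * real l)"
  proof eventually_elim
    case (elim k)
    define E where "E = real k powr \<eta>"
    define v where "v = real k powr (1 / 2)"
    have v0: "0 < v" using elim(2) by (simp add: v_def)
    have cE: "1 \<le> c * E" using elim(1) c0 by (simp add: E_def field_simps)
    have "c * E \<le> 1 * E" using c0(2) by (intro mult_right_mono) (auto simp: E_def)
    then have E1: "1 \<le> E" using cE by simp
    have "1 / (E * v) \<le> dist_nint (\<alpha> * real l)"
      if "\<alpha> \<in> bounded_quotients A" "0 < l" "E * real l \<le> v" for \<alpha> and l :: nat
    proof -
      have "1 / (E * v) \<le> 1 / v"
        using E1 v0 by (simp add: field_simps)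
      also have "\<dots> \<le> c * E / v"
        using cE v0 by (intro divide_right_mono) auto
      also have "\<dots> \<le> c * E / (E * real l)"
        using that E1 v0 c0 by (intro divide_left_mono) auto
      also have "\<dots> = c / real l" using E1 by simp
      also have "\<dots> \<le> dist_nint (\<alpha> * real l)"
        unfolding c_def by (rule bounded_quotients_dist_nint[OF that(1,2)])
      finally show ?thesis .
    qed
    then show ?case unfolding E_def v_def by blast
  qed
qed

text \<open>The sequence consists of the squares of the denominators q for which some reduced
  fraction h/q is within 1/q^2 of \<alpha>; irrationality makes them infinite in number. Then
  x_k^(1/2) = q is exactly the scale of \<open>approx_set_dist_nint\<close>.\<close>

lemma asymptotic_formula_irrational:
  assumes "\<alpha> \<notin> \<rat>"
  obtains x :: "nat \<Rightarrow> nat" where "strict_mono x" "\<And>k. 0 < x k" "asymptotic_formula {\<alpha>} \<beta> x"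
proof
  define Q where "Q = {q::nat. \<exists>h. (h, int q) \<in> approx_set \<alpha>}"
  have inf: "infinite Q"
    unfolding infinite_nat_iff_unbounded
  proof
    fix m :: nat
    have "infinite (approx_set \<alpha>)"
      using assms rational_iff_finite_approx_set by blast
    then obtain h k where hk: "(h, k) \<in> approx_set \<alpha>" "int m < k"
      using infinite_approx_set[of \<alpha> "int m"] by blast
    then have "int (nat k) = k" "m < nat k" by auto
    then show "\<exists>n>m. n \<in> Q" using hk(1) unfolding Q_def by (intro exI[of _ "nat k"]) auto
  qed
  define q where "q = enumerate Q"
  have qQ: "q k \<in> Q" for k
    unfolding q_def by (rule enumerate_in_set[OF inf])
  have q0: "0 < q k" for k
    using qQ[of k] by (auto simp: Q_def approx_set_def)
  show mono: "strict_mono (\<lambda>k. (q k)\<^sup>2)"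
  proof (rule strict_monoI)
    fix i j :: nat assume "i < j"
    then have "q i < q j" unfolding q_def by (rule enumerate_mono[OF _ inf])
    then show "(q i)\<^sup>2 < (q j)\<^sup>2" by (intro power_strict_mono) auto
  qed
  show "0 < (q k)\<^sup>2" for k using q0[of k] by simp
  have lim: "filterlim (\<lambda>k. (q k)\<^sup>2) at_top sequentially"
    using mono by (rule filterlim_subseq)
  show "asymptotic_formula {\<alpha>} \<beta> (\<lambda>k. (q k)\<^sup>2)"
  proof (rule asymptotic_formula_from_spacing[OF lim])
    fix \<eta> :: real assume \<eta>: "0 < \<eta>"
    have "filterlim (\<lambda>X::nat. real X powr \<eta>) at_top at_top"
      using \<eta> by real_asymp
    then have "\<forall>\<^sub>F X::nat in at_top. 2 \<le> real X powr \<eta>"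
      by (simp add: filterlim_at_top)
    then have "\<forall>\<^sub>F k in sequentially. 2 \<le> real ((q k)\<^sup>2) powr \<eta>"
      using lim by (rule eventually_compose_filterlim)
    then show "\<forall>\<^sub>F k in sequentially. \<forall>\<alpha>'\<in>{\<alpha>}. \<forall>l::nat. 0 < l \<and>
         real ((q k)\<^sup>2) powr \<eta> * real l \<le> real ((q k)\<^sup>2) powr (1 / 2) \<longrightarrow>
         1 / (real ((q k)\<^sup>2) powr \<eta> * real ((q k)\<^sup>2) powr (1 / 2)) \<le> dist_nint (\<alpha>' * real l)"
    proof eventually_elim
      case (elim k)
      obtain h where h: "(h, int (q k)) \<in> approx_set \<alpha>"
        using qQ[of k] by (auto simp: Q_def)
      have "real ((q k)\<^sup>2) powr (1 / 2) = real (q k)"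
        by (simp add: powr_half_sqrt)
      then show ?case
        using approx_set_dist_nint[OF h elim] by simp
    qed
  qed
qed

theorem theorem1:
  fixes \<alpha> \<beta> :: real
  assumes "\<alpha> \<notin> \<rat>"
  shows "(\<exists>x :: nat \<Rightarrow> nat. strict_mono x \<and> (\<forall>k. 0 < x k) \<and> asymptotic_formula {\<alpha>} \<beta> x)
       \<and> (\<forall>A :: nat. 0 < A \<longrightarrow> asymptotic_formula (bounded_quotients A) \<beta> (\<lambda>k. k))"
proof
  show "\<exists>x :: nat \<Rightarrow> nat. strict_mono x \<and> (\<forall>k. 0 < x k) \<and> asymptotic_formula {\<alpha>} \<beta> x"
    using asymptotic_formula_irrational[OF assms, of \<beta>] by metis
  show "\<forall>A :: nat. 0 < A \<longrightarrow> asymptotic_formula (bounded_quotients A) \<beta> (\<lambda>k. k)"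
    by (intro allI impI asymptotic_formula_bounded_quotients)
qed

end
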